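(* Let $n\geq 4$ and $1\leq q<\infty$, $1\le p\le\infty$. The maximal operator $A_*$ is bounded from $\ell^{p}(\mathbb{Z})\times\cdots\times\ell^{p}(\mathbb{Z})$ ($n$ factors) to $\ell^{q}(\mathbb{Z})$, i.e. there is a constant $C$ such that \[\|A_*[f_1,\dots,f_n]\|_{\ell^q(\mathbb{Z})}\leq C\prod_{i=1}^n\|f_i\|_{\ell^p(\mathbb{Z})}\quad\text{for all } f_1,\dots,f_n:\mathbb{Z}\to\mathbb{C},\] if and only if $n\geq 5$ and $1\leq p\leq nq$.
   Context: Fix an integer $n\geq 4$. For an integer $\lambda\geq1$ let $r(\lambda)=\#\{x=(x_1,\dots,x_n)\in\mathbb{Z}^n: x_1^2+\cdots+x_n^2=\lambda\}$ (which is positive for all $\lambda\ge1$ when $n\ge4$). For functions $f_1,\dots,f_n:\mathbb{Z}\to\mathbb{C}$ and $y\in\mathbb{Z}$ define the multilinear spherical averages \[A_\lambda[f_1,\dots,f_n](y)=\frac{1}{r(\lambda)}\sum_{x\in\mathbb{Z}^n,\ |x|^2=\lambda} f_1(y-x_1)\cdots f_n(y-x_n),\] where $|x|^2=x_1^2+\cdots+x_n^2$, and the maximal operator \[A_*[f_1,\dots,f_n](y)=\sup_{\lambda\in\mathbb{Z},\,\lambda\geq1}\big|A_\lambda[f_1,\dots,f_n](y)\big|.\] *)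

theory Defs
  imports "HOL-Analysis.Analysis"
begin

definition sphere_pts :: "nat \<Rightarrow> int \<Rightarrow> (nat \<Rightarrow> int) set" where
  "sphere_pts n lam = {x. (\<forall>i\<ge>n. x i = 0) \<and> (\<Sum>i<n. (x i)^2) = lam}"

definition r_count :: "nat \<Rightarrow> int \<Rightarrow> nat" where
  "r_count n lam = card (sphere_pts n lam)"

text \<open>Multilinear spherical average; the functions f_1..f_n are f 0, ..., f (n-1).\<close>
definition sph_avg :: "nat \<Rightarrow> int \<Rightarrow> (nat \<Rightarrow> int \<Rightarrow> complex) \<Rightarrow> int \<Rightarrow> complex" where
  "sph_avg n lam f y =
     (1 / of_nat (r_count n lam)) * (\<Sum>x\<in>sphere_pts n lam. \<Prod>i<n. f i (y - x i))"

definition sph_max :: "nat \<Rightarrow> (nat \<Rightarrow> int \<Rightarrow> complex) \<Rightarrow> int \<Rightarrow> real" where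
  "sph_max n f y = (SUP lam\<in>{1..}. norm (sph_avg n lam f y))"

definition in_lp :: "ereal \<Rightarrow> (int \<Rightarrow> 'a::real_normed_vector) \<Rightarrow> bool" where
  "in_lp p f = (if p = \<infinity> then bdd_above (range (\<lambda>x. norm (f x)))
               else (\<lambda>x. norm (f x) powr real_of_ereal p) summable_on UNIV)"

definition lp_norm :: "ereal \<Rightarrow> (int \<Rightarrow> 'a::real_normed_vector) \<Rightarrow> real" where
  "lp_norm p f = (if p = \<infinity> then (SUP x. norm (f x))
                 else (\<Sum>\<^sub>\<infinity>x. norm (f x) powr real_of_ereal p) powr (1 / real_of_ereal p))"

end

theory Submission
  imports Defs
begin

text \<open>
  Write \<open>N\<close> for the integer part of the square root of \<open>\<lambda>\<close>. For \<open>n \<ge> 5\<close> everything follows from a pointwise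
  inequality: the average over the sphere is at most a constant times the product over \<open>i\<close> of the
  \<open>L^s\<close> means of \<open>f_i\<close> over \<open>[y - N, y + N]\<close>, with \<open>s = 3n/4 < n\<close>. Since \<open>s < n\<close>, Hoelder's inequality in \<open>y\<close> and the
  Hardy--Littlewood maximal theorem on \<open>\<int>\<close> give the bound for \<open>p = nq\<close>, and the embedding of the \<open>l^p\<close> spaces
  gives it for all smaller \<open>p\<close>.

  A cyclic use of Hoelder's inequality reduces the pointwise inequality to functions of two coordinates
  \<open>F(x_i) G(x_j)\<close>. The other \<open>n - 2 \<ge> 3\<close> coordinates are given smooth weights, so that their exponential sum \<open>S\<close>
  satisfies a Weyl bound without logarithms. This majorises \<open>|S|^3\<close> near \<open>a/Q\<close> by \<open>Q^{-3/2}\<close> times an integrable bump.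
  Summing over \<open>a\<close> turns the integral of \<open>|S|^3\<close> times the squared exponential sum of \<open>F\<close> into a sum of \<open>F(m) F(m')\<close> against
  the sum of \<open>Q^{-1/2}\<close> over the divisors \<open>Q\<close> of \<open>m^2 - m'^2\<close>, whose third moment is bounded on average. The circle is replaced
  by the \<open>M\<close>-th roots of unity for a highly divisible \<open>M\<close>, so that only finite sums occur.

  The lower bound \<open>r(\<lambda>) \<ge> c N^{n-2}\<close> comes from the formula \<open>16 \<sigma>(u)\<close> for the number of representations of \<open>4u\<close>
  (\<open>u\<close> odd) as a sum of four odd squares. Both sides satisfy the recursion that \<open>\<theta>^4\<close> inherits
  from \<open>\<theta> (\<theta>^4)' = 4 \<theta>^4 \<theta>'\<close>; for the divisor sum this is an identity of Liouville type.

  If \<open>n = 4\<close>, then \<open>r(4^k)\<close> is bounded and delta functions give \<open>A_*(2^k) \<ge> c\<close>; if \<open>p > nq\<close>, indicator functions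
  of long intervals contradict the bound already at \<open>\<lambda> = 1\<close>.
\<close>

section \<open>Representations by four squares\<close>

text \<open>The maximal inequality leaves no room for logarithms, and this dictates the choices. The
  cube of |S| is the largest power available in every dimension n >= 5. Its bound Q^{-3/2}, summed
  over the Q numerators a, leaves Q^{-1/2} for each divisor Q of m^2 - m'^2, so the kernel is of
  type sigma_{-1/2} and bounded on average. With |S|^2, all that four dimensions offer, it would be
  the plain divisor function, whose mean grows logarithmically. The third moment of the kernel is
  paired by Hoelder with F(m) F(m') in l^{3/2}. In the cyclic argument F is a power h^{n/2}, and the
  l^{3/2} sum of such a power involves h^{3n/4}: this is the origin of s. The maximal theorem is
  then needed for the exponent nq/s = 4q/3, which exceeds 1 even if q = 1. In the lower bound for r,
  four-square counts are used at odd integers only. Along powers of 4 they stay bounded, which is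
  the obstruction in dimension four; a fifth coordinate of suitable parity avoids it.\<close>

definition odd_quads :: "int \<Rightarrow> (int \<times> int \<times> int) set" where
  "odd_quads n = {(i, d, e). odd i \<and> odd d \<and> odd e \<and> 0 < d \<and> 0 < e \<and> i\<^sup>2 + 4 * d * e = n}"

lemma int_le_square: "\<bar>i\<bar> \<le> (i::int)\<^sup>2"
proof (cases "i = 0")
  case False
  then have "\<bar>i\<bar> * 1 \<le> \<bar>i\<bar> * \<bar>i\<bar>" by (intro mult_left_mono) auto
  then show ?thesis by (simp add: power2_eq_square)
qed simp

lemma finite_odd_quads: "finite (odd_quads n)"
proof (rule finite_subset)
  show "odd_quads n \<subseteq> {-n..n} \<times> {1..n} \<times> {1..n}"
  proof clarify
    fix i d e assume "(i, d, e) \<in> odd_quads n"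
    then have *: "0 < d" "0 < e" "i\<^sup>2 + 4 * (d * e) = n" by (auto simp: odd_quads_def)
    then have "d * 1 \<le> d * e" "1 * e \<le> d * e" by (intro mult_mono; simp)+
    moreover have "\<bar>i\<bar> \<le> i\<^sup>2" by (rule int_le_square)
    ultimately have "-n \<le> i" "i \<le> n" "1 \<le> d" "d \<le> n" "1 \<le> e" "e \<le> n" using * by linarith+
    then show "i \<in> {-n..n} \<and> (d, e) \<in> {1..n} \<times> {1..n}" by simp
  qed
qed simp

lemma odd_square_mod_8: "odd (i::int) \<Longrightarrow> i\<^sup>2 mod 8 = 1"
proof -
  assume "odd i"
  then obtain k where k: "i = 2 * k + 1" by (elim oddE)
  have "even (k * (k + 1))" by simp
  then obtain l where l: "k * (k + 1) = 2 * l" by (elim evenE)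
  have "i\<^sup>2 = 8 * l + 1" using l by (simp add: k power2_eq_square algebra_simps)
  then show ?thesis by simp
qed

text \<open>Since y^2 = 1 mod 8, the congruence n = 5 mod 8 forces (X^2 - z^2)/4 to be odd. This
  excludes the boundary case X = z between the regions of the next identity and makes the parameter
  (X + z)/2 odd.\<close>

lemma half_sum_odd:
  fixes X y z n :: int
  assumes "even X" "even z" "odd y" "n = y\<^sup>2 + X\<^sup>2 - z\<^sup>2" "n mod 8 = 5"
  shows "odd ((X + z) div 2)" "X \<noteq> z" "X \<noteq> - z"
proof -
  obtain a b where ab: "X = 2 * a" "z = 2 * b" using assms by (auto elim!: evenE)
  have "y\<^sup>2 mod 8 = 1" using assms by (intro odd_square_mod_8)
  moreover have "n = y\<^sup>2 + 4 * (a\<^sup>2 - b\<^sup>2)" using assms(4) by (simp add: ab power_mult_distrib)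
  moreover have "odd t" if "w mod 8 = 1" "n = w + 4 * t" for w t :: int
  proof
    assume "even t"
    then obtain s where "t = 2 * s" by (elim evenE)
    then show False using that assms(5) by simp
  qed
  ultimately have "odd (a\<^sup>2 - b\<^sup>2)" by blast
  then have o: "odd (a + b)" by simp
  then show "odd ((X + z) div 2)" by (simp add: ab)
  show "X \<noteq> z" "X \<noteq> - z" using o by (auto simp: ab)
qed

text \<open>The triples \<open>(X, y, z)\<close> with \<open>n = y^2 + X^2 - z^2\<close> are parametrised by \<open>odd_quads n\<close> in two ways. Comparing the
  sums of \<open>X y^2\<close>, which is odd in \<open>X\<close> and invariant under \<open>(y, z) \<mapsto> (-y, -z)\<close>, over the two images gives the identity.\<close>

lemma liouville_odd_identity:
  fixes n :: int
  assumes n: "n mod 8 = 5"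
  shows "(\<Sum>(i, d, e)\<in>odd_quads n. d * (d * e - i\<^sup>2)) = 0"
proof -
  define T where "T = odd_quads n"
  define U where "U = {(X, y, z). even X \<and> even z \<and> odd y \<and> n = y\<^sup>2 + X\<^sup>2 - z\<^sup>2}"
  \<comment> \<open>\<open>A\<close> and \<open>B\<close> are the images of the two
    parametrisations, and \<open>A2\<close> is their common part. The rest of \<open>A\<close> is
    \<open>A1\<close>, which is stable under X -> -X; the rest of \<open>B\<close> is
    \<open>A3\<close>, the mirror image of \<open>A2\<close>.\<close>
  define A where "A = {(X, y, z). (X, y, z) \<in> U \<and> X + z > 0 \<and> z < y}"
  define A1 where "A1 = {(X, y, z). (X, y, z) \<in> U \<and> \<bar>X\<bar> < z \<and> z < y}"
  define A2 where "A2 = {(X, y, z). (X, y, z) \<in> U \<and> \<bar>z\<bar> < X \<and> z < y}"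
  define A3 where "A3 = {(X, y, z). (X, y, z) \<in> U \<and> \<bar>z\<bar> < X \<and> y < z}"
  define B where "B = {(X, y, z). (X, y, z) \<in> U \<and> \<bar>z\<bar> < X}"
  define g where "g = (\<lambda>(X::int, y::int, z::int). X * y\<^sup>2)"
  have finT: "finite T" by (simp add: T_def finite_odd_quads)
  have TI: "(i, d, e) \<in> T \<longleftrightarrow> odd i \<and> odd d \<and> odd e \<and> 0 < d \<and> 0 < e \<and> i\<^sup>2 + 4 * d * e = n" for i d e
    by (simp add: T_def odd_quads_def)
  \<comment> \<open>Here i = y - X - z, 2d = X + z and e = y - z, so that i^2 + 4de = y^2 + (X +
    z)(X - z).\<close>
  let ?j = "\<lambda>(i::int, d::int, e::int). (e - i, 2 * d + i, 2 * d + i - e)"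
  let ?k = "\<lambda>(X::int, y::int, z::int). (y - X - z, (X + z) div 2, y - z)"
  have bA: "bij_betw ?j T A"
  proof (rule bij_betw_byWitness[where f' = ?k])
    show "\<forall>a\<in>T. ?k (?j a) = a" by auto
    show "\<forall>a\<in>A. ?j (?k a) = a" by (auto simp: A_def U_def)
    show "?j ` T \<subseteq> A" 
      by (auto simp: A_def U_def TI power2_eq_square algebra_simps)
    show "?k ` A \<subseteq> T"
    proof (clarsimp simp: A_def)
      fix X y z assume *: "(X, y, z) \<in> U" "0 < X + z" "z < y"
      have o: "odd ((X + z) div 2)" using * n by (intro half_sum_odd(1)[of X z y n]) (auto simp: U_def)
      have "even X" "even z" "odd y" and nn: "n = y\<^sup>2 + X\<^sup>2 - z\<^sup>2" using * by (auto simp: U_def)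
      then have ev: "even (X + z)" by simp
      define d where "d = (X + z) div 2"
      have d: "X = 2 * d - z" using ev by (simp add: d_def)
      show "(y - X - z, (X + z) div 2, y - z) \<in> T"
        unfolding TI d_def[symmetric] nn
      proof (intro conjI)
        show "odd d" using o by (simp add: d_def)
        show "0 < d" using *(2) d by simp
      qed (use * \<open>even X\<close> \<open>even z\<close> \<open>odd y\<close> in \<open>simp_all add: d power2_eq_square algebra_simps\<close>)
    qed
  qed
  have finA: "finite A" using bA finT bij_betw_finite by blast
  \<comment> \<open>Here y = i, and X^2 - z^2 = (d + e)^2 - (d - e)^2 = 4de.\<close>
  let ?jB = "\<lambda>(i::int, d::int, e::int). (d + e, i, d - e)"
  let ?kB = "\<lambda>(X::int, y::int, z::int). (y, (X + z) div 2, (X - z) div 2)"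
  have bB: "bij_betw ?jB T B"
  proof (rule bij_betw_byWitness[where f' = ?kB])
    show "\<forall>a\<in>T. ?kB (?jB a) = a" by auto
    show "\<forall>a\<in>B. ?jB (?kB a) = a" by (auto simp: B_def U_def)
    show "?jB ` T \<subseteq> B" by (auto simp: B_def U_def TI power2_eq_square algebra_simps)
    show "?kB ` B \<subseteq> T"
    proof (clarsimp simp: B_def)
      fix X y z assume *: "(X, y, z) \<in> U" "\<bar>z\<bar> < X"
      have o: "odd ((X + z) div 2)" using * n by (intro half_sum_odd(1)[of X z y n]) (auto simp: U_def)
      have "even X" "even z" "odd y" and nn: "n = y\<^sup>2 + X\<^sup>2 - z\<^sup>2" using * by (auto simp: U_def)
      then have ev: "even (X + z)" "even (X - z)" by simp_all
      define d e where "d = (X + z) div 2" and "e = (X - z) div 2"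
      have "2 * d = X + z" "2 * e = X - z" using ev by (simp_all add: d_def e_def)
      then have d: "X = d + e" "z = d - e" by auto
      show "(y, (X + z) div 2, (X - z) div 2) \<in> T"
        unfolding TI d_def[symmetric] e_def[symmetric] nn
      proof (intro conjI)
        show "odd d" using o by (simp add: d_def)
        moreover have "even (d + e)" using \<open>even X\<close> d by simp
        ultimately show "odd e" by simp
        show "0 < d" "0 < e" using *(2) d by auto
      qed (use * \<open>even X\<close> \<open>even z\<close> \<open>odd y\<close> in \<open>simp_all add: d power2_eq_square algebra_simps\<close>)
    qed
  qed
  have finB: "finite B" using bB finT bij_betw_finite by blast
  have A: "A = A1 \<union> A2"
  proof -
    have "X \<noteq> z" if "(X, y, z) \<in> U" for X y z
      using that n by (intro half_sum_odd(2)[of X z y n]) (auto simp: U_def)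
    then show ?thesis by (fastforce simp: A_def A1_def A2_def)
  qed
  have B: "B = A2 \<union> A3"
  proof -
    have "z \<noteq> y" if "(X, y, z) \<in> U" for X y z using that by (auto simp: U_def)
    then show ?thesis by (fastforce simp: B_def A3_def A2_def)
  qed
  have fin: "finite A1" "finite A2" "finite A3" using finA finB A B by auto
  have "sum g A1 = sum (\<lambda>x. - g x) A1"
    by (rule sum.reindex_bij_witness[of _ "\<lambda>(X, y, z). (-X, y, z)" "\<lambda>(X, y, z). (-X, y, z)"])
       (auto simp: A1_def U_def g_def)
  then have A1: "sum g A1 = 0" by (simp add: sum_negf)
  have A3: "sum g A3 = sum g A2"
    by (rule sum.reindex_bij_witness[of _ "\<lambda>(X, y, z). (X, -y, -z)" "\<lambda>(X, y, z). (X, -y, -z)"])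
       (auto simp: A2_def A3_def U_def g_def)
  have "sum g A = sum g A1 + sum g A2" unfolding A
    by (rule sum.union_disjoint) (use fin in \<open>auto simp: A1_def A2_def\<close>)
  then have sA: "sum g A = sum g A2" using A1 by simp
  have "sum g B = sum g A2 + sum g A3" unfolding B
    by (rule sum.union_disjoint) (use fin in \<open>auto simp: A3_def A2_def\<close>)
  then have sB: "sum g B = 2 * sum g A" using A3 sA by simp
  have eA: "sum g A = (\<Sum>(i, d, e)\<in>T. (e - i) * (2 * d + i)\<^sup>2)"
    by (subst sum.reindex_bij_betw[OF bA, symmetric]) (auto intro!: sum.cong simp: g_def)
  have eB: "sum g B = (\<Sum>(i, d, e)\<in>T. (d + e) * i\<^sup>2)"
    by (subst sum.reindex_bij_betw[OF bB, symmetric]) (auto intro!: sum.cong simp: g_def)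
  \<comment> \<open>\<open>T\<close> is symmetric under i -> -i, so the part of the expanded summand
    in \<open>eA\<close> that is odd in i cancels. The symmetry between d and e, used next, turns e
    i^2 into d i^2.\<close>
  have "(\<Sum>(i, d, e)\<in>T. 4*d*e*i - 4*d\<^sup>2*i - i^3) = (\<Sum>(i, d, e)\<in>T. - (4*d*e*i - 4*d\<^sup>2*i - i^3))"
    by (rule sum.reindex_bij_witness[of _ "\<lambda>(X, y, z). (-X, y, z)" "\<lambda>(X, y, z). (-X, y, z)"]) (auto simp: TI)
  also have "\<dots> = - (\<Sum>(i, d, e)\<in>T. 4*d*e*i - 4*d\<^sup>2*i - i^3)"
    unfolding sum_negf[symmetric] by (rule sum.cong) auto
  finally have odd0: "(\<Sum>(i, d, e)\<in>T. 4*d*e*i - 4*d\<^sup>2*i - i^3) = 0" 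
    by linarith
  have sw: "(\<Sum>(i, d, e)\<in>T. e * i\<^sup>2) = (\<Sum>(i, d, e)\<in>T. d * i\<^sup>2)"
    by (rule sum.reindex_bij_witness[of _ "\<lambda>(X, y, z). (X, z, y)" "\<lambda>(X, y, z). (X, z, y)"]) (auto simp: TI)
  have "sum g A = (\<Sum>(i, d, e)\<in>T. (4*d\<^sup>2*e - 4 * (d * i\<^sup>2)) + e * i\<^sup>2 + (4*d*e*i - 4*d\<^sup>2*i - i^3))"
    unfolding eA by (rule sum.cong) (auto simp: power2_eq_square power3_eq_cube algebra_simps)
  also have "\<dots> = (\<Sum>(i, d, e)\<in>T. (4*d\<^sup>2*e - 4 * (d * i\<^sup>2))) + (\<Sum>(i, d, e)\<in>T. d * i\<^sup>2)"
    using odd0 sw by (simp add: case_prod_unfold sum.distrib)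
  finally have a: "sum g A = (\<Sum>(i, d, e)\<in>T. (4*d\<^sup>2*e - 4 * (d * i\<^sup>2))) + (\<Sum>(i, d, e)\<in>T. d * i\<^sup>2)" .
  have b: "sum g B = 2 * (\<Sum>(i, d, e)\<in>T. d * i\<^sup>2)" using sw
    by (simp add: eB case_prod_unfold sum.distrib distrib_right)
  have "(\<Sum>(i, d, e)\<in>T. (4*d\<^sup>2*e - 4 * (d * i\<^sup>2))) = 0" using a b sB by simp
  also have "(\<Sum>(i, d, e)\<in>T. (4*d\<^sup>2*e - 4 * (d * i\<^sup>2))) = 4 * (\<Sum>(i, d, e)\<in>T. d * (d * e - i\<^sup>2))"
    by (simp add: sum_distrib_left case_prod_unfold algebra_simps power2_eq_square)
  finally show ?thesis by (simp add: T_def)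
qed

section \<open>Sums of four odd squares and their divisor formula\<close>

definition odd_reps4 :: "int \<Rightarrow> (int \<times> int \<times> int \<times> int) set" where
  "odd_reps4 m = {(a, b, c, d). odd a \<and> odd b \<and> odd c \<and> odd d \<and> a\<^sup>2 + b\<^sup>2 + c\<^sup>2 + d\<^sup>2 = m}"

text \<open>For m = 4u with u odd, the sum of \<open>d\<close> over this set is sigma(u).\<close>

definition odd_factor_pairs :: "int \<Rightarrow> (int \<times> int) set" where
  "odd_factor_pairs m = {(d, e). odd d \<and> odd e \<and> 0 < d \<and> 0 < e \<and> 4 * d * e = m}"

lemma square_le_imp_range: "(i::int)\<^sup>2 \<le> m \<Longrightarrow> - m \<le> i \<and> i \<le> m"
  using int_le_square[of i] by linarith

definition reps4 :: "int \<Rightarrow> (int \<times> int \<times> int \<times> int) set" where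
  "reps4 m = {(a, b, c, d). a\<^sup>2 + b\<^sup>2 + c\<^sup>2 + d\<^sup>2 = m}"

lemma finite_reps4: "finite (reps4 m)"
proof (rule finite_subset)
  show "reps4 m \<subseteq> {-m..m} \<times> {-m..m} \<times> {-m..m} \<times> {-m..m}"
  proof clarify
    fix a b c d assume "(a, b, c, d) \<in> reps4 m"
    then have "a\<^sup>2 + b\<^sup>2 + c\<^sup>2 + d\<^sup>2 = m" by (simp add: reps4_def)
    then have "a\<^sup>2 \<le> m" "b\<^sup>2 \<le> m" "c\<^sup>2 \<le> m" "d\<^sup>2 \<le> m"
      using zero_le_power2[of a] zero_le_power2[of b] zero_le_power2[of c] zero_le_power2[of d]
      by linarith+
    then show "a \<in> {-m..m} \<and> (b, c, d) \<in> {-m..m} \<times> {-m..m} \<times> {-m..m}"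
      using square_le_imp_range by simp
  qed
qed simp

lemma finite_odd_reps4: "finite (odd_reps4 m)"
  by (rule finite_subset[OF _ finite_reps4[of m]]) (auto simp: odd_reps4_def reps4_def)

lemma finite_odd_factor_pairs: "finite (odd_factor_pairs m)"
proof (rule finite_subset)
  show "odd_factor_pairs m \<subseteq> {1..m} \<times> {1..m}"
  proof clarify
    fix d e assume "(d, e) \<in> odd_factor_pairs m"
    then have *: "0 < d" "0 < e" "4 * (d * e) = m" by (auto simp: odd_factor_pairs_def)
    then have "d * 1 \<le> d * e" "1 * e \<le> d * e" by (intro mult_mono; simp)+
    then have "1 \<le> d" "d \<le> m" "1 \<le> e" "e \<le> m" using * by linarith+
    then show "d \<in> {1..m} \<and> e \<in> {1..m}" by simp
  qed
qed simp

text \<open>In a representation of n by five odd squares the coordinates are interchangeable, so 5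
  x^2 and n have the same sum over all representations. Grouping by x gives the recursion, the
  coefficient form of the theta identity.\<close>

lemma odd_reps4_recursion:
  fixes n :: int
  shows "(\<Sum>x | odd x \<and> x \<in> {-n..n}. (n - 5 * x\<^sup>2) * int (card (odd_reps4 (n - x\<^sup>2)))) = 0"
proof -
  define I where "I = {x. odd x \<and> x \<in> {-n..n}}"
  define W where "W = Sigma I (\<lambda>x. odd_reps4 (n - x\<^sup>2))"
  have finI: "finite I" by (rule finite_subset[of _ "{-n..n}"]) (auto simp: I_def)
  have finW: "finite W" by (auto simp: W_def finI finite_odd_reps4)
  have W: "(x, a, b, c, d) \<in> W \<longleftrightarrow> odd x \<and> odd a \<and> odd b \<and> odd c \<and> odd d \<and> x\<^sup>2 + a\<^sup>2 + b\<^sup>2 + c\<^sup>2 + d\<^sup>2 = n" for x a b c d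
  proof
    assume "(x, a, b, c, d) \<in> W" 
    then show "odd x \<and> odd a \<and> odd b \<and> odd c \<and> odd d \<and> x\<^sup>2 + a\<^sup>2 + b\<^sup>2 + c\<^sup>2 + d\<^sup>2 = n"
      by (auto simp: W_def I_def odd_reps4_def)
  next
    assume *: "odd x \<and> odd a \<and> odd b \<and> odd c \<and> odd d \<and> x\<^sup>2 + a\<^sup>2 + b\<^sup>2 + c\<^sup>2 + d\<^sup>2 = n"
    then have "x\<^sup>2 \<le> n" using zero_le_power2[of a] zero_le_power2[of b] zero_le_power2[of c] zero_le_power2[of d] by linarith
    then have "- n \<le> x \<and> x \<le> n" by (rule square_le_imp_range)
    then show "(x, a, b, c, d) \<in> W" using * by (auto simp: W_def I_def odd_reps4_def)
  qed
  let ?s = "\<Sum>(x, a, b, c, d)\<in>W. x\<^sup>2"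
  have "?s = (\<Sum>(x, a, b, c, d)\<in>W. a\<^sup>2)"
    by (rule sum.reindex_bij_witness[of _ "\<lambda>(x, a, b, c, d). (a, x, b, c, d)" "\<lambda>(x, a, b, c, d). (a, x, b, c, d)"]) (auto simp: W)
  moreover have "?s = (\<Sum>(x, a, b, c, d)\<in>W. b\<^sup>2)"
    by (rule sum.reindex_bij_witness[of _ "\<lambda>(x, a, b, c, d). (b, a, x, c, d)" "\<lambda>(x, a, b, c, d). (b, a, x, c, d)"]) (auto simp: W)
  moreover have "?s = (\<Sum>(x, a, b, c, d)\<in>W. c\<^sup>2)"
    by (rule sum.reindex_bij_witness[of _ "\<lambda>(x, a, b, c, d). (c, a, b, x, d)" "\<lambda>(x, a, b, c, d). (c, a, b, x, d)"]) (auto simp: W)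
  moreover have "?s = (\<Sum>(x, a, b, c, d)\<in>W. d\<^sup>2)"
    by (rule sum.reindex_bij_witness[of _ "\<lambda>(x, a, b, c, d). (d, a, b, c, x)" "\<lambda>(x, a, b, c, d). (d, a, b, c, x)"]) (auto simp: W)
  ultimately have "5 * ?s = (\<Sum>(x, a, b, c, d)\<in>W. x\<^sup>2 + a\<^sup>2 + b\<^sup>2 + c\<^sup>2 + d\<^sup>2)"
    by (simp add: case_prod_unfold sum.distrib)
  also have "\<dots> = (\<Sum>(x, a, b, c, d)\<in>W. n)" by (rule sum.cong) (auto simp: W)
  finally have "(\<Sum>(x, a, b, c, d)\<in>W. n - 5 * x\<^sup>2) = 0"
    by (simp add: case_prod_unfold sum_subtractf sum_distrib_left)
  moreover have "(\<Sum>(x, a, b, c, d)\<in>W. n - 5 * x\<^sup>2) = (\<Sum>x\<in>I. \<Sum>y\<in>odd_reps4 (n - x\<^sup>2). n - 5 * x\<^sup>2)"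
    unfolding W_def by (subst sum.Sigma) (auto simp: finI finite_odd_reps4 case_prod_unfold)
  ultimately show ?thesis by (simp add: I_def mult.commute)
qed

text \<open>On \<open>odd_quads n\<close> one has 4 (d e - i^2) = n - 5 i^2, so the Liouville
  identity, grouped by i, is the same recursion as for the representation numbers.\<close>

lemma odd_factor_pairs_recursion:
  fixes n :: int
  assumes "n mod 8 = 5"
  shows "(\<Sum>x | odd x \<and> x \<in> {-n..n}. (n - 5 * x\<^sup>2) * (\<Sum>(d, e)\<in>odd_factor_pairs (n - x\<^sup>2). d)) = 0"
proof -
  define I where "I = {x. odd x \<and> x \<in> {-n..n}}"
  have finI: "finite I" by (rule finite_subset[of _ "{-n..n}"]) (auto simp: I_def)
  have W: "odd_quads n = Sigma I (\<lambda>x. odd_factor_pairs (n - x\<^sup>2))"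
  proof (intro set_eqI, clarify)
    fix i d e
    show "(i, d, e) \<in> odd_quads n \<longleftrightarrow> (i, d, e) \<in> Sigma I (\<lambda>x. odd_factor_pairs (n - x\<^sup>2))"
    proof
      assume *: "(i, d, e) \<in> odd_quads n"
      then have "0 < d * e" "i\<^sup>2 + 4 * d * e = n" by (auto simp: odd_quads_def)
      then have "i\<^sup>2 \<le> n" by linarith
      then have "- n \<le> i \<and> i \<le> n" by (rule square_le_imp_range)
      then show "(i, d, e) \<in> Sigma I (\<lambda>x. odd_factor_pairs (n - x\<^sup>2))" 
        using * by (auto simp: odd_quads_def odd_factor_pairs_def I_def)
    qed (auto simp: odd_quads_def odd_factor_pairs_def I_def)
  qed
  have "0 = 4 * (\<Sum>(i, d, e)\<in>odd_quads n. d * (d * e - i\<^sup>2))" using liouville_odd_identity[OF assms] by simp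
  also have "\<dots> = (\<Sum>(i, d, e)\<in>odd_quads n. (n - 5 * i\<^sup>2) * d)"
    unfolding sum_distrib_left by (rule sum.cong) (auto simp: odd_quads_def algebra_simps)
  also have "\<dots> = (\<Sum>x\<in>I. \<Sum>(d, e)\<in>odd_factor_pairs (n - x\<^sup>2). (n - 5 * x\<^sup>2) * d)"
    unfolding W by (subst sum.Sigma) (auto simp: finI finite_odd_factor_pairs case_prod_unfold)
  finally show ?thesis by (simp add: I_def sum_distrib_left case_prod_unfold)
qed

lemma odd_reps4_4: "card (odd_reps4 4) = 16"
proof -
  have "odd_reps4 4 = {-1,1} \<times> {-1,1} \<times> {-1,1} \<times> {-1,1}"
  proof (intro set_eqI, clarify)
    fix a b c d :: int
    have 1: "1 \<le> x\<^sup>2" if "odd x" for x :: int 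
      using that int_le_square[of x] by (cases "x = 0") auto
    have 2: "x\<^sup>2 = 1 \<longleftrightarrow> x = -1 \<or> x = 1" for x :: int by (auto simp: power2_eq_1_iff)
    show "(a, b, c, d) \<in> odd_reps4 4 \<longleftrightarrow> (a, b, c, d) \<in> {-1,1} \<times> {-1,1} \<times> {-1,1} \<times> {-1,1}"
    proof
      assume "(a, b, c, d) \<in> odd_reps4 4"
      then have "odd a" "odd b" "odd c" "odd d" "a\<^sup>2 + b\<^sup>2 + c\<^sup>2 + d\<^sup>2 = 4" by (auto simp: odd_reps4_def)
      then have "a\<^sup>2 = 1" "b\<^sup>2 = 1" "c\<^sup>2 = 1" "d\<^sup>2 = 1" using 1[of a] 1[of b] 1[of c] 1[of d] by linarith+
      then show "(a, b, c, d) \<in> {-1,1} \<times> {-1,1} \<times> {-1,1} \<times> {-1,1}" 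
        unfolding 2 by (simp only: mem_Times_iff fst_conv snd_conv insert_iff empty_iff simp_thms)
    qed (auto simp: odd_reps4_def)
  qed
  then show ?thesis by simp
qed

lemma odd_factor_pairs_4: "odd_factor_pairs 4 = {(1, 1)}"
proof -
  have "(d, e) \<in> odd_factor_pairs 4 \<longleftrightarrow> (d, e) = (1, 1)" for d e :: int
    using pos_zmult_eq_1_iff[of d e] by (auto simp: odd_factor_pairs_def)
  then show ?thesis by auto
qed

text \<open>With n = m + 1, the terms x = 1 and x = -1 of the recursion carry the value at m with
  coefficient m - 4, and all other terms lie at smaller arguments. Hence the recursion determines
  the sequence from its value at m = 4, where both sides are 16.\<close>

lemma card_odd_reps4:
  fixes m :: int
  assumes "m mod 8 = 4"
  shows "int (card (odd_reps4 m)) = 16 * (\<Sum>(d, e)\<in>odd_factor_pairs m. d)"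
  using assms
proof (induction "nat m" arbitrary: m rule: less_induct)
  case less
  define D where "D = (\<lambda>m. int (card (odd_reps4 m)) - 16 * (\<Sum>(d, e)\<in>odd_factor_pairs m. d))"
  have D0: "D m = 0" if "m \<le> 0" for m
  proof -
    have "odd_reps4 m = {}"
    proof -
      have False if "(a, b, c, d) \<in> odd_reps4 m" for a b c d
      proof -
        have "a \<noteq> 0" "a\<^sup>2 + b\<^sup>2 + c\<^sup>2 + d\<^sup>2 = m" using that by (auto simp: odd_reps4_def)
        then show False using \<open>m \<le> 0\<close> zero_less_power2[of a] zero_le_power2[of b] zero_le_power2[of c] zero_le_power2[of d] by linarith
      qed
      then show ?thesis by fast
    qed
    moreover have "odd_factor_pairs m = {}"
    proof -
      have False if "(d, e) \<in> odd_factor_pairs m" for d e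
      proof -
        have "0 < d * e" "4 * (d * e) = m" using that by (auto simp: odd_factor_pairs_def)
        then show False using \<open>m \<le> 0\<close> by linarith
      qed
      then show ?thesis by fast
    qed
    ultimately show ?thesis by (simp add: D_def)
  qed
  have "D m = 0"
  proof (cases "m > 4")
    case False
    show ?thesis
    proof (cases "m = 4")
      case True
      then show ?thesis by (simp add: D_def odd_reps4_4 odd_factor_pairs_4)
    next
      case False
      then have "m \<le> 0" using \<open>\<not> m > 4\<close> less.prems by presburger
      then show ?thesis by (rule D0)
    qed
  next
    case True
    define n where "n = m + 1"
    have n: "n mod 8 = 5" using less.prems unfolding n_def by presburger
    define I where "I = {x. odd x \<and> x \<in> {-n..n}}"
    have finI: "finite I" by (rule finite_subset[of _ "{-n..n}"]) (auto simp: I_def)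
    have "(\<Sum>x\<in>I. (n - 5 * x\<^sup>2) * D (n - x\<^sup>2)) = 
       (\<Sum>x\<in>I. (n - 5 * x\<^sup>2) * int (card (odd_reps4 (n - x\<^sup>2)))) - 16 * (\<Sum>x\<in>I. (n - 5 * x\<^sup>2) * (\<Sum>(d, e)\<in>odd_factor_pairs (n - x\<^sup>2). d))"
      by (simp add: D_def sum_subtractf sum_distrib_left right_diff_distrib mult.left_commute)
    also have "\<dots> = 0" using odd_reps4_recursion[of n] odd_factor_pairs_recursion[OF n] by (simp add: I_def)
    finally have "0 = (\<Sum>x\<in>I. (n - 5 * x\<^sup>2) * D (n - x\<^sup>2))" by simp
    also have "\<dots> = (\<Sum>x\<in>{-1,1}. (n - 5 * x\<^sup>2) * D (n - x\<^sup>2))"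
    proof (rule sum.mono_neutral_right)
      show "{-1,1} \<subseteq> I" using True by (auto simp: I_def n_def)
      show "\<forall>i\<in>I - {- 1, 1}. (n - 5 * i\<^sup>2) * D (n - i\<^sup>2) = 0"
      proof
        fix x assume x: "x \<in> I - {-1, 1}"
        then have "odd x" "x \<noteq> 1" "x \<noteq> -1" by (auto simp: I_def)
        then have "x\<^sup>2 mod 8 = 1" "x \<noteq> 0" by (auto intro: odd_square_mod_8)
        then have "\<bar>x\<bar> \<ge> 2" using \<open>x \<noteq> 1\<close> \<open>x \<noteq> -1\<close> by linarith
        then have "x\<^sup>2 > 1" using int_le_square[of x] by linarith
        have "D (n - x\<^sup>2) = 0"
        proof (cases "n - x\<^sup>2 \<le> 0")
          case True then show ?thesis by (rule D0)
        next
          case False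
          have "nat (n - x\<^sup>2) < nat m" using \<open>x\<^sup>2 > 1\<close> True by (simp add: n_def)
          moreover have "(n - w) mod 8 = 4" if "w mod 8 = 1" for w using that n mod_diff_eq[of n 8 w] by simp
          then have "(n - x\<^sup>2) mod 8 = 4" using \<open>x\<^sup>2 mod 8 = 1\<close> by blast
          ultimately show ?thesis using less.hyps by (simp add: D_def)
        qed
        then show "(n - 5 * x\<^sup>2) * D (n - x\<^sup>2) = 0" by simp
      qed
    qed (use finI in auto)
    also have "\<dots> = 2 * ((n - 5) * D m)" by (simp add: n_def)
    finally have "(n - 5) * D m = 0" by simp
    then show ?thesis using True by (simp add: n_def)
  qed
  then show ?case by (simp add: D_def)
qed

text \<open>Half of the odd quadruples have a coordinate sum divisible by 4; on these, a quarter of the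
  Hadamard matrix is an integral map that divides the norm by 4.\<close>

lemma card_reps4_ge:
  fixes u :: int
  assumes "odd u" "u > 0"
  shows "8 * u \<le> int (card (reps4 u))"
proof -
  define H where "H = {(a, b, c, d). (a, b, c, d) \<in> odd_reps4 (4 * u) \<and> 4 dvd a + b + c + d}"
  define H' where "H' = {(a, b, c, d). (a, b, c, d) \<in> odd_reps4 (4 * u) \<and> \<not> 4 dvd a + b + c + d}"
  have HH: "odd_reps4 (4 * u) = H \<union> H'" by (auto simp: H_def H'_def)
  then have fin: "finite H" "finite H'" using finite_odd_reps4[of "4 * u"] by auto
  have "card H = card H'"
  proof (rule bij_betw_same_card, rule bij_betw_byWitness[where f = "\<lambda>(a, b, c, d). (-a, b, c, d)" and f' = "\<lambda>(a, b, c, d). (-a, b, c, d)"])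
    \<comment> \<open>Changing the sign of the odd number a alters the even coordinate sum by 2
      modulo 4.\<close>
    have flip: "4 dvd - a + b + c + d \<longleftrightarrow> \<not> 4 dvd a + b + c + d" 
      if "odd a" "odd b" "odd c" "odd d" for a b c d :: int
    proof -
      obtain k where k: "a = 2 * k + 1" using \<open>odd a\<close> by (elim oddE)
      have "even (a + b + c + d)" using that by simp
      then obtain l where l: "a + b + c + d = 2 * l" by (elim evenE)
      then have l': "- a + b + c + d = 2 * (l - 2 * k - 1)" using k by simp
      have four: "(4 dvd 2 * m) = even m" for m :: int by presburger
      show ?thesis unfolding l l' four by simp
    qed
    show "(\<lambda>(a, b, c, d). (- a, b, c, d)) ` H \<subseteq> H'" "(\<lambda>(a, b, c, d). (- a, b, c, d)) ` H' \<subseteq> H"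
      using flip by (auto simp: H_def H'_def odd_reps4_def)
  qed auto
  moreover have "card (odd_reps4 (4 * u)) = card H + card H'"
    unfolding HH by (rule card_Un_disjoint) (use fin in \<open>auto simp: H_def H'_def\<close>)
  ultimately have "card (odd_reps4 (4 * u)) = 2 * card H" by simp
  moreover have "int (card (odd_reps4 (4 * u))) = 16 * (\<Sum>(d, e)\<in>odd_factor_pairs (4 * u). d)"
    by (rule card_odd_reps4) (use assms in presburger)
  \<comment> \<open>Of sigma(u) only the divisor u is kept. This gives 16 u for all odd quadruples
    and 8 u for \<open>H\<close>.\<close>
  moreover have "u \<le> (\<Sum>(d, e)\<in>odd_factor_pairs (4 * u). d)"
  proof -
    have "(\<Sum>(d, e)\<in>{(u, 1::int)}. d) \<le> (\<Sum>(d, e)\<in>odd_factor_pairs (4 * u). d)"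
    proof (rule sum_mono2[OF finite_odd_factor_pairs])
      show "{(u, 1)} \<subseteq> odd_factor_pairs (4 * u)" using assms by (simp add: odd_factor_pairs_def)
    qed (auto simp: odd_factor_pairs_def)
    then show ?thesis by simp
  qed
  ultimately have "8 * u \<le> int (card H)" by linarith
  also have "card H \<le> card (reps4 u)"
  proof (rule card_inj_on_le[where f = "\<lambda>(a, b, c, d). ((a + b + c + d) div 4, (a + b - c - d) div 4, (a - b + c - d) div 4, (a - b - c + d) div 4)"])
    \<comment> \<open>p, q, r, s are the values of the map. They are integers because the other
      three signed sums differ from a + b + c + d by twice an even number. The Hadamard matrix is
      symmetric with square 4, so it maps them back to a, b, c, d; injectivity and the norm relation
      are read off from this form.\<close>
    have *: "\<exists>p q r s. a = p + q + r + s \<and> b = p + q - r - s \<and> c = p - q + r - s \<and> d = p - q - r + s"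
      if "(a, b, c, d) \<in> H" for a b c d
    proof -
      have o: "odd a" "odd b" "odd c" "odd d" "4 dvd a + b + c + d" using that by (auto simp: H_def odd_reps4_def)
      then obtain p where p: "a + b + c + d = 4 * p" by (elim dvdE)
      have "even (c + d)" "even (b + d)" "even (b + c)" using o by simp_all
      then obtain x y z where "c + d = 2 * x" "b + d = 2 * y" "b + c = 2 * z" by (elim evenE)
      moreover have "a + b - c - d = (a + b + c + d) - 2 * (c + d)" "a - b + c - d = (a + b + c + d) - 2 * (b + d)"
        "a - b - c + d = (a + b + c + d) - 2 * (b + c)" by simp_all
      ultimately have "a + b - c - d = 4 * (p - x)" "a - b + c - d = 4 * (p - y)" "a - b - c + d = 4 * (p - z)"
        using p by simp_all
      then obtain q r s where q: "a + b - c - d = 4 * q" and r: "a - b + c - d = 4 * r" and s: "a - b - c + d = 4 * s" 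
        by blast
      show ?thesis using p q r s by (intro exI[of _ p] exI[of _ q] exI[of _ r] exI[of _ s]) linarith
    qed
    have aux: "(p + q + r + s + (p + q - r - s) + (p - q + r - s) + (p - q - r + s)) div 4 = p"
       "(p + q + r + s + (p + q - r - s) - (p - q + r - s) - (p - q - r + s)) div 4 = q"
       "(p + q + r + s - (p + q - r - s) + (p - q + r - s) - (p - q - r + s)) div 4 = r"
       "(p + q + r + s - (p + q - r - s) - (p - q + r - s) + (p - q - r + s)) div 4 = s" for p q r s :: int
      by (simp_all add: algebra_simps)
    show "inj_on (\<lambda>(a, b, c, d). ((a + b + c + d) div 4, (a + b - c - d) div 4, (a - b + c - d) div 4, (a - b - c + d) div 4)) H"
    proof (rule inj_onI)
      fix x y assume xy: "x \<in> H" "y \<in> H" and eq: "(\<lambda>(a, b, c, d). ((a + b + c + d) div 4, (a + b - c - d) div 4, (a - b + c - d) div 4, (a - b - c + d) div 4)) x = (\<lambda>(a, b, c, d). ((a + b + c + d) div 4, (a + b - c - d) div 4, (a - b + c - d) div 4, (a - b - c + d) div 4)) y"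
      obtain a b c d where x: "x = (a, b, c, d)" by (cases x) auto
      obtain a' b' c' d' where y: "y = (a', b', c', d')" by (cases y) auto
      have H: "(a, b, c, d) \<in> H" "(a', b', c', d') \<in> H" using xy x y by auto
      have e: "(a + b + c + d) div 4 = (a' + b' + c' + d') div 4" "(a + b - c - d) div 4 = (a' + b' - c' - d') div 4"
         "(a - b + c - d) div 4 = (a' - b' + c' - d') div 4" "(a - b - c + d) div 4 = (a' - b' - c' + d') div 4"
        using eq unfolding x y by simp_all
      obtain p q r s where 1: "a = p + q + r + s" "b = p + q - r - s" "c = p - q + r - s" "d = p - q - r + s"
        using *[OF H(1)] by blast
      obtain p' q' r' s' where 2: "a' = p' + q' + r' + s'" "b' = p' + q' - r' - s'" "c' = p' - q' + r' - s'" "d' = p' - q' - r' + s'"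
        using *[OF H(2)] by blast
      show "x = y" using e unfolding x y 1 2 aux by simp
    qed
    show "(\<lambda>(a, b, c, d). ((a + b + c + d) div 4, (a + b - c - d) div 4, (a - b + c - d) div 4, (a - b - c + d) div 4)) ` H \<subseteq> reps4 u"
    proof (rule image_subsetI)
      fix x assume "x \<in> H"
      then obtain a b c d where x: "x = (a, b, c, d)" and H: "(a, b, c, d) \<in> H" by (cases x) auto
      obtain p q r s where 1: "a = p + q + r + s" "b = p + q - r - s" "c = p - q + r - s" "d = p - q - r + s"
        using *[OF H(1)] by blast
      have "a\<^sup>2 + b\<^sup>2 + c\<^sup>2 + d\<^sup>2 = 4 * u" using H by (auto simp: H_def odd_reps4_def)
      then have "4 * (p\<^sup>2 + q\<^sup>2 + r\<^sup>2 + s\<^sup>2) = 4 * u" unfolding 1 by (simp add: power2_eq_square algebra_simps)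
      then show "(case x of (a, b, c, d) \<Rightarrow> ((a + b + c + d) div 4, (a + b - c - d) div 4, (a - b + c - d) div 4, (a - b - c + d) div 4)) \<in> reps4 u"
        unfolding x 1 split_conv aux by (simp add: reps4_def)
    qed
  qed (rule finite_reps4)
  finally show ?thesis by simp
qed

section \<open>Lower bounds for the number of lattice points\<close>

lemma sphere_pts_coord_le:
  assumes "x \<in> sphere_pts n lam"
  shows "(x i)\<^sup>2 \<le> lam"
proof (cases "i < n")
  case True
  then have "(x i)\<^sup>2 \<le> (\<Sum>i<n. (x i)\<^sup>2)" by (intro member_le_sum) auto
  then show ?thesis using assms by (simp add: sphere_pts_def)
next
  case False
  then have "x i = 0" "(\<Sum>i<n. (x i)\<^sup>2) = lam" using assms by (auto simp: sphere_pts_def)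
  then show ?thesis using sum_nonneg[of "{..<n}" "\<lambda>i. (x i)\<^sup>2"] by auto
qed

lemma finite_sphere_pts: "finite (sphere_pts n lam)"
proof (rule finite_subset)
  show "sphere_pts n lam \<subseteq> {x. \<forall>i. (i \<in> {..<n} \<longrightarrow> x i \<in> {-lam..lam}) \<and> (i \<notin> {..<n} \<longrightarrow> x i = 0)}"
  proof
    fix x assume x: "x \<in> sphere_pts n lam"
    then have "x i \<in> {-lam..lam}" for i
      using square_le_imp_range[OF sphere_pts_coord_le[OF x, of i]] by simp
    moreover have "x i = 0" if "i \<notin> {..<n}" for i using x that by (simp add: sphere_pts_def)
    ultimately show "x \<in> {x. \<forall>i. (i \<in> {..<n} \<longrightarrow> x i \<in> {-lam..lam}) \<and> (i \<notin> {..<n} \<longrightarrow> x i = 0)}"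
      by blast
  qed
qed (rule finite_set_of_finite_funs; simp)

lemma card_reps4_le_r_count: "card (reps4 u) \<le> r_count 4 u"
  unfolding r_count_def
proof (rule card_inj_on_le[where f = "\<lambda>(a, b, c, d). (\<lambda>_. 0)(0 := a, 1 := b, 2 := c, 3 := d)"])
  show "inj_on (\<lambda>(a, b, c, d). (\<lambda>_. 0)(0::nat := a, 1 := b, 2 := c, 3 := d)) (reps4 u)"
  proof (rule inj_onI)
    fix x y :: "int \<times> int \<times> int \<times> int"
    obtain a b c d where x: "x = (a, b, c, d)" by (cases x) auto
    obtain a' b' c' d' where y: "y = (a', b', c', d')" by (cases y) auto
    assume "(case x of (a, b, c, d) \<Rightarrow> (\<lambda>_. 0)(0::nat := a, 1 := b, 2 := c, 3 := d)) = (case y of (a, b, c, d) \<Rightarrow> (\<lambda>_. 0)(0 := a, 1 := b, 2 := c, 3 := d))"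
    then have e: "(\<lambda>_. 0)(0::nat := a, 1 := b, 2 := c, 3 := d) = (\<lambda>_. 0)(0 := a', 1 := b', 2 := c', 3 := d')"
      by (simp add: x y)
    show "x = y" unfolding x y
      using fun_cong[OF e, of 0] fun_cong[OF e, of 1] fun_cong[OF e, of 2] fun_cong[OF e, of 3] by simp
  qed
  show "(\<lambda>(a, b, c, d). (\<lambda>_. 0)(0 := a, 1 := b, 2 := c, 3 := d)) ` reps4 u \<subseteq> sphere_pts 4 u"
    by (auto simp: sphere_pts_def reps4_def eval_nat_numeral lessThan_Suc)
qed (rule finite_sphere_pts)

lemma r_count_Suc_ge:
  assumes "finite X"
  shows "(\<Sum>x\<in>X. r_count n (lam - x\<^sup>2)) \<le> r_count (Suc n) lam"
proof -
  have "(\<Sum>x\<in>X. r_count n (lam - x\<^sup>2)) = card (Sigma X (\<lambda>x. sphere_pts n (lam - x\<^sup>2)))"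
    using assms by (simp add: r_count_def finite_sphere_pts)
  also have "\<dots> \<le> r_count (Suc n) lam"
    unfolding r_count_def
  proof (rule card_inj_on_le[where f = "\<lambda>(x, g). g(n := x)"])
    show "inj_on (\<lambda>(x, g). g(n := x)) (SIGMA x:X. sphere_pts n (lam - x\<^sup>2))"
    proof (rule inj_onI)
      fix p q assume pq: "p \<in> (SIGMA x:X. sphere_pts n (lam - x\<^sup>2))" "q \<in> (SIGMA x:X. sphere_pts n (lam - x\<^sup>2))"
        and eq: "(\<lambda>(x, g). g(n := x)) p = (\<lambda>(x, g). g(n := x)) q"
      obtain x g where p: "p = (x, g)" by (cases p)
      obtain x' g' where q: "q = (x', g')" by (cases q)
      have *: "g \<in> sphere_pts n (lam - x\<^sup>2)" "g' \<in> sphere_pts n (lam - x'\<^sup>2)" and e: "g(n := x) = g'(n := x')"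
        using pq eq by (auto simp: p q)
      have "x = x'" using fun_cong[OF e, of n] by simp
      moreover have "g n = 0" "g' n = 0" using * by (auto simp: sphere_pts_def)
      then have "g i = g' i" for i using fun_cong[OF e, of i] by (cases "i = n") auto
      ultimately show "p = q" by (auto simp: p q)
    qed
    show "(\<lambda>(x, g). g(n := x)) ` (SIGMA x:X. sphere_pts n (lam - x\<^sup>2)) \<subseteq> sphere_pts (Suc n) lam"
      by (auto simp: sphere_pts_def)
  qed (rule finite_sphere_pts)
  finally show ?thesis .
qed

lemma r_count_4_ge: "odd u \<Longrightarrow> u > 0 \<Longrightarrow> 8 * u \<le> int (r_count 4 u)"
  using card_reps4_ge[of u] card_reps4_le_r_count[of u] by linarith

text \<open>Four-square counts can be small at even numbers, so the fifth coordinate x runs only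
  over the parity that makes lam - x^2 odd. About N/2 values of x, of size at most about N/2, leave
  4 (lam - x^2) >= N^2, and each contributes at least 2 N^2.\<close>

lemma r_count_5_ge:
  fixes N lam :: int
  assumes N: "1 \<le> N" and lam: "N\<^sup>2 \<le> lam"
  shows "N ^ 3 \<le> int (r_count 5 lam)"
proof -
  define h where "h = (N + 1) div 2"
  have h: "1 \<le> h" "N \<le> 2 * h" "2 * h \<le> N + 1" using N by (auto simp: h_def)
  \<comment> \<open>Chosen so that every element of \<open>X\<close> is congruent to lam + 1 modulo
    2.\<close>
  define \<epsilon> where "\<epsilon> = (lam + 1 + h) mod 2"
  have eps: "\<epsilon> = 0 \<or> \<epsilon> = 1" by (auto simp: \<epsilon>_def)
  have eps_par: "even \<epsilon> \<longleftrightarrow> even (lam + 1 + h)" by (simp add: \<epsilon>_def)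
  define X where "X = (\<lambda>k. -h + 2 * k + \<epsilon>) ` {0..<h}"
  have card: "card X = nat h" unfolding X_def by (subst card_image) (auto simp: inj_on_def)
  have *: "2 * N\<^sup>2 \<le> int (r_count 4 (lam - x\<^sup>2))" if "x \<in> X" for x
  proof -
    obtain k where k: "0 \<le> k" "k < h" "x = -h + 2 * k + \<epsilon>" using \<open>x \<in> X\<close> by (auto simp: X_def)
    have "\<bar>x\<bar> \<le> h" using k eps by auto
    then have xh: "x\<^sup>2 \<le> h\<^sup>2" using h by (simp add: abs_le_square_iff[symmetric])
    have "odd (lam - x\<^sup>2)" using k(3) eps_par by auto
    have "N\<^sup>2 \<le> 4 * (lam - x\<^sup>2)"
    \<comment> \<open>For N = 1 the size estimate yields only lam - x^2 >= 0; oddness excludes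
      0.\<close>
    proof (cases "N = 1")
      case True
      then have "x\<^sup>2 \<le> 1" using xh by (simp add: h_def)
      then have "0 \<le> lam - x\<^sup>2" using lam True by simp
      moreover have "lam - x\<^sup>2 \<noteq> 0" using \<open>odd (lam - x\<^sup>2)\<close> by (metis even_zero)
      ultimately show ?thesis using True by simp
    next
      case False
      have "(2 * h)\<^sup>2 \<le> (N + 1)\<^sup>2" using h by (intro power_mono) auto
      then have "4 * x\<^sup>2 \<le> N\<^sup>2 + 2 * N + 1" using xh by (simp add: power2_sum power_mult_distrib)
      moreover have "2 * N \<le> N * N" using N False by (intro mult_right_mono) auto
      then have "2 * N + 1 \<le> 2 * N\<^sup>2" unfolding power2_eq_square using N False by linarith
      ultimately show ?thesis using lam by (simp only: right_diff_distrib)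
    qed
    moreover have "0 < N\<^sup>2" using N by simp
    ultimately have "0 < lam - x\<^sup>2" unfolding right_diff_distrib by linarith
    then show ?thesis using r_count_4_ge[OF \<open>odd (lam - x\<^sup>2)\<close>] \<open>N\<^sup>2 \<le> 4 * (lam - x\<^sup>2)\<close> by linarith
  qed
  have "N ^ 3 = N * N\<^sup>2" by (simp add: power3_eq_cube power2_eq_square)
  also have "\<dots> \<le> (2 * h) * N\<^sup>2" using h by (intro mult_right_mono) auto
  also have "\<dots> = (\<Sum>x\<in>X. 2 * N\<^sup>2)" using h by (simp add: card)
  also have "\<dots> \<le> (\<Sum>x\<in>X. int (r_count 4 (lam - x\<^sup>2)))" by (intro sum_mono *)
  also have "\<dots> = int (\<Sum>x\<in>X. r_count 4 (lam - x\<^sup>2))" by simp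
  also have "\<dots> \<le> int (r_count (Suc 4) lam)"
    by (intro iffD2[OF of_nat_le_iff] r_count_Suc_ge) (simp add: X_def)
  finally show ?thesis by simp
qed

text \<open>Slicing by the last coordinate: at least N values with |x| <= N/2 leave a squared radius
  of at least h^2 with h = (N + 1) div 2, at the cost of a factor 2^{n-2} in the constant.\<close>

lemma r_count_ge:
  fixes n :: nat
  assumes "n \<ge> 5"
  shows "\<exists>c>0. \<forall>N::nat. \<forall>lam. 1 \<le> N \<longrightarrow> (int N)\<^sup>2 \<le> lam \<longrightarrow> c * real N ^ (n - 2) \<le> real (r_count n lam)"
  using assms
proof (induction n rule: dec_induct)
  case base
  have "1 * real N ^ 3 \<le> real (r_count 5 lam)" if "1 \<le> N" "(int N)\<^sup>2 \<le> lam" for N :: nat and lam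
  proof -
    have "int N ^ 3 \<le> int (r_count 5 lam)" using that by (intro r_count_5_ge) auto
    then have "int (N ^ 3) \<le> int (r_count 5 lam)" by simp
    then have "N ^ 3 \<le> r_count 5 lam" by linarith
    then show ?thesis by (metis mult_1 of_nat_mono of_nat_power)
  qed
  then show ?case by (intro exI[of _ 1]) auto
next
  case (step n)
  then obtain c where c: "c > 0" 
    "\<And>N::nat. \<And>lam. 1 \<le> N \<Longrightarrow> (int N)\<^sup>2 \<le> lam \<Longrightarrow> c * real N ^ (n - 2) \<le> real (r_count n lam)" by blast
  have "c / 2 ^ (n - 2) * real N ^ (Suc n - 2) \<le> real (r_count (Suc n) lam)"
    if N: "1 \<le> N" "(int N)\<^sup>2 \<le> lam" for N :: nat and lam
  proof -
    define h where "h = (N + 1) div 2"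
    define k where "k = int (N div 2)"
    have k: "2 * k \<le> int N" "0 \<le> k" "int N \<le> 2 * k + 1" by (auto simp: k_def)
    have h: "1 \<le> h" "N \<le> 2 * h" "2 * h \<le> N + 1" using N by (auto simp: h_def)
    have *: "c * real h ^ (n - 2) \<le> real (r_count n (lam - x\<^sup>2))" if "x \<in> {-k..k}" for x
    proof (rule c(2)[OF h(1)])
      have xk: "x\<^sup>2 \<le> k\<^sup>2" using that k by (intro iffD1[OF abs_le_square_iff]) auto
      show "(int h)\<^sup>2 \<le> lam - x\<^sup>2"
      proof (cases "N = 1")
        case True
        then show ?thesis using xk N by (simp add: k_def h_def)
      next
        case False
        have "(2 * int h)\<^sup>2 \<le> (int N + 1)\<^sup>2" using h by (intro power_mono) auto
        then have 1: "4 * (int h)\<^sup>2 \<le> (int N)\<^sup>2 + 2 * int N + 1" by (simp add: power2_sum power_mult_distrib)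
        have "(2 * k)\<^sup>2 \<le> (int N)\<^sup>2" using k by (intro power_mono) auto
        then have 2: "4 * k\<^sup>2 \<le> (int N)\<^sup>2" by (simp add: power_mult_distrib)
        have "2 * int N \<le> int N * int N" using N False by (intro mult_right_mono) auto
        then have 3: "2 * int N \<le> (int N)\<^sup>2" by (simp only: power2_eq_square)
        have "2 \<le> int N" using N False by linarith
        then show ?thesis using N(2) xk 1 2 3 by linarith
      qed
    qed
    have "(c / 2 ^ (n - 2)) * real N ^ (Suc n - 2) = real N * (c * (real N / 2) ^ (n - 2))"
    proof -
      have "Suc n - 2 = Suc (n - 2)" using step.hyps by linarith
      then show ?thesis by (simp add: power_divide)
    qed
    also have "\<dots> \<le> real (card {-k..k}) * (c * real h ^ (n - 2))"
      using c(1) h k by (intro mult_mono power_mono) auto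
    also have "\<dots> = (\<Sum>x\<in>{-k..k}. c * real h ^ (n - 2))" by simp
    also have "\<dots> \<le> (\<Sum>x\<in>{-k..k}. real (r_count n (lam - x\<^sup>2)))" by (intro sum_mono *)
    also have "\<dots> = real (\<Sum>x\<in>{-k..k}. r_count n (lam - x\<^sup>2))" by simp
    also have "\<dots> \<le> real (r_count (Suc n) lam)" by (intro of_nat_mono r_count_Suc_ge) simp
    finally show ?thesis .
  qed
  then show ?case using c(1) by (intro exI[of _ "c / 2 ^ (n - 2)"]) auto
qed

section \<open>Weyl differencing with a tent weight\<close>

text \<open>The right side is |1 - e(y)|^2 = 4 sin^2(pi y). The cubic Taylor bound gives sin x >=
  x/2 in the relevant range, and pi >= 3 turns (pi y)^2 into 9 y^2.\<close>

lemma two_minus_two_cos_ge: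
  fixes y :: real
  assumes "\<bar>y\<bar> \<le> 1 / 2"
  shows "9 * y\<^sup>2 \<le> 2 - 2 * cos (2 * pi * y)"
proof -
  define x where "x = pi * \<bar>y\<bar>"
  have x0: "0 \<le> x" by (simp add: x_def)
  have pi: "3 \<le> pi" "pi \<le> 16/5" using pi_approx by auto
  have "x \<le> (16/5) * (1/2)" unfolding x_def using assms pi by (intro mult_mono) auto
  then have "x\<^sup>2 \<le> (8/5)\<^sup>2" using x0 by (intro power_mono) auto
  then have x3: "x\<^sup>2 \<le> 3" by (simp add: power2_eq_square)
  have "\<bar>sin x - (\<Sum>m<3. sin_coeff m * x ^ m)\<bar> \<le> inverse (fact 3) * \<bar>x\<bar> ^ 3"
    by (rule Maclaurin_sin_bound)
  then have "\<bar>sin x - x\<bar> \<le> x ^ 3 / 6" using x0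
    by (simp add: eval_nat_numeral sin_coeff_def divide_simps)
  then have "x - x ^ 3 / 6 \<le> sin x" by linarith
  moreover have "x ^ 3 = x * x\<^sup>2" by (simp add: power3_eq_cube power2_eq_square)
  moreover have "x * x\<^sup>2 \<le> x * 3" using x3 x0 by (intro mult_left_mono)
  ultimately have "x / 2 \<le> sin x" by linarith
  then have "(x / 2)\<^sup>2 \<le> (sin x)\<^sup>2" using x0 by (intro power_mono) auto
  moreover have "(3 * \<bar>y\<bar>)\<^sup>2 \<le> x\<^sup>2" unfolding x_def using pi by (intro power_mono mult_right_mono) auto
  moreover have "cos (2 * pi * y) = cos (2 * x)" by (cases "y \<ge> 0") (simp_all add: x_def mult.assoc)
  then have "2 - 2 * cos (2 * pi * y) = 4 * (sin x)\<^sup>2" by (simp add: cos_double_sin)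
  ultimately show ?thesis by (simp add: power_mult_distrib power_divide)
qed

lemma sum_shift_int:
  fixes f :: "int \<Rightarrow> 'a::comm_monoid_add" and K L c :: int
  assumes "\<And>m. \<bar>m\<bar> > K \<Longrightarrow> f m = 0" "K + \<bar>c\<bar> \<le> L"
  shows "(\<Sum>m\<in>{-L..L}. f (m + c)) = (\<Sum>m\<in>{-L..L}. f m)"
proof -
  have "(\<Sum>m\<in>{-L..L}. f (m + c)) = (\<Sum>m\<in>{-L+c..L+c}. f m)"
    by (rule sum.reindex_bij_witness[of _ "\<lambda>m. m - c" "\<lambda>m. m + c"]) auto
  also have "\<dots> = (\<Sum>m\<in>{-K..K}. f m)" using assms by (intro sum.mono_neutral_right) auto
  also have "\<dots> = (\<Sum>m\<in>{-L..L}. f m)" using assms by (intro sum.mono_neutral_left) auto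
  finally show ?thesis .
qed

text \<open>Summation by parts twice: shifting the coefficients by one multiplies the sum by e^{it}
  or e^{-it}, so taking second differences multiplies it by 2 cos t - 2. The gain is quadratic in t,
  which later keeps the sum over h free of logarithms.\<close>

lemma norm_exp_sum_second_difference:
  fixes \<phi> :: "int \<Rightarrow> real" and K :: int and t :: real
  assumes "\<And>m. \<bar>m\<bar> > K \<Longrightarrow> \<phi> m = 0"
  shows "norm (\<Sum>m\<in>{-K..K}. of_real (\<phi> m) * cis (t * of_int m)) * (2 - 2 * cos t)
           \<le> (\<Sum>m\<in>{-(K+1)..K+1}. \<bar>\<phi> (m + 1) - 2 * \<phi> m + \<phi> (m - 1)\<bar>)"
proof -
  define L where "L = K + 1"
  define E where "E = (\<lambda>m::int. cis (t * of_int m))"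
  define S where "S = (\<Sum>m\<in>{-L..L}. of_real (\<phi> m) * E m)"
  have E: "E (m + k) = E m * E k" for m k by (simp add: E_def cis_mult ring_distribs)
  have S: "(\<Sum>m\<in>{-K..K}. of_real (\<phi> m) * cis (t * of_int m)) = S"
    unfolding S_def E_def using assms by (intro sum.mono_neutral_left) (auto simp: L_def)
  have "(\<Sum>m\<in>{-L..L}. of_real (\<phi> (m + c)) * E (m + c)) = S" if "c = 1 \<or> c = -1" for c
    unfolding S_def using assms that by (intro sum_shift_int[of K]) (auto simp: L_def)
  from this[of 1] this[of "-1"] have sh: "(\<Sum>m\<in>{-L..L}. of_real (\<phi> (m + 1)) * E (m + 1)) = S" "(\<Sum>m\<in>{-L..L}. of_real (\<phi> (m - 1)) * E (m - 1)) = S"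
    by simp_all
  have e: "E m = E (m + 1) * E (-1)" "E m = E (m - 1) * E 1" for m using E[of "m + 1" "-1"] E[of "m - 1" 1] by simp_all
  have "(\<Sum>m\<in>{-L..L}. of_real (\<phi> (m + 1)) * E m) = S * E (-1)"
    unfolding sh(1)[symmetric] sum_distrib_right by (rule sum.cong) (metis e(1) mult.assoc)+
  moreover have "(\<Sum>m\<in>{-L..L}. of_real (\<phi> (m - 1)) * E m) = S * E 1"
    unfolding sh(2)[symmetric] sum_distrib_right by (rule sum.cong) (metis e(2) mult.assoc)+
  ultimately have "(\<Sum>m\<in>{-L..L}. of_real (\<phi> (m + 1) - 2 * \<phi> m + \<phi> (m - 1)) * E m) = S * E (-1) - 2 * S + S * E 1"
    by (simp add: S_def sum.distrib sum_subtractf algebra_simps sum_distrib_left)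
  also have "\<dots> = - S * of_real (2 - 2 * cos t)"
    by (simp add: E_def complex_eq_iff algebra_simps)
  finally have "norm S * \<bar>2 - 2 * cos t\<bar> = norm (\<Sum>m\<in>{-L..L}. of_real (\<phi> (m + 1) - 2 * \<phi> m + \<phi> (m - 1)) * E m)"
    by (simp only: norm_mult norm_of_real norm_minus_cancel)
  also have "\<dots> \<le> (\<Sum>m\<in>{-L..L}. norm (of_real (\<phi> (m + 1) - 2 * \<phi> m + \<phi> (m - 1)) * E m))" by (rule norm_sum)
  also have "\<dots> = (\<Sum>m\<in>{-L..L}. \<bar>\<phi> (m + 1) - 2 * \<phi> m + \<phi> (m - 1)\<bar>)"
    by (simp add: norm_mult E_def del: of_real_add of_real_diff of_real_mult)
  also have "\<bar>2 - 2 * cos t\<bar> = 2 - 2 * cos t" by simp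
  finally show ?thesis unfolding S L_def[symmetric] .
qed

text \<open>The support reaches 2N so that the weight is at least N on [-N, N], where all
  coordinates of the sphere lie. Being piecewise linear with three kinks, it has second differences
  of bounded total size.\<close>

definition tent :: "nat \<Rightarrow> int \<Rightarrow> real" where
  "tent N m = max 0 (2 * real N - \<bar>real_of_int m\<bar>)"

definition weyl_sum :: "nat \<Rightarrow> real \<Rightarrow> complex" where
  "weyl_sum N \<theta> = (\<Sum>m\<in>{-2 * int N..2 * int N}. of_real (tent N m) * cis (2 * pi * (of_int m)\<^sup>2 * \<theta>))"

lemma tent_nonneg: "0 \<le> tent N m" by (simp add: tent_def)
lemma tent_le: "tent N m \<le> 2 * real N" by (simp add: tent_def)
lemma tent_eq_0: "2 * int N < \<bar>m\<bar> \<Longrightarrow> tent N m = 0" by (auto simp: tent_def)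

lemma tent_second_difference: 
  "\<bar>tent N (m + 1) - 2 * tent N m + tent N (m - 1)\<bar> \<le> (if m \<in> {0, 2 * int N, -2 * int N} then 2 else 0)"
proof -
  consider "m \<in> {0, 2 * int N, -2 * int N}" | "m < - 2 * int N" | "- 2 * int N < m \<and> m < 0" | "0 < m \<and> m < 2 * int N" | "2 * int N < m" by fastforce
  then show ?thesis
  proof cases
    case 2
    then have "real_of_int m + 1 \<le> - 2 * real N" by linarith
    then show ?thesis by (auto simp: tent_def)
  next
    case 3
    then have "- 2 * real N + 1 \<le> real_of_int m" "real_of_int m + 1 \<le> 0" by linarith+
    then show ?thesis by (auto simp: tent_def)
  next
    case 4
    then have "1 \<le> real_of_int m" "real_of_int m + 1 \<le> 2 * real N" by linarith+
    then show ?thesis by (auto simp: tent_def)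
  next
    case 5
    then have "2 * real N + 1 \<le> real_of_int m" by linarith
    then show ?thesis by (auto simp: tent_def)
  next
    case 1
    have "\<bar>tent N (m + 1) - tent N m\<bar> \<le> 1" "\<bar>tent N m - tent N (m - 1)\<bar> \<le> 1" 
      unfolding tent_def by (auto simp: max_def abs_if)
    then show ?thesis using 1 by auto
  qed
qed

lemma tent_slope: "\<bar>tent N (m + 1) - tent N m\<bar> \<le> 1"
  unfolding tent_def by (auto simp: max_def abs_if)

lemma tent_second_difference_sum:
  assumes "finite A"
  shows "(\<Sum>m\<in>A. \<bar>tent N (m + c + 1) - 2 * tent N (m + c) + tent N (m + c - 1)\<bar>) \<le> 6"
proof -
  have "(\<Sum>m\<in>A. \<bar>tent N (m + c + 1) - 2 * tent N (m + c) + tent N (m + c - 1)\<bar>)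
      \<le> (\<Sum>m\<in>A. if m \<in> {-c, 2 * int N - c, -2 * int N - c} then 2 else 0)"
  proof (rule sum_mono)
    fix m
    show "\<bar>tent N (m + c + 1) - 2 * tent N (m + c) + tent N (m + c - 1)\<bar> \<le> (if m \<in> {-c, 2 * int N - c, -2 * int N - c} then 2 else 0)"
      using tent_second_difference[of N "m + c"] by (auto split: if_splits)
  qed
  also have "\<dots> = 2 * real (card (A \<inter> {-c, 2 * int N - c, -2 * int N - c}))"
    using assms by (simp add: sum.If_cases Int_def)
  also have "card (A \<inter> {-c, 2 * int N - c, -2 * int N - c}) \<le> card {-c, 2 * int N - c, -2 * int N - c}"
    by (intro card_mono) auto
  also have "\<dots> \<le> 3" by (metis card.empty card_insert_le_m1 finite.emptyI numeral_3_eq_3 One_nat_def diff_Suc_1 card_length length_Cons list.size(3) list.set(1) list.set(2))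
  finally show ?thesis by simp
qed

text \<open>Discrete Leibniz rule: the second difference of u v is u times that of v, plus v times
  that of u, plus two products of slopes. The kinks contribute 12 N + 12 N, the slopes at most 2 at
  each of at most 7 N points.\<close>

lemma tent_product_second_difference_sum:
  assumes N: "1 \<le> N"
  shows "(\<Sum>m\<in>{-(2 * int N + 1)..2 * int N + 1}. 
    \<bar>tent N (m + 1 + h) * tent N (m + 1) - 2 * (tent N (m + h) * tent N m) + tent N (m - 1 + h) * tent N (m - 1)\<bar>) \<le> 38 * real N"
proof -
  let ?A = "{-(2 * int N + 1)..2 * int N + 1}"
  define d where "d = (\<lambda>m. \<bar>tent N (m + 1) - 2 * tent N m + tent N (m - 1)\<bar>)"
  have "(\<Sum>m\<in>?A. \<bar>tent N (m + 1 + h) * tent N (m + 1) - 2 * (tent N (m + h) * tent N m) + tent N (m - 1 + h) * tent N (m - 1)\<bar>)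
     \<le> (\<Sum>m\<in>?A. 2 * real N * d (m + 0) + 2 * real N * d (m + h) + 2)"
  proof (rule sum_mono)
    fix m
    define u v where "u = tent N m" and "v = tent N (m + h)"
    define a b where "a = tent N (m + 1) - u" and "b = tent N (m + 1 + h) - v"
    define a' b' where "a' = u - tent N (m - 1)" and "b' = v - tent N (m - 1 + h)"
    have u: "\<bar>u\<bar> \<le> 2 * real N" "\<bar>v\<bar> \<le> 2 * real N" using tent_le tent_nonneg by (auto simp: u_def v_def abs_le_iff intro: order_trans[of _ 0])
    have s: "\<bar>a\<bar> \<le> 1" "\<bar>b\<bar> \<le> 1" "\<bar>a'\<bar> \<le> 1" "\<bar>b'\<bar> \<le> 1"
      using tent_slope[of N m] tent_slope[of N "m - 1"] tent_slope[of N "m + h"] tent_slope[of N "m - 1 + h"]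
      by (auto simp: a_def b_def a'_def b'_def u_def v_def algebra_simps)
    have "tent N (m + 1 + h) * tent N (m + 1) - 2 * (tent N (m + h) * tent N m) + tent N (m - 1 + h) * tent N (m - 1)
       = (v + b) * (u + a) - 2 * (v * u) + (v - b') * (u - a')"
      by (simp add: a_def b_def a'_def b'_def u_def v_def)
    also have "\<dots> = u * (b - b') + v * (a - a') + a * b + a' * b'" by (simp add: algebra_simps)
    also have "\<bar>\<dots>\<bar> \<le> \<bar>u\<bar> * \<bar>b - b'\<bar> + \<bar>v\<bar> * \<bar>a - a'\<bar> + \<bar>a\<bar> * \<bar>b\<bar> + \<bar>a'\<bar> * \<bar>b'\<bar>"
      unfolding abs_mult[symmetric] by linarith
    also have "\<dots> \<le> 2 * real N * \<bar>b - b'\<bar> + 2 * real N * \<bar>a - a'\<bar> + 1 * 1 + 1 * 1"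
      using u s by (intro add_mono mult_mono) auto
    also have "\<bar>b - b'\<bar> = d (m + h)" by (simp add: d_def b_def b'_def v_def algebra_simps)
    also have "\<bar>a - a'\<bar> = d m" by (simp add: d_def a_def a'_def u_def algebra_simps)
    finally show "\<bar>tent N (m + 1 + h) * tent N (m + 1) - 2 * (tent N (m + h) * tent N m) + tent N (m - 1 + h) * tent N (m - 1)\<bar>
      \<le> 2 * real N * d (m + 0) + 2 * real N * d (m + h) + 2" by simp
  qed
  also have "\<dots> = 2 * real N * (\<Sum>m\<in>?A. d (m + 0)) + 2 * real N * (\<Sum>m\<in>?A. d (m + h)) + 2 * real (card ?A)"
    by (simp add: sum.distrib sum_distrib_left)
  also have "\<dots> \<le> 2 * real N * 6 + 2 * real N * 6 + 2 * (7 * real N)"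
    unfolding d_def using N by (intro add_mono mult_left_mono tent_second_difference_sum) auto
  finally show ?thesis by simp
qed

text \<open>The linear exponential sum that Weyl differencing with shift h leaves, up to a
  unimodular factor; \<alpha> stands for 2 \<theta>.\<close>

definition diff_sum :: "nat \<Rightarrow> real \<Rightarrow> int \<Rightarrow> real" where
  "diff_sum N \<alpha> h = norm (\<Sum>m\<in>{-2 * int N..2 * int N}. of_real (tent N (m + h) * tent N m) * cis (2 * pi * (of_int h * \<alpha>) * of_int m))"

text \<open>The phase (m + h)^2 - m^2 is linear in m apart from the constant h^2, and a shift beyond
  4N moves the support of the weight off itself.\<close>

lemma norm_weyl_sum_square_le:
  "(norm (weyl_sum N \<theta>))\<^sup>2 \<le> (\<Sum>h\<in>{-4 * int N..4 * int N}. diff_sum N (2 * \<theta>) h)"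
proof -
  let ?I = "{-2 * int N..2 * int N}" and ?H = "{-4 * int N..4 * int N}"
  let ?w = "tent N"
  let ?e = "\<lambda>x::real. cis (2 * pi * x)"
  let ?g = "\<lambda>m m'. of_real (?w m * ?w m') * ?e (((of_int m)\<^sup>2 - (of_int m')\<^sup>2) * \<theta>)"
  have "complex_of_real ((norm (weyl_sum N \<theta>))\<^sup>2) = weyl_sum N \<theta> * cnj (weyl_sum N \<theta>)"
    by (simp add: complex_norm_square[symmetric])
  also have "\<dots> = (\<Sum>m\<in>?I. \<Sum>m'\<in>?I. ?g m m')"
    unfolding weyl_sum_def cnj_sum sum_product
    by (intro sum.cong refl) (simp add: cis_cnj cis_mult algebra_simps)
  also have "\<dots> = (\<Sum>m'\<in>?I. \<Sum>m\<in>?I. ?g m m')" by (rule sum.swap)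
  also have "\<dots> = (\<Sum>m'\<in>?I. \<Sum>h\<in>?H. ?g (m' + h) m')"
  proof (rule sum.cong)
    fix m' assume m': "m' \<in> ?I"
    have "(\<Sum>h\<in>?H. ?g (m' + h) m') = (\<Sum>m\<in>{m' - 4 * int N..m' + 4 * int N}. ?g m m')"
      by (rule sum.reindex_bij_witness[of _ "\<lambda>m. m - m'" "\<lambda>h. m' + h"]) auto
    also have "\<dots> = (\<Sum>m\<in>?I. ?g m m')"
      using m' by (intro sum.mono_neutral_right) (auto simp: tent_eq_0)
    finally show "(\<Sum>m\<in>?I. ?g m m') = (\<Sum>h\<in>?H. ?g (m' + h) m')" by simp
  qed simp
  also have "\<dots> = (\<Sum>h\<in>?H. \<Sum>m'\<in>?I. ?g (m' + h) m')" by (rule sum.swap)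
  finally have "(norm (weyl_sum N \<theta>))\<^sup>2 = norm (\<Sum>h\<in>?H. \<Sum>m'\<in>?I. ?g (m' + h) m')"
    by (metis norm_of_real abs_of_nonneg zero_le_power2)
  also have "\<dots> \<le> (\<Sum>h\<in>?H. norm (\<Sum>m'\<in>?I. ?g (m' + h) m'))" by (rule norm_sum)
  also have "\<dots> = (\<Sum>h\<in>?H. diff_sum N (2 * \<theta>) h)"
  proof (rule sum.cong)
    fix h
    have "(\<Sum>m'\<in>?I. ?g (m' + h) m') = ?e ((of_int h)\<^sup>2 * \<theta>) * (\<Sum>m\<in>?I. of_real (tent N (m + h) * tent N m) * ?e ((of_int h * (2 * \<theta>)) * of_int m))"
      unfolding sum_distrib_left 
    proof (rule sum.cong)
      fix m
      have "((of_int (m + h))\<^sup>2 - (of_int m)\<^sup>2) * \<theta> = (of_int h)\<^sup>2 * \<theta> + (of_int h * (2 * \<theta>)) * of_int m"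
        by (simp add: power2_eq_square algebra_simps)
      then have "?e (((of_int (m + h))\<^sup>2 - (of_int m)\<^sup>2) * \<theta>) = ?e ((of_int h)\<^sup>2 * \<theta>) * ?e ((of_int h * (2 * \<theta>)) * of_int m)"
        by (simp only: cis_mult distrib_left)
      then show "?g (m + h) m = ?e ((of_int h)\<^sup>2 * \<theta>) * (of_real (tent N (m + h) * tent N m) * ?e ((of_int h * (2 * \<theta>)) * of_int m))"
        by (simp only: mult.left_commute mult.assoc)
    qed simp
    then show "norm (\<Sum>m'\<in>?I. ?g (m' + h) m') = diff_sum N (2 * \<theta>) h"
      by (simp add: diff_sum_def norm_mult mult.assoc)
  qed simp
  finally show ?thesis .
qed

lemma diff_sum_le_trivial:
  assumes "1 \<le> N"
  shows "diff_sum N \<alpha> h \<le> 20 * real N ^ 3"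
proof -
  have "diff_sum N \<alpha> h \<le> (\<Sum>m\<in>{-2 * int N..2 * int N}. (2 * real N) * (2 * real N))"
    unfolding diff_sum_def
  proof (rule order_trans[OF norm_sum], rule sum_mono)
    fix m
    have "tent N (m + h) * tent N m \<le> (2 * real N) * (2 * real N)" 
      by (intro mult_mono tent_le tent_nonneg) simp
    then show "norm (complex_of_real (tent N (m + h) * tent N m) * cis (2 * pi * (of_int h * \<alpha>) * of_int m)) \<le> (2 * real N) * (2 * real N)"
      by (simp add: norm_mult tent_nonneg)
  qed
  also have "\<dots> = (4 * real N + 1) * ((2 * real N) * (2 * real N))" by (simp add: nat_add_distrib nat_mult_distrib)
  also have "\<dots> \<le> (5 * real N) * ((2 * real N) * (2 * real N))" using assms by (intro mult_right_mono) auto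
  finally show ?thesis by (simp add: power3_eq_cube)
qed

lemma diff_sum_le:
  assumes "1 \<le> N" "\<bar>of_int h * \<alpha> - of_int k\<bar> \<le> 1 / 2"
  shows "diff_sum N \<alpha> h * (9 * (of_int h * \<alpha> - of_int k)\<^sup>2) \<le> 38 * real N"
proof -
  define t where "t = 2 * pi * (of_int h * \<alpha>)"
  have "diff_sum N \<alpha> h * (9 * (of_int h * \<alpha> - of_int k)\<^sup>2) \<le> diff_sum N \<alpha> h * (2 - 2 * cos (2 * pi * (of_int h * \<alpha> - of_int k)))"
    by (intro mult_left_mono two_minus_two_cos_ge assms) (simp add: diff_sum_def)
  also have "cos (2 * pi * (of_int h * \<alpha> - of_int k)) = cos t"
  proof -
    have "2 * pi * (of_int h * \<alpha> - of_int k) = t - of_int k * (2 * pi)" by (simp add: t_def algebra_simps)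
    then show ?thesis using cos_int_2pin[of k] sin_int_2pin[of k] by (simp add: cos_diff mult.commute)
  qed
  also have "diff_sum N \<alpha> h * (2 - 2 * cos t) \<le> (\<Sum>m\<in>{-(2 * int N + 1)..2 * int N + 1}. 
    \<bar>tent N (m + 1 + h) * tent N (m + 1) - 2 * (tent N (m + h) * tent N m) + tent N (m - 1 + h) * tent N (m - 1)\<bar>)"
    using norm_exp_sum_second_difference[of "2 * int N" "\<lambda>m. tent N (m + h) * tent N m" t]
    by (simp add: diff_sum_def t_def tent_eq_0)
  also have "\<dots> \<le> 38 * real N" by (rule tent_product_second_difference_sum[OF assms(1)])
  finally show ?thesis .
qed

section \<open>Summing the differenced sums near a rational number\<close>

lemma sum_inverse_squares_nat: "(\<Sum>j\<in>{1..m::nat}. 1 / (real j)\<^sup>2) \<le> 2"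
proof -
  have "(\<Sum>j\<in>{1..Suc m}. 1 / (real j)\<^sup>2) \<le> 2 - 1 / (real m + 1)" for m
  proof (induction m)
    case (Suc m)
    define x where "x = real m + 1"
    have x: "x > 0" by (simp add: x_def)
    have "1 / (x + 1)\<^sup>2 \<le> 1 / (x * (x + 1))" using x by (intro divide_left_mono) (auto simp: power2_eq_square)
    also have "\<dots> = 1 / x - 1 / (x + 1)" using x by (simp add: field_simps)
    finally show ?case using Suc by (simp add: x_def add.commute)
  qed simp
  then have *: "(\<Sum>j\<in>{1..Suc m}. 1 / (real j)\<^sup>2) \<le> 2 - 1 / (real m + 1)" .
  have "(\<Sum>j\<in>{1..m}. 1 / (real j)\<^sup>2) \<le> (\<Sum>j\<in>{1..Suc m}. 1 / (real j)\<^sup>2)" by (intro sum_mono2) auto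
  also have "\<dots> \<le> 2" by (rule order_trans[OF *]) simp
  finally show ?thesis .
qed

lemma sum_int_eq_nat: "(\<Sum>j\<in>{1..m::int}. f j) = (\<Sum>j\<in>{1..nat m}. f (int j))"
  by (rule sum.reindex_bij_witness[of _ int nat]) auto

lemma sum_inverse_squares_int: "(\<Sum>j\<in>{1..m::int}. 1 / (of_int j :: real)\<^sup>2) \<le> 2"
  unfolding sum_int_eq_nat using sum_inverse_squares_nat[of "nat m"] by simp

text \<open>The minimum is at most 4 A u^2 / (u + l)^2, both for l <= u and for l > u, and these
  terms are dominated by a telescoping sum.\<close>

lemma sum_min_inverse_square_le:
  fixes A u :: real
  assumes A: "0 \<le> A" and u: "0 < u"
  shows "(\<Sum>l\<in>{1..K::nat}. min A (A * u\<^sup>2 / (real l)\<^sup>2)) \<le> 4 * A * u"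
proof -
  have "(\<Sum>l\<in>{1..K}. min A (A * u\<^sup>2 / (real l)\<^sup>2)) \<le> 4 * A * u\<^sup>2 * (1 / u - 1 / (u + real K))"
  proof (induction K)
    case (Suc K)
    define x where "x = real (Suc K)"
    have x: "x \<ge> 1" by (simp add: x_def)
    have "min A (A * u\<^sup>2 / x\<^sup>2) \<le> 4 * A * u\<^sup>2 / (u + x)\<^sup>2"
    proof (cases "x \<le> u")
      case True
      have "A * (u + x)\<^sup>2 \<le> A * (2 * u)\<^sup>2" using True x u A by (intro mult_left_mono power_mono) auto
      then have "A \<le> 4 * A * u\<^sup>2 / (u + x)\<^sup>2" using x u by (simp add: field_simps power_mult_distrib)
      then show ?thesis by simp
    next
      case False
      have "(A * u\<^sup>2) * (u + x)\<^sup>2 \<le> (A * u\<^sup>2) * (2 * x)\<^sup>2" using False x u A by (intro mult_left_mono power_mono) auto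
      then have "A * u\<^sup>2 / x\<^sup>2 \<le> 4 * A * u\<^sup>2 / (u + x)\<^sup>2" using x u by (simp add: field_simps power_mult_distrib)
      then show ?thesis by simp
    qed
    also have "\<dots> \<le> 4 * A * u\<^sup>2 / ((u + x - 1) * (u + x))"
      using x u A by (intro divide_left_mono) (auto simp: power2_eq_square intro!: mult_right_mono)
    also have "\<dots> = 4 * A * u\<^sup>2 * (1 / (u + x - 1) - 1 / (u + x))"
      using x u by (simp add: field_simps)
    finally have "min A (A * u\<^sup>2 / x\<^sup>2) \<le> 4 * A * u\<^sup>2 * (1 / (u + real K) - 1 / (u + real (Suc K)))"
      by (simp add: x_def)
    then show ?case using Suc by (simp add: x_def right_diff_distrib)
  qed (use u in simp)
  also have "\<dots> \<le> 4 * A * u\<^sup>2 * (1 / u)" using A u by (intro mult_left_mono) auto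
  also have "\<dots> = 4 * A * u" using u by (simp add: power2_eq_square)
  finally show ?thesis .
qed

lemma sum_mod_permutation:
  fixes a q :: int and g :: "int \<Rightarrow> real"
  assumes "coprime a q" "q > 0"
  shows "(\<Sum>r\<in>{1..<q}. g ((r * a) mod q)) = (\<Sum>j\<in>{1..<q}. g j)"
proof -
  let ?f = "\<lambda>r. (r * a) mod q"
  have "inj_on ?f {1..<q}"
  proof (rule inj_onI)
    fix x y assume xy: "x \<in> {1..<q}" "y \<in> {1..<q}" "(x * a) mod q = (y * a) mod q"
    then have "q dvd (x - y) * a" by (metis left_diff_distrib mod_eq_dvd_iff)
    then have "q dvd x - y" using assms(1) by (simp add: coprime_commute coprime_dvd_mult_left_iff)
    then have "x mod q = y mod q" by (simp add: mod_eq_dvd_iff)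
    then show "x = y" using xy by simp
  qed
  moreover have "?f ` {1..<q} \<subseteq> {1..<q}"
  proof (rule image_subsetI)
    fix x assume x: "x \<in> {1..<q}"
    have "(x * a) mod q \<noteq> 0"
    proof
      assume "(x * a) mod q = 0"
      then have "q dvd x * a" by auto
      then have "q dvd x" using assms(1) by (simp add: coprime_commute coprime_dvd_mult_left_iff)
      then show False using x by (auto dest: zdvd_imp_le)
    qed
    moreover have "0 \<le> (x * a) mod q" "(x * a) mod q < q" using assms(2) by simp_all
    ultimately show "(x * a) mod q \<in> {1..<q}" by simp
  qed
  ultimately have "bij_betw ?f {1..<q} {1..<q}"
    by (simp add: bij_betw_def endo_inj_surj)
  then show ?thesis by (rule sum.reindex_bij_betw)
qed

text \<open>The multiples of \<open>q\<close> contribute the main term; the other \<open>h\<close> keep \<open>h \<alpha>\<close> at distance at least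
  \<open>|h a - k q| / (2q)\<close> from every integer \<open>k\<close>, because the approximation \<open>a/q\<close> was chosen with denominators up to \<open>8N\<close>.\<close>

lemma sum_diff_sum_le:
  fixes N :: nat and q a :: int and \<alpha> :: real
  assumes N: "1 \<le> N" and q: "1 \<le> q" "q \<le> 8 * int N" and cop: "coprime a q"
    and b: "\<bar>of_int q * \<alpha> - of_int a\<bar> \<le> 1 / (8 * real N)"
  shows "(\<Sum>h\<in>{-4 * int N..4 * int N}. diff_sum N \<alpha> h) * (of_int q * (1 + (real N)\<^sup>2 * \<bar>\<alpha> - of_int a / of_int q\<bar>)) \<le> 150000 * real N ^ 4"
proof -
  define H where "H = {-4 * int N..4 * int N}"
  define H0 where "H0 = {h\<in>H. q dvd h}"
  define H1 where "H1 = {h\<in>H. \<not> q dvd h}"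
  define D where "D = diff_sum N \<alpha>"
  define \<beta> where "\<beta> = \<bar>\<alpha> - of_int a / of_int q\<bar>"
  define n where "n = real N"
  define r where "r = real_of_int q"
  have n: "1 \<le> n" using N by (simp add: n_def)
  have r: "1 \<le> r" "r \<le> 8 * n" using q by (simp_all add: r_def n_def)
  have \<beta>0: "0 \<le> \<beta>" by (simp add: \<beta>_def)
  have D0: "0 \<le> D h" for h by (simp add: D_def diff_sum_def)
  have "r * \<beta> = \<bar>r * (\<alpha> - of_int a / r)\<bar>" using r by (simp add: \<beta>_def r_def abs_mult)
  also have "r * (\<alpha> - of_int a / r) = r * \<alpha> - of_int a" using r by (simp add: field_simps)
  finally have r\<beta>: "r * \<beta> = \<bar>r * \<alpha> - of_int a\<bar>" .
  then have r\<beta>_le: "r * \<beta> \<le> 1 / (8 * n)" using b by (simp add: r_def n_def)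
  have finH: "finite H" by (simp add: H_def)
  have H_le: "\<bar>real_of_int h\<bar> \<le> 4 * n" if "h \<in> H" for h
  proof -
    have "\<bar>h\<bar> \<le> 4 * int N" using that by (auto simp: H_def)
    then have "real_of_int \<bar>h\<bar> \<le> real_of_int (4 * int N)" by (rule of_int_le_iff[THEN iffD2])
    then show ?thesis by (simp add: n_def)
  qed

  have T1: "(\<Sum>h\<in>H1. D h) \<le> 2176 * n\<^sup>2 * r"
  proof -
    \<comment> \<open>\<open>G\<close> dominates the inverse square of the distance from j to the
      multiples of q. Its sum over the nonzero residues is at most 4, whatever q is.\<close>
    define G where "G = (\<lambda>j::int. 1 / (of_int j)\<^sup>2 + 1 / (of_int (q - j))\<^sup>2 :: real)"
    have Dh: "D h \<le> 17 * n * r\<^sup>2 * G ((h mod q) * a mod q)" if h: "h \<in> H1" for h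
    proof -
      define k where "k = round (of_int h * \<alpha>)"
      define y where "y = of_int h * \<alpha> - of_int k"
      define m where "m = h * a - k * q"
      define j where "j = (h mod q) * a mod q"
      have j_eq: "j = (h * a) mod q" by (simp add: j_def mod_mult_left_eq)
      have "\<not> q dvd h * a" using h cop by (simp add: H1_def coprime_commute coprime_dvd_mult_left_iff)
      then have "j \<noteq> 0" by (simp add: j_eq dvd_eq_mod_eq_0)
      moreover have "0 \<le> j" "j < q" using q by (simp_all add: j_eq)
      ultimately have j: "1 \<le> j" "j < q" by auto
      \<comment> \<open>m = h a - k q is congruent to j modulo q, so |m| is at least j or at least q
        - j.\<close>
      define s where "s = (h * a) div q - k"
      have ms: "m = j + q * s" using div_mult_mod_eq[of "h * a" q] by (simp add: m_def s_def j_eq algebra_simps)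
      have m1: "1 \<le> \<bar>m\<bar>" and mG: "1 / (real_of_int m)\<^sup>2 \<le> G j"
      proof -
        have "j \<le> \<bar>m\<bar> \<or> q - j \<le> \<bar>m\<bar>"
        proof (cases "s \<ge> 0")
          case True
          then have "q * s \<ge> 0" using q by simp
          then show ?thesis using ms j by auto
        next
          case False
          then have "q * s \<le> q * (-1)" using q by (intro mult_left_mono) auto
          then show ?thesis using ms j by auto
        qed
        then obtain i where i: "i = j \<or> i = q - j" "i \<le> \<bar>m\<bar>" by blast
        have i1: "1 \<le> i" using i(1) j by auto
        then show "1 \<le> \<bar>m\<bar>" using i by linarith
        have "real_of_int i \<le> \<bar>real_of_int m\<bar>" using i(2) by linarith
        then have "(real_of_int i)\<^sup>2 \<le> (real_of_int m)\<^sup>2" using i1 by (simp add: abs_le_square_iff[symmetric])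
        then have "1 / (real_of_int m)\<^sup>2 \<le> 1 / (real_of_int i)\<^sup>2" using i1 \<open>1 \<le> \<bar>m\<bar>\<close> by (intro divide_left_mono mult_pos_pos) auto
        also have "\<dots> \<le> G j" using i(1) by (auto simp: G_def)
        finally show "1 / (real_of_int m)\<^sup>2 \<le> G j" .
      qed
      have y_half: "\<bar>y\<bar> \<le> 1 / 2" using of_int_round_abs_le[of "of_int h * \<alpha>"] by (simp add: y_def k_def abs_minus_commute)
      \<comment> \<open>The denominator range 8N is twice the largest shift 4N. Hence replacing r
        \<alpha> by a changes r y by at most 1/2, at most half of the nonzero integer |m|.\<close>
      have "\<bar>real_of_int h\<bar> * (r * \<beta>) \<le> (4 * n) * (1 / (8 * n))"
        using H_le[of h] h r\<beta>_le n \<beta>0 r by (intro mult_mono) (auto simp: H1_def)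
      then have hb: "\<bar>real_of_int h\<bar> * (r * \<beta>) \<le> 1 / 2" using n by simp
      have "r * y = of_int m + of_int h * (r * \<alpha> - of_int a)"
        by (simp add: y_def m_def r_def algebra_simps)
      moreover have "\<bar>of_int h * (r * \<alpha> - of_int a)\<bar> = \<bar>real_of_int h\<bar> * (r * \<beta>)" by (simp add: abs_mult r\<beta>)
      moreover have "1 \<le> \<bar>real_of_int m\<bar>" using m1 by linarith
      ultimately have "\<bar>real_of_int m\<bar> / 2 \<le> \<bar>r * y\<bar>" using hb by linarith
      then have "(\<bar>real_of_int m\<bar> / 2)\<^sup>2 \<le> \<bar>r * y\<bar>\<^sup>2" by (intro power_mono) auto
      then have "(real_of_int m)\<^sup>2 \<le> 4 * (r\<^sup>2 * y\<^sup>2)" by (simp add: power_divide power_mult_distrib)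
      then have "D h * (9 * (real_of_int m)\<^sup>2) \<le> D h * (9 * (4 * (r\<^sup>2 * y\<^sup>2)))" using D0 by (intro mult_left_mono) auto
      also have "\<dots> = 4 * r\<^sup>2 * (D h * (9 * y\<^sup>2))" by simp
      also have "\<dots> \<le> 4 * r\<^sup>2 * (38 * n)"
        unfolding D_def y_def n_def using diff_sum_le[OF N y_half[unfolded y_def]] by (intro mult_left_mono) auto
      finally have "9 * (D h * (real_of_int m)\<^sup>2) \<le> 152 * (n * r\<^sup>2)" by (simp add: mult_ac)
      moreover have "0 \<le> n * r\<^sup>2" using n by simp
      ultimately have "D h * (real_of_int m)\<^sup>2 \<le> 17 * (n * r\<^sup>2)" by linarith
      then have "D h \<le> 17 * n * r\<^sup>2 * (1 / (real_of_int m)\<^sup>2)" using m1 by (simp add: pos_le_divide_eq)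
      also have "\<dots> \<le> 17 * n * r\<^sup>2 * G j" using mG n by (intro mult_left_mono) auto
      finally show ?thesis by (simp add: j_def)
    qed
    \<comment> \<open>h div q lies in [-K, K]: blocks of length q cover all shifts, and q <= 8N
      bounds the number of blocks by 32 N / q.\<close>
    define K where "K = (4 * int N) div q + 1"
    have K: "0 \<le> K" "of_int (2 * K + 1) \<le> 32 * n / r"
    proof -
      show "0 \<le> K" using q by (simp add: K_def pos_imp_zdiv_nonneg_iff)
      have "real_of_int ((4 * int N) div q) \<le> real_of_int (4 * int N) / real_of_int q" by (rule real_of_int_div4)
      also have "\<dots> = 4 * n / r" by (simp add: n_def r_def)
      finally have "of_int (2 * K + 1) \<le> 8 * n / r + 3" by (simp add: K_def)
      also have "3 \<le> 24 * n / r" using r by (simp add: field_simps)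
      finally show "of_int (2 * K + 1) \<le> 32 * n / r" by simp
    qed
    have "(\<Sum>h\<in>H1. D h) \<le> (\<Sum>h\<in>H1. 17 * n * r\<^sup>2 * G ((h mod q) * a mod q))" by (intro sum_mono Dh)
    also have "\<dots> \<le> (\<Sum>(l, i)\<in>{-K..K} \<times> {1..<q}. 17 * n * r\<^sup>2 * G (i * a mod q))"
    proof (rule sum_le_included[where i = "\<lambda>(l, i). q * l + i"])
      show "finite H1" by (simp add: H1_def finH)
      show "\<forall>y\<in>{-K..K} \<times> {1..<q}. 0 \<le> (case y of (l, i) \<Rightarrow> 17 * n * r\<^sup>2 * G (i * a mod q))"
        using n by (auto simp: G_def)
      show "\<forall>h\<in>H1. \<exists>y\<in>{-K..K} \<times> {1..<q}. (case y of (l, i) \<Rightarrow> q * l + i) = h \<and> 17 * n * r\<^sup>2 * G ((h mod q) * a mod q) \<le> (case y of (l, i) \<Rightarrow> 17 * n * r\<^sup>2 * G (i * a mod q))"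
      proof
        fix h assume h: "h \<in> H1"
        have "h \<le> 4 * int N" "- (4 * int N) \<le> h" using h by (auto simp: H1_def H_def)
        then have "h div q \<le> (4 * int N) div q" "(- (4 * int N)) div q \<le> h div q" using q by (auto intro: zdiv_mono1)
        moreover have "- ((4 * int N) div q) - 1 \<le> (- (4 * int N)) div q" using zdiv_zminus1_eq_if[of q "4 * int N"] q by (simp split: if_splits)
        ultimately have "h div q \<in> {-K..K}" by (simp add: K_def)
        moreover have "h mod q \<noteq> 0" using h by (auto simp: H1_def)
        have "0 \<le> h mod q" "h mod q < q" using q by simp_all
        then have "h mod q \<in> {1..<q}" using \<open>h mod q \<noteq> 0\<close> by auto
        ultimately show "\<exists>y\<in>{-K..K} \<times> {1..<q}. (case y of (l, i) \<Rightarrow> q * l + i) = h \<and> 17 * n * r\<^sup>2 * G ((h mod q) * a mod q) \<le> (case y of (l, i) \<Rightarrow> 17 * n * r\<^sup>2 * G (i * a mod q))"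
          by (intro bexI[of _ "(h div q, h mod q)"]) auto
      qed
    qed simp
    also have "\<dots> = (\<Sum>l\<in>{-K..K}. \<Sum>i\<in>{1..<q}. 17 * n * r\<^sup>2 * G (i * a mod q))" by (rule sum.cartesian_product[symmetric])
    also have "\<dots> = of_int (2 * K + 1) * (17 * n * r\<^sup>2 * (\<Sum>i\<in>{1..<q}. G (i * a mod q)))"
      using K(1) by (simp add: sum_distrib_left)
    also have "(\<Sum>i\<in>{1..<q}. G (i * a mod q)) = (\<Sum>j\<in>{1..<q}. G j)" using cop q by (intro sum_mod_permutation) auto
    also have "\<dots> = (\<Sum>j\<in>{1..<q}. 1 / (of_int j)\<^sup>2) + (\<Sum>j\<in>{1..<q}. 1 / (of_int (q - j))\<^sup>2)" by (simp add: G_def sum.distrib)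
    also have "(\<Sum>j\<in>{1..<q}. 1 / (of_int (q - j))\<^sup>2) = (\<Sum>j\<in>{1..<q}. 1 / (of_int j)\<^sup>2 :: real)"
      by (rule sum.reindex_bij_witness[of _ "\<lambda>j. q - j" "\<lambda>j. q - j"]) auto
    also have "of_int (2 * K + 1) * (17 * n * r\<^sup>2 * ((\<Sum>j\<in>{1..<q}. 1 / (of_int j)\<^sup>2) + (\<Sum>j\<in>{1..<q}. 1 / (of_int j)\<^sup>2)))
       \<le> (32 * n / r) * (17 * n * r\<^sup>2 * (2 + 2))"
    proof -
      have "{1..<q} = {1..q - 1}" by auto
      then have "(\<Sum>j\<in>{1..<q}. 1 / (real_of_int j)\<^sup>2) \<le> 2" using sum_inverse_squares_int[of "q - 1"] by simp
      then show ?thesis using K n r by (intro mult_mono add_mono mult_nonneg_nonneg add_nonneg_nonneg sum_nonneg) auto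
    qed
    also have "\<dots> = 2176 * n\<^sup>2 * r" using r by (simp add: power2_eq_square)
    finally show ?thesis .
  qed

  define K where "K = nat ((4 * int N) div q)"
  have K: "real K \<le> 4 * n / r"
  proof -
    have "real K = real_of_int ((4 * int N) div q)" using q by (simp add: K_def pos_imp_zdiv_nonneg_iff)
    also have "\<dots> \<le> real_of_int (4 * int N) / real_of_int q" by (rule real_of_int_div4)
    finally show ?thesis by (simp add: n_def r_def)
  qed
  define A where "A = 20 * n ^ 3"
  have A0: "0 \<le> A" using n by (simp add: A_def)
  have DA: "D h \<le> A" for h using diff_sum_le_trivial[OF N] by (simp add: D_def A_def n_def)
  have T0: "(\<Sum>h\<in>H0. D h) \<le> D 0 + (\<Sum>l\<in>{1..K}. D (q * int l)) + (\<Sum>l\<in>{1..K}. D (- q * int l))"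
  proof -
    have "H0 \<subseteq> {0} \<union> (\<lambda>l. q * int l) ` {1..K} \<union> (\<lambda>l. - q * int l) ` {1..K}"
    proof
      fix h assume h: "h \<in> H0"
      then obtain l where l: "h = q * l" by (auto simp: H0_def elim: dvdE)
      have "\<bar>h\<bar> \<le> 4 * int N" using h by (auto simp: H0_def H_def)
      then have "\<bar>l\<bar> * q \<le> 4 * int N" using q by (simp add: l abs_mult mult.commute)
      then have "(\<bar>l\<bar> * q) div q \<le> (4 * int N) div q" using q by (intro zdiv_mono1) auto
      then have "\<bar>l\<bar> \<le> (4 * int N) div q" using q by simp
      then have lK: "nat \<bar>l\<bar> \<le> K" unfolding K_def by linarith
      consider "l = 0" | "l > 0" | "l < 0" by linarith
      then show "h \<in> {0} \<union> (\<lambda>l. q * int l) ` {1..K} \<union> (\<lambda>l. - q * int l) ` {1..K}"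
      proof cases
        case 2
        then have "h = q * int (nat \<bar>l\<bar>)" "nat \<bar>l\<bar> \<in> {1..K}" using l lK by auto
        then show ?thesis by blast
      next
        case 3
        then have "h = - q * int (nat \<bar>l\<bar>)" "nat \<bar>l\<bar> \<in> {1..K}" using l lK by auto
        then show ?thesis by blast
      qed (simp add: l)
    qed
    then have "(\<Sum>h\<in>H0. D h) \<le> (\<Sum>h\<in>{0} \<union> (\<lambda>l. q * int l) ` {1..K} \<union> (\<lambda>l. - q * int l) ` {1..K}. D h)"
      by (intro sum_mono2 D0) auto
    also have "\<dots> \<le> (\<Sum>h\<in>{0} \<union> (\<lambda>l. q * int l) ` {1..K}. D h) + (\<Sum>h\<in>(\<lambda>l. - q * int l) ` {1..K}. D h)"
      by (subst sum_Un) (auto intro!: sum_nonneg D0)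
    also have "(\<Sum>h\<in>{0} \<union> (\<lambda>l. q * int l) ` {1..K}. D h) \<le> (\<Sum>h\<in>{0}. D h) + (\<Sum>h\<in>(\<lambda>l. q * int l) ` {1..K}. D h)"
      by (subst sum_Un) (auto intro!: sum_nonneg D0)
    also have "(\<Sum>h\<in>(\<lambda>l. q * int l) ` {1..K}. D h) = (\<Sum>l\<in>{1..K}. D (q * int l))"
      using q by (subst sum.reindex) (auto simp: inj_on_def)
    also have "(\<Sum>h\<in>(\<lambda>l. - q * int l) ` {1..K}. D h) = (\<Sum>l\<in>{1..K}. D (- q * int l))"
      using q by (subst sum.reindex) (auto simp: inj_on_def)
    finally show ?thesis by simp
  qed
  \<comment> \<open>The trivial bound of order N^3 for each multiple of q, of which there are
    O(N/q), settles the summand 1 of 1 + N^2 \<beta>; \<open>T0b\<close> settles the summand N^2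
    \<beta>.\<close>
  have T0a: "(\<Sum>h\<in>H0. D h) * r \<le> 320 * n ^ 4"
  proof -
    have "(\<Sum>h\<in>H0. D h) \<le> A + (\<Sum>l\<in>{1..K}. A) + (\<Sum>l\<in>{1..K}. A)"
      by (rule order_trans[OF T0]) (intro add_mono sum_mono DA)
    also have "\<dots> = (2 * real K + 1) * A" by (simp add: algebra_simps)
    also have "\<dots> \<le> (8 * n / r + 8 * n / r) * A"
      using K r A0 by (intro mult_right_mono add_mono) (auto simp: field_simps)
    finally have "(\<Sum>h\<in>H0. D h) * r \<le> (8 * n / r + 8 * n / r) * A * r" using r by (intro mult_right_mono) auto
    also have "\<dots> = 320 * n ^ 4" using r by (simp add: A_def field_simps power_numeral_reduce)
    finally show ?thesis .
  qed
  have T0b: "(\<Sum>h\<in>H0. D h) * r * (n\<^sup>2 * \<beta>) \<le> 83 * n ^ 4"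
  proof (cases "\<beta> = 0")
    case False
    then have \<beta>: "\<beta> > 0" using \<beta>0 by simp
    \<comment> \<open>The crossover: at |l| = u the trivial bound \<open>A\<close> equals the
      quadratic bound 5 n / (l r \<beta>)^2.\<close>
    define u where "u = 1 / (2 * n * r * \<beta>)"
    have u: "0 < u" using n r \<beta> by (simp add: u_def)
    have Dl: "D (q * l) \<le> min A (A * u\<^sup>2 / (of_int l)\<^sup>2)" if l: "l \<noteq> 0" "\<bar>l\<bar> \<le> int K" for l
    proof -
      define y where "y = of_int (q * l) * \<alpha> - of_int (a * l)"
      have y: "\<bar>y\<bar> = \<bar>of_int l\<bar> * (r * \<beta>)"
        unfolding r\<beta> abs_mult[symmetric] by (simp add: y_def r_def algebra_simps)
      have "\<bar>real_of_int l\<bar> \<le> real K" using l(2) by linarith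
      then have "\<bar>real_of_int l\<bar> \<le> 4 * n / r" using K by linarith
      also have "\<dots> \<le> 4 * n" using r n by (simp add: field_simps)
      finally have "\<bar>y\<bar> \<le> (4 * n) * (1 / (8 * n))" unfolding y using r\<beta>_le n r \<beta> by (intro mult_mono) auto
      then have y_half: "\<bar>y\<bar> \<le> 1 / 2" using n by simp
      have "D (q * l) * (9 * y\<^sup>2) \<le> 38 * n"
        unfolding D_def y_def n_def using y_half by (intro diff_sum_le N) (simp add: y_def)
      moreover have "y\<^sup>2 = (of_int l)\<^sup>2 * (r * \<beta>)\<^sup>2" using arg_cong[OF y, of "\<lambda>x. x\<^sup>2"] by (simp add: power_mult_distrib)
      ultimately have "D (q * l) * (of_int l)\<^sup>2 * (r * \<beta>)\<^sup>2 \<le> 5 * n" using n by (simp add: mult.assoc)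
      then have "D (q * l) * (of_int l)\<^sup>2 \<le> 5 * n / (r * \<beta>)\<^sup>2" using r \<beta> by (simp add: pos_le_divide_eq)
      also have "\<dots> = A * u\<^sup>2" using n r \<beta> by (simp add: A_def u_def field_simps power2_eq_square power3_eq_cube)
      finally have "D (q * l) \<le> A * u\<^sup>2 / (of_int l)\<^sup>2" using l by (simp add: pos_le_divide_eq)
      then show ?thesis using DA by simp
    qed
    have "(\<Sum>h\<in>H0. D h) \<le> A + (\<Sum>l\<in>{1..K}. min A (A * u\<^sup>2 / (real l)\<^sup>2)) + (\<Sum>l\<in>{1..K}. min A (A * u\<^sup>2 / (real l)\<^sup>2))"
    proof (rule order_trans[OF T0], intro add_mono sum_mono DA)
      fix l assume l: "l \<in> {1..K}"
      show "D (q * int l) \<le> min A (A * u\<^sup>2 / (real l)\<^sup>2)" using Dl[of "int l"] l by simp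
      show "D (- q * int l) \<le> min A (A * u\<^sup>2 / (real l)\<^sup>2)" using Dl[of "- int l"] l by simp
    qed
    also have "\<dots> \<le> A + 4 * A * u + 4 * A * u" by (intro add_mono sum_min_inverse_square_le A0 u order_refl)
    finally have "(\<Sum>h\<in>H0. D h) * (r * (n\<^sup>2 * \<beta>)) \<le> (A + 8 * A * u) * (r * (n\<^sup>2 * \<beta>))"
      using r n \<beta> by (intro mult_right_mono) auto
    also have "\<dots> = A * n\<^sup>2 * (r * \<beta>) + 80 * n ^ 4"
      using n r \<beta> by (simp add: A_def u_def field_simps power2_eq_square power_numeral_reduce)
    also have "A * n\<^sup>2 * (r * \<beta>) \<le> A * n\<^sup>2 * (1 / (8 * n))" using r\<beta>_le A0 by (intro mult_left_mono) auto
    also have "\<dots> \<le> 3 * n ^ 4" using n by (simp add: A_def field_simps power2_eq_square power_numeral_reduce)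
    finally show ?thesis by (simp add: mult.assoc)
  qed (use n in simp)
  \<comment> \<open>One factor r belongs to the bound \<open>T1\<close>, the other to the claim, and
    r <= 8n turns both into powers of n. In \<open>T1b\<close> the second factor r is paired with
    \<beta>, and r \<beta> <= 1/(8n) is used.\<close>
  have T1a: "(\<Sum>h\<in>H1. D h) * r \<le> 139264 * n ^ 4"
  proof -
    have "(\<Sum>h\<in>H1. D h) * r \<le> 2176 * n\<^sup>2 * r * r" using T1 r by (intro mult_right_mono) auto
    also have "\<dots> = 2176 * n\<^sup>2 * (r * r)" by simp
    also have "\<dots> \<le> 2176 * n\<^sup>2 * ((8 * n) * (8 * n))" using r n by (intro mult_left_mono mult_mono) auto
    finally show ?thesis by (simp add: power2_eq_square power_numeral_reduce)
  qed
  have T1b: "(\<Sum>h\<in>H1. D h) * r * (n\<^sup>2 * \<beta>) \<le> 2176 * n ^ 4"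
  proof -
    have "(\<Sum>h\<in>H1. D h) * (r * (n\<^sup>2 * \<beta>)) \<le> 2176 * n\<^sup>2 * r * (r * (n\<^sup>2 * \<beta>))" using T1 r \<beta>0 by (intro mult_right_mono) auto
    also have "\<dots> = 2176 * n ^ 4 * (r * (r * \<beta>))" by (simp add: power2_eq_square power_numeral_reduce)
    also have "\<dots> \<le> 2176 * n ^ 4 * ((8 * n) * (1 / (8 * n)))" using r n r\<beta>_le \<beta>0 by (intro mult_left_mono mult_mono) auto
    finally show ?thesis using n by (simp add: mult.assoc)
  qed
  have "(\<Sum>h\<in>H. D h) = (\<Sum>h\<in>H0. D h) + (\<Sum>h\<in>H1. D h)"
    by (subst sum.union_disjoint[symmetric]) (auto simp: H0_def H1_def finH intro!: sum.cong)
  then have "(\<Sum>h\<in>H. D h) * (r * (1 + n\<^sup>2 * \<beta>)) = (\<Sum>h\<in>H0. D h) * r + (\<Sum>h\<in>H0. D h) * r * (n\<^sup>2 * \<beta>) + ((\<Sum>h\<in>H1. D h) * r + (\<Sum>h\<in>H1. D h) * r * (n\<^sup>2 * \<beta>))"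
    by (simp add: algebra_simps)
  also have "\<dots> \<le> 320 * n ^ 4 + 83 * n ^ 4 + (139264 * n ^ 4 + 2176 * n ^ 4)"
    by (intro add_mono T0a T0b T1a T1b)
  also have "\<dots> \<le> 150000 * n ^ 4" using n by simp
  finally show ?thesis by (simp add: H_def D_def r_def n_def \<beta>_def)
qed

text \<open>Differencing doubles the frequency, so the approximation a/q is taken for 2 \<theta> and
  the denominator becomes Q = 2q <= 16 N. The fraction a/Q need not be reduced; this is harmless
  because all numerators modulo Q are summed later.\<close>

lemma weyl_sum_bound:
  fixes N :: nat and \<theta> :: real
  assumes N: "1 \<le> N"
  shows "\<exists>Q a :: int. 1 \<le> Q \<and> Q \<le> 16 * int N \<and>
    (norm (weyl_sum N \<theta>))\<^sup>2 * (of_int Q * (1 + (real N)\<^sup>2 * \<bar>\<theta> - of_int a / of_int Q\<bar>)) \<le> 300000 * real N ^ 4"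
proof -
  obtain a q where q: "coprime a q" "0 < q" "q \<le> int (8 * N)" "\<bar>of_int q * (2 * \<theta>) - of_int a\<bar> < 1 / real (8 * N)"
    using Dirichlet_approx_coprime[of "8 * N" "2 * \<theta>"] N by auto
  let ?b = "(real N)\<^sup>2 * \<bar>\<theta> - of_int a / of_int (2 * q)\<bar>"
  have "2 * \<theta> - of_int a / of_int q = 2 * (\<theta> - of_int a / of_int (2 * q))" using q by (simp add: field_simps)
  then have e: "\<bar>2 * \<theta> - of_int a / of_int q\<bar> = 2 * \<bar>\<theta> - of_int a / of_int (2 * q)\<bar>" by (simp only: abs_mult abs_numeral)
  have "(norm (weyl_sum N \<theta>))\<^sup>2 * (of_int (2 * q) * (1 + ?b)) \<le> (norm (weyl_sum N \<theta>))\<^sup>2 * (2 * (of_int q * (1 + 2 * ?b)))"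
    using q by (intro mult_left_mono) auto
  also have "\<dots> \<le> (\<Sum>h\<in>{-4 * int N..4 * int N}. diff_sum N (2 * \<theta>) h) * (2 * (of_int q * (1 + 2 * ?b)))"
    using q by (intro mult_right_mono norm_weyl_sum_square_le) auto
  also have "\<dots> = 2 * ((\<Sum>h\<in>{-4 * int N..4 * int N}. diff_sum N (2 * \<theta>) h) * (of_int q * (1 + (real N)\<^sup>2 * \<bar>2 * \<theta> - of_int a / of_int q\<bar>)))"
    unfolding e by simp
  also have "\<dots> \<le> 2 * (150000 * real N ^ 4)"
    using q N by (intro mult_left_mono sum_diff_sum_le) auto
  finally show ?thesis using q by (intro exI[of _ "2 * q"] exI[of _ a]) auto
qed

section \<open>Moments of a divisor sum\<close>

text \<open>Arithmetic-geometric mean after normalising each factor by its l^n norm, n being the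
  number of factors; a factor of norm zero makes the left side vanish.\<close>

lemma generalized_Holder:
  fixes h :: "'i \<Rightarrow> 'a \<Rightarrow> real"
  assumes "finite X" "finite I" "I \<noteq> {}" and h: "\<And>i x. i \<in> I \<Longrightarrow> x \<in> X \<Longrightarrow> 0 \<le> h i x"
  shows "(\<Sum>x\<in>X. \<Prod>i\<in>I. h i x) ^ card I \<le> (\<Prod>i\<in>I. \<Sum>x\<in>X. h i x ^ card I)"
proof -
  define n where "n = card I"
  have n: "n > 0" using assms by (simp add: n_def card_gt_0_iff)
  define A where "A = (\<lambda>i. \<Sum>x\<in>X. h i x ^ n)"
  have A0: "A i \<ge> 0" if "i \<in> I" for i using h that by (auto simp: A_def intro: sum_nonneg)
  show ?thesis
  proof (cases "\<exists>i\<in>I. A i = 0")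
    case True
    then obtain i where i: "i \<in> I" "A i = 0" by blast
    have "\<forall>x\<in>X. h i x ^ n = 0"
      using i h assms(1) unfolding A_def by (subst (asm) sum_nonneg_eq_0_iff) auto
    then have "(\<Prod>i\<in>I. h i x) = 0" if "x \<in> X" for x using that i(1) n assms(2) by auto
    then have "(\<Sum>x\<in>X. \<Prod>i\<in>I. h i x) = 0" by simp
    moreover have "0 \<le> (\<Prod>i\<in>I. A i)" using A0 by (intro prod_nonneg) auto
    ultimately show ?thesis using n by (simp add: n_def A_def power_0_left)
  next
    case False
    define a where "a = (\<lambda>i. root n (A i))"
    have Apos: "A i > 0" if "i \<in> I" for i using A0[OF that] False that by (metis order_le_less)
    have a: "a i > 0" "a i ^ n = A i" if "i \<in> I" for i using Apos[OF that] n by (simp_all add: a_def)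
    have "(\<Prod>i\<in>I. h i x) \<le> (\<Prod>i\<in>I. a i) * ((\<Sum>i\<in>I. h i x ^ n / A i) / n)" if x: "x \<in> X" for x
    proof -
      define P where "P = (\<Prod>i\<in>I. h i x / a i)"
      have P: "P \<ge> 0" unfolding P_def using h x a by (intro prod_nonneg) (auto intro!: divide_nonneg_nonneg simp: less_imp_le)
      have "(\<Prod>i\<in>I. (h i x / a i) ^ n) powr (1 / card I) \<le> (\<Sum>i\<in>I. (h i x / a i) ^ n / card I)"
        by (rule arith_geom_mean) (use assms x a in \<open>auto intro!: zero_le_power divide_nonneg_nonneg simp: less_imp_le\<close>)
      then have "(P ^ n) powr (1 / n) \<le> (\<Sum>i\<in>I. (h i x / a i) ^ n) / n"
        by (simp add: P_def n_def prod_power_distrib sum_divide_distrib)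
      moreover have "(P ^ n) powr (1 / n) = P" using P n
        by (cases "P = 0") (simp_all add: powr_realpow[symmetric] powr_powr)
      moreover have "(\<Sum>i\<in>I. (h i x / a i) ^ n) = (\<Sum>i\<in>I. h i x ^ n / A i)"
        using a by (intro sum.cong) (auto simp: power_divide)
      ultimately have "(\<Prod>i\<in>I. h i x) / (\<Prod>i\<in>I. a i) \<le> (\<Sum>i\<in>I. h i x ^ n / A i) / n"
        by (simp add: P_def prod_dividef)
      moreover have "(\<Prod>i\<in>I. a i) > 0" using a by (intro prod_pos) auto
      ultimately show ?thesis by (simp add: pos_divide_le_eq mult.commute)
    qed
    then have "(\<Sum>x\<in>X. \<Prod>i\<in>I. h i x) \<le> (\<Sum>x\<in>X. (\<Prod>i\<in>I. a i) * ((\<Sum>i\<in>I. h i x ^ n / A i) / n))" by (rule sum_mono)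
    also have "\<dots> = (\<Prod>i\<in>I. a i) * ((\<Sum>x\<in>X. \<Sum>i\<in>I. h i x ^ n / A i) / n)"
      by (simp add: sum_distrib_left sum_divide_distrib)
    also have "(\<Sum>x\<in>X. \<Sum>i\<in>I. h i x ^ n / A i) = (\<Sum>i\<in>I. (\<Sum>x\<in>X. h i x ^ n) / A i)"
      by (subst sum.swap) (simp add: sum_divide_distrib)
    also have "\<dots> = (\<Sum>i\<in>I. 1)" using False by (intro sum.cong) (auto simp: A_def)
    also have "\<dots> = n" by (simp add: n_def)
    finally have "(\<Sum>x\<in>X. \<Prod>i\<in>I. h i x) \<le> (\<Prod>i\<in>I. a i)" using n by simp
    moreover have "0 \<le> (\<Sum>x\<in>X. \<Prod>i\<in>I. h i x)" using h by (intro sum_nonneg prod_nonneg) auto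
    ultimately have "(\<Sum>x\<in>X. \<Prod>i\<in>I. h i x) ^ n \<le> (\<Prod>i\<in>I. a i) ^ n" by (intro power_mono)
    also have "\<dots> = (\<Prod>i\<in>I. A i)" unfolding prod_power_distrib using a by (intro prod.cong) auto
    finally show ?thesis by (simp add: n_def A_def)
  qed
qed

text \<open>Threefold Hoelder for f^{1/2}, f^{1/2} and g.\<close>

lemma Holder_3_2:
  fixes f g :: "'a \<Rightarrow> real"
  assumes "finite X" "\<And>x. x \<in> X \<Longrightarrow> 0 \<le> f x" "\<And>x. x \<in> X \<Longrightarrow> 0 \<le> g x"
  shows "(\<Sum>x\<in>X. f x * g x) ^ 3 \<le> (\<Sum>x\<in>X. f x powr (3/2))\<^sup>2 * (\<Sum>x\<in>X. g x ^ 3)"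
proof -
  define h where "h = (\<lambda>i::nat. \<lambda>x. if i < 2 then f x powr (1/2) else g x)"
  have I: "{..<3::nat} = {0,1,2}" by auto
  have "(\<Sum>x\<in>X. \<Prod>i\<in>{..<3}. h i x) ^ card {..<3::nat} \<le> (\<Prod>i\<in>{..<3}. \<Sum>x\<in>X. h i x ^ card {..<3::nat})"
    by (rule generalized_Holder) (use assms in \<open>auto simp: h_def I\<close>)
  also have "(\<Sum>x\<in>X. \<Prod>i\<in>{..<3}. h i x) = (\<Sum>x\<in>X. f x * g x)"
  proof (rule sum.cong)
    fix x assume "x \<in> X"
    then have "f x powr (1/2) * f x powr (1/2) = f x" using assms by (cases "f x = 0") (auto simp: powr_add[symmetric])
    then show "(\<Prod>i\<in>{..<3}. h i x) = f x * g x" by (simp add: I h_def)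
  qed simp
  also have "(\<Prod>i\<in>{..<3}. \<Sum>x\<in>X. h i x ^ card {..<3::nat}) = (\<Sum>x\<in>X. f x powr (3/2))\<^sup>2 * (\<Sum>x\<in>X. g x ^ 3)"
  proof -
    have "(f x powr (1/2)) ^ 3 = f x powr (3/2)" for x
      by (cases "f x = 0") (simp_all add: powr_power)
    moreover have "card {..<3::nat} = 3" by simp
    moreover have "(\<Prod>i\<in>{..<3::nat}. F i) = F 0 * F 1 * F 2" for F :: "nat \<Rightarrow> real" by (simp add: I)
    ultimately show ?thesis by (simp add: h_def power2_eq_square)
  qed
  finally show ?thesis by simp
qed

section \<open>The function sigma_{-1/2} and its third moment\<close>

lemma powr_sum_bounded:
  fixes a :: real
  assumes "a > 1"
  shows "\<exists>Z>0. \<forall>V::nat. (\<Sum>d\<in>{1..V}. real d powr (-a)) \<le> Z"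
proof -
  have s: "summable (\<lambda>d. real d powr (-a))" using assms by (simp add: summable_real_powr_iff)
  have "(\<Sum>d\<in>{1..V}. real d powr (-a)) \<le> suminf (\<lambda>d. real d powr (-a)) + 1" for V
    using sum_le_suminf[OF s, of "{1..V}"] by simp
  moreover have "0 \<le> suminf (\<lambda>d. real d powr (-a))" by (intro suminf_nonneg s) simp
  ultimately show ?thesis by (intro exI[of _ "suminf (\<lambda>d. real d powr (-a)) + 1"]) auto
qed

lemma sum_powr_neg_half_le: "(\<Sum>d\<in>{1..V::nat}. real d powr (-(1/2))) \<le> 2 * sqrt V"
proof (induction V)
  case (Suc V)
  define y where "y = real (Suc V)"
  have y: "y \<ge> 1" by (simp add: y_def)
  have "y powr (-(1/2)) = 1 / sqrt y" using y by (simp add: powr_minus_divide powr_half_sqrt)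
  also have "\<dots> = 2 / (2 * sqrt y)" by simp
  also have "\<dots> \<le> 2 / (sqrt y + sqrt (y - 1))" using y by (intro divide_left_mono mult_pos_pos add_pos_nonneg) auto
  also have "\<dots> = 2 * (sqrt y - sqrt (y - 1))"
  proof -
    have "(sqrt y - sqrt (y - 1)) * (sqrt y + sqrt (y - 1)) = 1" using y by (simp add: algebra_simps)
    moreover have "sqrt y + sqrt (y - 1) > 0" using y by (intro add_pos_nonneg) auto
    ultimately show ?thesis by (simp add: field_simps)
  qed
  finally show ?case using Suc by (simp add: y_def)
qed simp

text \<open>This is sigma_{-1/2}(u). The exponent is what remains of the Weyl factor Q^{-3/2} after
  summing over the Q fractions a/Q.\<close>

definition divisor_sum :: "nat \<Rightarrow> real" where
  "divisor_sum u = (\<Sum>d | d dvd u. real d powr (-(1/2)))"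

lemma divisor_sum_nonneg: "0 \<le> divisor_sum u" by (simp add: divisor_sum_def sum_nonneg)

lemma divisor_sum_mult_le:
  assumes "u > 0" "v > 0"
  shows "divisor_sum (u * v) \<le> divisor_sum u * divisor_sum v"
proof -
  have "divisor_sum (u * v) \<le> (\<Sum>(a, b)\<in>{a. a dvd u} \<times> {b. b dvd v}. real a powr (-(1/2)) * real b powr (-(1/2)))"
    unfolding divisor_sum_def
  proof (rule sum_le_included[where i = "\<lambda>(a, b). a * b"])
    show "\<forall>d\<in>{d. d dvd u * v}. \<exists>y\<in>{a. a dvd u} \<times> {b. b dvd v}. (case y of (a, b) \<Rightarrow> a * b) = d \<and>
        real d powr (-(1/2)) \<le> (case y of (a, b) \<Rightarrow> real a powr (-(1/2)) * real b powr (-(1/2)))"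
    proof clarify
      fix d assume "d dvd u * v"
      then obtain a b where "d = a * b" "a dvd u" "b dvd v" using division_decomp by blast
      then show "\<exists>y\<in>{a. a dvd u} \<times> {b. b dvd v}. (case y of (a, b) \<Rightarrow> a * b) = d \<and>
        real d powr (-(1/2)) \<le> (case y of (a, b) \<Rightarrow> real a powr (-(1/2)) * real b powr (-(1/2)))"
        by (intro bexI[of _ "(a, b)"]) (auto simp: powr_mult)
    qed
  qed (use assms in \<open>auto intro!: finite_divisors_nat\<close>)
  also have "\<dots> = divisor_sum u * divisor_sum v"
    by (simp add: divisor_sum_def sum_product sum.cartesian_product)
  finally show ?thesis .
qed

text \<open>Divisors up to sqrt u are bounded by all integers in that range. The larger ones number
  at most sqrt u, because their codivisors are at most sqrt u, and each weighs at most
  u^{-1/4}.\<close>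

lemma divisor_sum_le_powr:
  assumes u: "u > 0"
  shows "divisor_sum u \<le> 3 * real u powr (1/4)"
proof -
  define m where "m = nat \<lfloor>sqrt u\<rfloor>"
  have m: "real m \<le> sqrt u" "sqrt u < real m + 1" by (simp_all add: m_def) 
  define D1 where "D1 = {d. d dvd u \<and> d \<le> m}"
  define D2 where "D2 = {d. d dvd u \<and> m < d}"
  have fin: "finite D1" "finite D2" using u by (auto simp: D1_def D2_def)
  have "divisor_sum u = (\<Sum>d\<in>D1. real d powr (-(1/2))) + (\<Sum>d\<in>D2. real d powr (-(1/2)))"
    unfolding divisor_sum_def using fin
    by (subst sum.union_disjoint[symmetric]) (auto simp: D1_def D2_def intro!: sum.cong)
  also have "(\<Sum>d\<in>D1. real d powr (-(1/2))) \<le> (\<Sum>d\<in>{1..m}. real d powr (-(1/2)))"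
    using u by (intro sum_mono2) (auto simp: D1_def Suc_le_eq dest: dvd_pos_nat)
  also have "\<dots> \<le> 2 * sqrt (sqrt u)" 
    by (rule order_trans[OF sum_powr_neg_half_le]) (use m in simp)
  also have "(\<Sum>d\<in>D2. real d powr (-(1/2))) \<le> (\<Sum>d\<in>D2. 1 / sqrt (sqrt u))"
  proof (rule sum_mono)
    fix d assume "d \<in> D2"
    then have "sqrt u \<le> real d" using m(2) by (auto simp: D2_def)
    then have "sqrt (sqrt u) \<le> sqrt d" by simp
    moreover have "real d powr (-(1/2)) = 1 / sqrt d" by (simp add: powr_minus_divide powr_half_sqrt)
    ultimately show "real d powr (-(1/2)) \<le> 1 / sqrt (sqrt u)" using u by (simp add: frac_le)
  qed
  also have "\<dots> = real (card D2) * (1 / sqrt (sqrt u))" by simp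
  also have "\<dots> \<le> sqrt u * (1 / sqrt (sqrt u))"
  proof (rule mult_right_mono)
    have "card D2 \<le> card {1..m}"
    proof (rule card_inj_on_le[where f = "\<lambda>d. u div d"])
      show "inj_on (\<lambda>d. u div d) D2"
      proof (rule inj_onI)
        fix x y assume xy: "x \<in> D2" "y \<in> D2" "u div x = u div y"
        then have "x * (u div x) = u" "y * (u div x) = u" by (auto simp: D2_def)
        then have "x * (u div x) = y * (u div x)" "u div x \<noteq> 0" using u by (simp, metis mult_0_right less_irrefl)
        then show "x = y" by simp
      qed
      show "(\<lambda>d. u div d) ` D2 \<subseteq> {1..m}"
      proof (rule image_subsetI)
        fix d assume "d \<in> D2"
        then have d: "d dvd u" "m < d" by (auto simp: D2_def)
        then have du: "d * (u div d) = u" by simp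
        then have "u div d \<noteq> 0" using u by (metis mult_0_right less_irrefl)
        have "sqrt u * sqrt u = real d * real (u div d)" by (simp add: of_nat_mult[symmetric] du del: of_nat_mult)
        have "real (u div d) \<le> sqrt u"
        proof (rule ccontr)
          assume "\<not> real (u div d) \<le> sqrt u"
          then have "sqrt u * sqrt u < real d * real (u div d)"
            using m(2) d(2) u by (intro mult_strict_mono) auto
          then show False using \<open>sqrt u * sqrt u = real d * real (u div d)\<close> by simp
        qed
        then have "u div d \<le> m" unfolding m_def by (simp add: le_nat_floor)
        then show "u div d \<in> {1..m}" using \<open>u div d \<noteq> 0\<close> by simp
      qed
    qed simp
    then show "real (card D2) \<le> sqrt u" using m(1) by simp
  qed simp
  also have "\<dots> = sqrt (sqrt u)" using u by (simp add: real_div_sqrt)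
  finally have "divisor_sum u \<le> 3 * sqrt (sqrt u)" by simp
  also have "sqrt (sqrt u) = real u powr (1/4)" by (simp add: powr_half_sqrt[symmetric] powr_powr)
  finally show ?thesis .
qed

lemma sum_multiples:
  assumes "g > 0"
  shows "(\<Sum>d | d \<in> {1..U} \<and> g dvd d. f d) = (\<Sum>k\<in>{1..U div g::nat}. f (g * k))"
proof -
  have "{d. d \<in> {1..U} \<and> g dvd d} = (\<lambda>k. g * k) ` {1..U div g}"
  proof (intro set_eqI iffI)
    fix d assume "d \<in> {d. d \<in> {1..U} \<and> g dvd d}"
    then obtain k where k: "d = g * k" "1 \<le> d" "d \<le> U" by (auto elim: dvdE)
    have "k \<le> U div g" using k assms by (simp add: less_eq_div_iff_mult_less_eq mult.commute)
    moreover have "1 \<le> k" using k by (cases k) auto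
    ultimately show "d \<in> (\<lambda>k. g * k) ` {1..U div g}" using k by auto
  next
    fix d assume "d \<in> (\<lambda>k. g * k) ` {1..U div g}"
    then obtain k where k: "d = g * k" "1 \<le> k" "k \<le> U div g" by (meson atLeastAtMost_iff imageE)
    then have "g * k \<le> U" using assms by (simp add: less_eq_div_iff_mult_less_eq mult.commute)
    then show "d \<in> {d. d \<in> {1..U} \<and> g dvd d}" using k assms by (auto simp: Suc_le_eq)
  qed
  moreover have "inj_on (\<lambda>k. g * k) {1..U div g}" using assms by (auto simp: inj_on_def)
  ultimately show ?thesis by (simp add: sum.reindex)
qed

lemma divisor_sum_alt:
  assumes "u \<in> {1..U}"
  shows "divisor_sum u = (\<Sum>d\<in>{1..U}. if d dvd u then real d powr (-(1/2)) else 0)"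
proof -
  have "{d. d dvd u} = {d\<in>{1..U}. d dvd u}" using assms by (auto simp: Suc_le_eq dest: dvd_imp_le dvd_pos_nat)
  then show ?thesis unfolding divisor_sum_def by (simp only: sum.inter_filter[OF finite_atLeastAtMost])
qed

lemma sum_divisor_sum_le:
  assumes "\<And>V::nat. (\<Sum>d\<in>{1..V}. real d powr (-(3/2))) \<le> Z"
  shows "(\<Sum>v\<in>{1..V}. divisor_sum v) \<le> Z * real V"
proof -
  have "(\<Sum>v\<in>{1..V}. divisor_sum v) = (\<Sum>v\<in>{1..V}. \<Sum>d\<in>{1..V}. if d dvd v then real d powr (-(1/2)) else 0)"
    by (intro sum.cong refl divisor_sum_alt)
  also have "\<dots> = (\<Sum>d\<in>{1..V}. \<Sum>v\<in>{1..V}. if d dvd v then real d powr (-(1/2)) else 0)"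
    by (rule sum.swap)
  also have "\<dots> \<le> (\<Sum>d\<in>{1..V}. real V * real d powr (-(3/2)))"
  proof (rule sum_mono)
    fix d assume d: "d \<in> {1..V}"
    have "(\<Sum>v\<in>{1..V}. if d dvd v then real d powr (-(1/2)) else 0) = (\<Sum>v | v \<in> {1..V} \<and> d dvd v. real d powr (-(1/2)))"
      by (subst sum.inter_filter[symmetric]) auto
    also have "\<dots> = real (V div d) * real d powr (-(1/2))" using d by (subst sum_multiples) auto
    also have "\<dots> \<le> (real V / real d) * real d powr (-(1/2))" by (intro mult_right_mono of_nat_div_le_of_nat) simp
    also have "\<dots> = real V * real d powr (-(3/2))"
    proof -
      have "real d powr (-(3/2)) = real d powr (-1 + -(1/2))" by simp
      also have "\<dots> = real d powr (-1) * real d powr (-(1/2))" by (rule powr_add)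
      finally show ?thesis using d by (simp add: powr_minus_divide)
    qed
    finally show "(\<Sum>v\<in>{1..V}. if d dvd v then real d powr (-(1/2)) else 0) \<le> real V * real d powr (-(3/2))" .
  qed
  also have "\<dots> = real V * (\<Sum>d\<in>{1..V}. real d powr (-(3/2)))" by (simp add: sum_distrib_left)
  also have "\<dots> \<le> real V * Z" by (intro mult_left_mono assms) simp
  finally show ?thesis by (simp add: mult.commute)
qed

text \<open>The multiples have density 1/l, and submultiplicativity costs the factor
  \<open>divisor_sum l\<close>, at most 3 l^{1/4}.\<close>

lemma sum_divisor_sum_multiples_le:
  assumes Z: "\<And>V::nat. (\<Sum>d\<in>{1..V}. real d powr (-(3/2))) \<le> Z" and l: "l > 0"
  shows "(\<Sum>u | u \<in> {1..U} \<and> l dvd u. divisor_sum u) \<le> 3 * Z * real U * real l powr (-(3/4))"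
proof -
  have Z0: "0 \<le> Z" using Z[of 0] by simp
  have "(\<Sum>u | u \<in> {1..U} \<and> l dvd u. divisor_sum u) = (\<Sum>k\<in>{1..U div l}. divisor_sum (l * k))" by (rule sum_multiples[OF l])
  also have "\<dots> \<le> (\<Sum>k\<in>{1..U div l}. divisor_sum l * divisor_sum k)" using l by (intro sum_mono divisor_sum_mult_le) auto
  also have "\<dots> = divisor_sum l * (\<Sum>k\<in>{1..U div l}. divisor_sum k)" by (simp add: sum_distrib_left)
  also have "\<dots> \<le> divisor_sum l * (Z * real (U div l))" by (intro mult_left_mono sum_divisor_sum_le Z divisor_sum_nonneg)
  also have "\<dots> \<le> (3 * real l powr (1/4)) * (Z * (real U / real l))"
    using Z0 l by (intro mult_mono divisor_sum_le_powr mult_left_mono of_nat_div_le_of_nat) auto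
  also have "\<dots> = 3 * Z * real U * real l powr (-(3/4))"
  proof -
    have "real l powr (-(3/4)) = real l powr (1/4 + -1)" by simp
    also have "\<dots> = real l powr (1/4) * real l powr (-1)" by (rule powr_add)
    finally show ?thesis using l by (simp add: powr_minus_divide)
  qed
  finally show ?thesis .
qed

text \<open>Expanding the cube completely leads to a divergent sum unless the least common multiple is
  kept, so only two factors are expanded and the third is estimated by submultiplicativity.\<close>

lemma divisor_sum_third_moment: "\<exists>C>0. \<forall>U::nat. (\<Sum>u\<in>{1..U}. divisor_sum u ^ 3) \<le> C * real U"
proof -
  obtain Z1 where Z1: "Z1 > 0" "\<And>V::nat. (\<Sum>d\<in>{1..V}. real d powr (-(3/2))) \<le> Z1" 
    using powr_sum_bounded[of "3/2"] by auto
  obtain Z2 where Z2: "Z2 > 0" "\<And>V::nat. (\<Sum>d\<in>{1..V}. real d powr (-(5/4))) \<le> Z2" 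
    using powr_sum_bounded[of "5/4"] by auto
  obtain Z3 where Z3: "Z3 > 0" "\<And>V::nat. (\<Sum>d\<in>{1..V}. real d powr (-(7/4))) \<le> Z3" 
    using powr_sum_bounded[of "7/4"] by auto
  have "(\<Sum>u\<in>{1..U}. divisor_sum u ^ 3) \<le> 3 * Z1 * Z2\<^sup>2 * Z3 * real U" for U :: nat
  proof -
    let ?I = "{1..U}"
    define p where "p = (\<lambda>d::nat. real d powr (-(1/2)))"
    define w where "w = (\<lambda>d::nat. real d powr (-(5/4)))"
    have "(\<Sum>u\<in>?I. divisor_sum u ^ 3) = (\<Sum>u\<in>?I. \<Sum>d\<in>?I. \<Sum>e\<in>?I. if d dvd u \<and> e dvd u then p d * p e * divisor_sum u else 0)"
    proof (rule sum.cong)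
      fix u assume u: "u \<in> ?I"
      have "divisor_sum u ^ 3 = (divisor_sum u * divisor_sum u) * divisor_sum u" by (simp add: power3_eq_cube)
      also have "divisor_sum u * divisor_sum u = (\<Sum>d\<in>?I. \<Sum>e\<in>?I. (if d dvd u then p d else 0) * (if e dvd u then p e else 0))"
        unfolding p_def divisor_sum_alt[OF u] sum_product by (rule refl)
      also have "\<dots> * divisor_sum u = (\<Sum>d\<in>?I. \<Sum>e\<in>?I. if d dvd u \<and> e dvd u then p d * p e * divisor_sum u else 0)"
        by (simp add: sum_distrib_right if_distrib cong: if_cong) (intro sum.cong; simp)
      finally show "divisor_sum u ^ 3 = (\<Sum>d\<in>?I. \<Sum>e\<in>?I. if d dvd u \<and> e dvd u then p d * p e * divisor_sum u else 0)" .
    qed simp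
    also have "\<dots> = (\<Sum>d\<in>?I. \<Sum>u\<in>?I. \<Sum>e\<in>?I. if d dvd u \<and> e dvd u then p d * p e * divisor_sum u else 0)" by (rule sum.swap)
    also have "\<dots> = (\<Sum>d\<in>?I. \<Sum>e\<in>?I. \<Sum>u\<in>?I. if d dvd u \<and> e dvd u then p d * p e * divisor_sum u else 0)"
      by (rule sum.cong[OF refl], rule sum.swap)
    also have "\<dots> \<le> (\<Sum>d\<in>?I. \<Sum>e\<in>?I. 3 * Z1 * real U * (\<Sum>g\<in>?I. if g dvd d \<and> g dvd e then real g powr (3/4) * (w d * w e) else 0))"
    proof (intro sum_mono)
      fix d e assume d: "d \<in> ?I" and e: "e \<in> ?I"
      \<comment> \<open>Both d and e divide u exactly if l does, and l = d e / gcd d e turns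
        l^{-3/4} into a product in d and e up to the factor gcd^{3/4}.\<close>
      define l where "l = lcm d e"
      have l: "l > 0" using d e by (auto simp: l_def intro: lcm_pos_nat)
      have "(\<Sum>u\<in>?I. if d dvd u \<and> e dvd u then p d * p e * divisor_sum u else 0) = (\<Sum>u | u \<in> ?I \<and> l dvd u. p d * p e * divisor_sum u)"
        unfolding l_def lcm_least_iff by (subst sum.inter_filter[symmetric]) auto
      also have "\<dots> = p d * p e * (\<Sum>u | u \<in> ?I \<and> l dvd u. divisor_sum u)" by (simp add: sum_distrib_left)
      also have "\<dots> \<le> p d * p e * (3 * Z1 * real U * real l powr (-(3/4)))"
        by (intro mult_left_mono sum_divisor_sum_multiples_le Z1 l) (simp add: p_def)
      also have "real l powr (-(3/4)) = real (gcd d e) powr (3/4) * (real d powr (-(3/4)) * real e powr (-(3/4)))"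
      proof -
        have "real l * real (gcd d e) = real d * real e" by (metis l_def of_nat_mult prod_gcd_lcm_nat mult.commute)
        then have "(real l * real (gcd d e)) powr (-(3/4)) = (real d * real e) powr (-(3/4))" by simp
        then have "real l powr (-(3/4)) * real (gcd d e) powr (-(3/4)) = real d powr (-(3/4)) * real e powr (-(3/4))"
          by (simp add: powr_mult)
        moreover have "real (gcd d e) powr (-(3/4)) * real (gcd d e) powr (3/4) = 1"
          using d by (simp add: powr_add[symmetric])
        moreover have "L = G2 * D" if "L * G1 = D" "G1 * G2 = 1" for L G1 G2 D :: real
          using that by (metis mult.assoc mult.commute mult_1)
        ultimately show ?thesis by blast
      qed
      also have "p d * p e * (3 * Z1 * real U * (real (gcd d e) powr (3/4) * (real d powr (-(3/4)) * real e powr (-(3/4)))))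
        = 3 * Z1 * real U * (real (gcd d e) powr (3/4) * (w d * w e))"
      proof -
        have "w x = p x * real x powr (-(3/4))" for x
          unfolding w_def p_def powr_add[symmetric] by simp
        then show ?thesis by (simp add: mult_ac)
      qed
      \<comment> \<open>Summing over all common divisors g, instead of taking only the gcd,
        decouples d from e.\<close>
      also have "\<dots> \<le> 3 * Z1 * real U * (\<Sum>g\<in>?I. if g dvd d \<and> g dvd e then real g powr (3/4) * (w d * w e) else 0)"
      proof (rule mult_left_mono)
        let ?h = "\<lambda>g. if g dvd d \<and> g dvd e then real g powr (3/4) * (w d * w e) else 0"
        have "gcd d e \<in> ?I" using d e by (auto simp: Suc_le_eq intro: order_trans[OF gcd_le1_nat])
        then have "?h (gcd d e) \<le> sum ?h ?I" by (intro member_le_sum) (auto simp: w_def)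
        then show "real (gcd d e) powr (3/4) * (w d * w e) \<le> sum ?h ?I" by simp
      qed (use Z1 in simp)
      finally show "(\<Sum>u\<in>?I. if d dvd u \<and> e dvd u then p d * p e * divisor_sum u else 0) \<le> 3 * Z1 * real U * (\<Sum>g\<in>?I. if g dvd d \<and> g dvd e then real g powr (3/4) * (w d * w e) else 0)" .
    qed
    also have "\<dots> = 3 * Z1 * real U * (\<Sum>d\<in>?I. \<Sum>e\<in>?I. \<Sum>g\<in>?I. if g dvd d \<and> g dvd e then real g powr (3/4) * (w d * w e) else 0)"
      by (simp add: sum_distrib_left)
    also have "(\<Sum>d\<in>?I. \<Sum>e\<in>?I. \<Sum>g\<in>?I. if g dvd d \<and> g dvd e then real g powr (3/4) * (w d * w e) else 0)
      = (\<Sum>d\<in>?I. \<Sum>g\<in>?I. \<Sum>e\<in>?I. if g dvd d \<and> g dvd e then real g powr (3/4) * (w d * w e) else 0)"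
      by (rule sum.cong[OF refl], rule sum.swap)
    also have "\<dots> = (\<Sum>g\<in>?I. \<Sum>d\<in>?I. \<Sum>e\<in>?I. if g dvd d \<and> g dvd e then real g powr (3/4) * (w d * w e) else 0)" by (rule sum.swap)
    also have "\<dots> = (\<Sum>g\<in>?I. real g powr (3/4) * (\<Sum>d | d \<in> ?I \<and> g dvd d. w d)\<^sup>2)"
    proof (rule sum.cong)
      fix g assume "g \<in> ?I"
      have "(\<Sum>d\<in>?I. \<Sum>e\<in>?I. if g dvd d \<and> g dvd e then real g powr (3/4) * (w d * w e) else 0)
        = (\<Sum>d\<in>?I. \<Sum>e\<in>?I. real g powr (3/4) * ((if g dvd d then w d else 0) * (if g dvd e then w e else 0)))"
        by (intro sum.cong) auto
      also have "\<dots> = real g powr (3/4) * (\<Sum>d\<in>?I. \<Sum>e\<in>?I. (if g dvd d then w d else 0) * (if g dvd e then w e else 0))"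
        by (simp only: sum_distrib_left)
      also have "\<dots> = real g powr (3/4) * ((\<Sum>d\<in>?I. if g dvd d then w d else 0) * (\<Sum>e\<in>?I. if g dvd e then w e else 0))"
        by (simp only: sum_product)
      also have "(\<Sum>d\<in>?I. if g dvd d then w d else 0) = (\<Sum>d | d \<in> ?I \<and> g dvd d. w d)" by (subst sum.inter_filter[symmetric]) auto
      finally show "(\<Sum>d\<in>?I. \<Sum>e\<in>?I. if g dvd d \<and> g dvd e then real g powr (3/4) * (w d * w e) else 0)
        = real g powr (3/4) * (\<Sum>d | d \<in> ?I \<and> g dvd d. w d)\<^sup>2" by (simp add: power2_eq_square)
    qed simp
    \<comment> \<open>Writing d = g k in the inner sum, which occurs squared, leaves g^{3/4 - 5/2} =
      g^{-7/4}, and this is summable.\<close>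
    also have "\<dots> \<le> (\<Sum>g\<in>?I. Z2\<^sup>2 * real g powr (-(7/4)))"
    proof (rule sum_mono)
      fix g assume g: "g \<in> ?I"
      have "(\<Sum>d | d \<in> ?I \<and> g dvd d. w d) = w g * (\<Sum>k\<in>{1..U div g}. w k)"
        using g by (subst sum_multiples) (auto simp: sum_distrib_left w_def powr_mult)
      also have "\<dots> \<le> w g * Z2" unfolding w_def by (intro mult_left_mono Z2) simp
      finally have "real g powr (3/4) * (\<Sum>d | d \<in> ?I \<and> g dvd d. w d)\<^sup>2 \<le> real g powr (3/4) * (w g * Z2)\<^sup>2"
        by (intro mult_left_mono power_mono) (auto intro!: sum_nonneg simp: w_def)
      also have "\<dots> = Z2\<^sup>2 * (real g powr (3/4) * (w g * w g))" by (simp add: power2_eq_square)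
      also have "real g powr (3/4) * (w g * w g) = real g powr (-(7/4))" by (simp add: w_def powr_add[symmetric])
      finally show "real g powr (3/4) * (\<Sum>d | d \<in> ?I \<and> g dvd d. w d)\<^sup>2 \<le> Z2\<^sup>2 * real g powr (-(7/4))" .
    qed
    also have "\<dots> = Z2\<^sup>2 * (\<Sum>g\<in>?I. real g powr (-(7/4)))" by (simp add: sum_distrib_left)
    also have "\<dots> \<le> Z2\<^sup>2 * Z3" by (intro mult_left_mono Z3) simp
    finally have "(\<Sum>u\<in>?I. divisor_sum u ^ 3) \<le> 3 * Z1 * real U * (Z2\<^sup>2 * Z3)" using Z1 by (simp add: mult_left_mono)
    then show ?thesis by (simp add: mult_ac)
  qed
  then show ?thesis using Z1(1) Z2(1) Z3(1) by (intro exI[of _ "3 * Z1 * Z2\<^sup>2 * Z3"]) auto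
qed

text \<open>The range 16 N is that of the denominators in \<open>weyl_sum_bound\<close>; stopping
  there also gives k = 0, which every Q divides, a finite value of order at most sqrt N.\<close>

definition sq_kernel :: "nat \<Rightarrow> int \<Rightarrow> real" where
  "sq_kernel N k = (\<Sum>Q\<in>{1..16 * N}. if int Q dvd k then real Q powr (-(1/2)) else 0)"

lemma sq_kernel_nonneg: "0 \<le> sq_kernel N k"
  by (simp add: sq_kernel_def sum_nonneg)

lemma sq_kernel_0_le: "sq_kernel N 0 \<le> 8 * sqrt N"
proof -
  have "sq_kernel N 0 \<le> 2 * sqrt (16 * N)" using sum_powr_neg_half_le[of "16 * N"] by (simp add: sq_kernel_def)
  also have "sqrt (16 * N) = 4 * sqrt N" by (simp add: real_sqrt_mult)
  finally show ?thesis by simp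
qed

lemma sq_kernel_mult_le:
  assumes "v \<noteq> 0" "w \<noteq> 0"
  shows "sq_kernel N (v * w) \<le> divisor_sum (nat \<bar>v\<bar>) * divisor_sum (nat \<bar>w\<bar>)"
proof -
  have e: "int Q dvd v * w \<longleftrightarrow> Q dvd nat \<bar>v\<bar> * nat \<bar>w\<bar>" for Q
  proof -
    have "int (nat \<bar>v\<bar> * nat \<bar>w\<bar>) = \<bar>v * w\<bar>" by (simp add: abs_mult)
    then show ?thesis by (metis dvd_abs_iff int_dvd_int_iff)
  qed
  have "sq_kernel N (v * w) = (\<Sum>Q | Q \<in> {1..16 * N} \<and> Q dvd nat \<bar>v\<bar> * nat \<bar>w\<bar>. real Q powr (-(1/2)))"
    unfolding sq_kernel_def e by (subst sum.inter_filter[symmetric]) auto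
  also have "\<dots> \<le> divisor_sum (nat \<bar>v\<bar> * nat \<bar>w\<bar>)"
    unfolding divisor_sum_def using assms by (intro sum_mono2) auto
  also have "\<dots> \<le> divisor_sum (nat \<bar>v\<bar>) * divisor_sum (nat \<bar>w\<bar>)" using assms by (intro divisor_sum_mult_le) auto
  finally show ?thesis .
qed

text \<open>With v = m - m' and w = m + m' the kernel at v w is at most a product of two divisor
  sums, so the moment splits into two one-dimensional ones. Pairs with m^2 = m'^2 are left out,
  since there the kernel is of size sqrt N and its cube would be too large.\<close>

lemma sq_kernel_third_moment:
  "\<exists>C>0. \<forall>N::nat. (\<Sum>(m, m')\<in>{(m, m'). m \<in> {-int N..int N} \<and> m' \<in> {-int N..int N} \<and> m\<^sup>2 \<noteq> m'\<^sup>2}.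
      sq_kernel N (m\<^sup>2 - m'\<^sup>2) ^ 3) \<le> C * (real N)\<^sup>2"
proof -
  obtain C where C: "C > 0" "\<And>U::nat. (\<Sum>u\<in>{1..U}. divisor_sum u ^ 3) \<le> C * real U"
    using divisor_sum_third_moment by auto
  have "(\<Sum>(m, m')\<in>{(m, m'). m \<in> {-int N..int N} \<and> m' \<in> {-int N..int N} \<and> m\<^sup>2 \<noteq> m'\<^sup>2}.
      sq_kernel N (m\<^sup>2 - m'\<^sup>2) ^ 3) \<le> (16 * C\<^sup>2) * (real N)\<^sup>2" (is "sum _ ?P \<le> _") for N
  proof -
    define J where "J = {-2 * int N..2 * int N} - {0}"
    define s where "s = (\<lambda>v::int. divisor_sum (nat \<bar>v\<bar>) ^ 3)"
    have s0: "0 \<le> s v" for v by (simp add: s_def divisor_sum_nonneg)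
    have fin: "finite ?P" by (rule finite_subset[of _ "{-int N..int N} \<times> {-int N..int N}"]) auto
    have "(\<Sum>(m, m')\<in>?P. sq_kernel N (m\<^sup>2 - m'\<^sup>2) ^ 3) \<le> (\<Sum>(v, w)\<in>J \<times> J. s v * s w)"
    proof (rule sum_le_included[where i = "\<lambda>(v, w). ((v + w) div 2, (w - v) div 2)"])
      show "\<forall>y\<in>J \<times> J. 0 \<le> (case y of (v, w) \<Rightarrow> s v * s w)" using s0 by auto
      show "\<forall>x\<in>?P. \<exists>y\<in>J \<times> J. (case y of (v, w) \<Rightarrow> ((v + w) div 2, (w - v) div 2)) = x \<and>
          (case x of (m, m') \<Rightarrow> sq_kernel N (m\<^sup>2 - m'\<^sup>2) ^ 3) \<le> (case y of (v, w) \<Rightarrow> s v * s w)"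
      proof clarify
        fix m m' assume m: "m \<in> {-int N..int N}" "m' \<in> {-int N..int N}" "m\<^sup>2 \<noteq> m'\<^sup>2"
        define v w where "v = m - m'" and "w = m + m'"
        have vw: "m\<^sup>2 - m'\<^sup>2 = v * w" by (simp add: v_def w_def power2_eq_square algebra_simps)
        then have nz: "v \<noteq> 0" "w \<noteq> 0" using m(3) by auto
        have "sq_kernel N (m\<^sup>2 - m'\<^sup>2) ^ 3 \<le> (divisor_sum (nat \<bar>v\<bar>) * divisor_sum (nat \<bar>w\<bar>)) ^ 3"
          unfolding vw by (intro power_mono sq_kernel_mult_le nz sq_kernel_nonneg)
        then have "sq_kernel N (m\<^sup>2 - m'\<^sup>2) ^ 3 \<le> s v * s w" by (simp add: s_def power_mult_distrib)
        moreover have "v \<in> J" "w \<in> J" using nz m(1,2) by (auto simp: J_def v_def w_def)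
        moreover have "(v + w) div 2 = m" "(w - v) div 2 = m'" by (simp_all add: v_def w_def)
        ultimately show "\<exists>y\<in>J \<times> J. (case y of (v, w) \<Rightarrow> ((v + w) div 2, (w - v) div 2)) = (m, m') \<and>
          sq_kernel N (m\<^sup>2 - m'\<^sup>2) ^ 3 \<le> (case y of (v, w) \<Rightarrow> s v * s w)"
          by (intro bexI[of _ "(v, w)"]) auto
      qed
    qed (use fin in \<open>auto simp: J_def\<close>)
    also have "\<dots> = (\<Sum>v\<in>J. s v)\<^sup>2" by (simp add: power2_eq_square sum_product sum.cartesian_product)
    also have "(\<Sum>v\<in>J. s v) = 2 * (\<Sum>u\<in>{1..2 * N}. divisor_sum u ^ 3)"
    proof -
      have J: "J = {1..2 * int N} \<union> {-2 * int N..-1}" by (auto simp: J_def)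
      have 1: "(\<Sum>v\<in>{1..2 * int N}. s v) = (\<Sum>u\<in>{1..2 * N}. divisor_sum u ^ 3)"
        by (rule sum.reindex_bij_witness[of _ int nat]) (auto simp: s_def)
      have 2: "(\<Sum>v\<in>{-2 * int N..-1}. s v) = (\<Sum>u\<in>{1..2 * N}. divisor_sum u ^ 3)"
        by (rule sum.reindex_bij_witness[of _ "\<lambda>u. - int u" "\<lambda>v. nat (- v)"]) (auto simp: s_def)
      have "sum s J = sum s {1..2 * int N} + sum s {-2 * int N..-1}" unfolding J by (rule sum.union_disjoint) auto
      then show ?thesis using 1 2 by simp
    qed
    also have "(2 * (\<Sum>u\<in>{1..2 * N}. divisor_sum u ^ 3))\<^sup>2 \<le> (2 * (C * real (2 * N)))\<^sup>2"
      by (intro power_mono mult_left_mono C(2)) (auto intro!: sum_nonneg simp: divisor_sum_nonneg)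
    also have "\<dots> = (16 * C\<^sup>2) * (real N)\<^sup>2" by (simp add: power_mult_distrib)
    finally show ?thesis .
  qed
  then show ?thesis using C(1) by (intro exI[of _ "16 * C\<^sup>2"]) auto
qed

lemma sum_squares_le_powr:
  fixes F :: "'a \<Rightarrow> real"
  assumes "finite I" "\<And>m. m \<in> I \<Longrightarrow> 0 \<le> F m"
  shows "(\<Sum>m\<in>I. (F m)\<^sup>2) \<le> (\<Sum>m\<in>I. F m powr (3/2)) powr (4/3)"
proof -
  define s where "s = (\<Sum>m\<in>I. F m powr (3/2))"
  have s0: "0 \<le> s" by (simp add: s_def sum_nonneg)
  have "(\<Sum>m\<in>I. (F m)\<^sup>2) \<le> (\<Sum>m\<in>I. F m powr (3/2) * s powr (1/3))"
  proof (rule sum_mono)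
    fix m assume m: "m \<in> I"
    have "F m powr (3/2) \<le> s" unfolding s_def using assms m by (intro member_le_sum) auto
    then have "(F m powr (3/2)) powr (1/3) \<le> s powr (1/3)" by (intro powr_mono2) auto
    then have "F m powr (1/2) \<le> s powr (1/3)" by (simp add: powr_powr)
    then have "F m powr (3/2) * F m powr (1/2) \<le> F m powr (3/2) * s powr (1/3)" by (intro mult_left_mono) auto
    moreover have "F m powr (3/2) * F m powr (1/2) = (F m)\<^sup>2"
      using assms(2)[OF m] by (cases "F m = 0") (simp_all add: powr_add[symmetric])
    ultimately show "(F m)\<^sup>2 \<le> F m powr (3/2) * s powr (1/3)" by simp
  qed
  also have "\<dots> = s * s powr (1/3)" by (simp add: s_def sum_distrib_right)
  also have "\<dots> = s powr (4/3)" using powr_mult_base[OF s0, of "1/3"] by simp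
  finally show ?thesis by (simp add: s_def)
qed

text \<open>Off the diagonal, Hoelder with exponents 3/2 for F(m) F(m') and 3 for the kernel gives
  (N^2)^{1/3}. For m' = m and m' = -m the kernel is at most 8 sqrt N and the l^2 norm of F is
  controlled by its l^{3/2} norm; this part is absorbed because sqrt N <= N^{2/3}.\<close>

lemma sq_kernel_bilinear_bound:
  "\<exists>C>0. \<forall>N F. 1 \<le> N \<longrightarrow> (\<forall>m. 0 \<le> F m) \<longrightarrow>
    (\<Sum>m\<in>{-int N..int N}. \<Sum>m'\<in>{-int N..int N}. F m * F m' * sq_kernel N (m\<^sup>2 - m'\<^sup>2))
      \<le> C * real N powr (2/3) * (\<Sum>m\<in>{-int N..int N}. F m powr (3/2)) powr (4/3)"
proof -
  obtain C where C: "C > 0" "\<And>N::nat. (\<Sum>(m, m')\<in>{(m, m'). m \<in> {-int N..int N} \<and> m' \<in> {-int N..int N} \<and> m\<^sup>2 \<noteq> m'\<^sup>2}.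
      sq_kernel N (m\<^sup>2 - m'\<^sup>2) ^ 3) \<le> C * (real N)\<^sup>2" using sq_kernel_third_moment by auto
  have "(\<Sum>m\<in>{-int N..int N}. \<Sum>m'\<in>{-int N..int N}. F m * F m' * sq_kernel N (m\<^sup>2 - m'\<^sup>2))
      \<le> (16 + C powr (1/3)) * real N powr (2/3) * (\<Sum>m\<in>{-int N..int N}. F m powr (3/2)) powr (4/3)"
    if N: "1 \<le> N" and F: "\<And>m. 0 \<le> F m" for N F
  proof -
    let ?I = "{-int N..int N}"
    define s where "s = (\<Sum>m\<in>?I. F m powr (3/2))"
    have s0: "0 \<le> s" by (simp add: s_def sum_nonneg)
    define P where "P = {(m, m'). m \<in> ?I \<and> m' \<in> ?I \<and> m\<^sup>2 \<noteq> m'\<^sup>2}"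
    define P0 where "P0 = {(m, m'). m \<in> ?I \<and> m' \<in> ?I \<and> m\<^sup>2 = m'\<^sup>2}"
    have PP: "?I \<times> ?I = P0 \<union> P" "P0 \<inter> P = {}" by (auto simp: P_def P0_def)
    have "finite (P0 \<union> P)" unfolding PP(1)[symmetric] by simp
    then have fin: "finite P" "finite P0" by simp_all
    let ?k = "\<lambda>(m, m'). sq_kernel N (m\<^sup>2 - m'\<^sup>2)" and ?F = "\<lambda>(m, m'). F m * F m'"
    have P0: "(\<Sum>x\<in>P0. ?F x * ?k x) \<le> 16 * real N powr (2/3) * s powr (4/3)"
    proof -
      have "(\<Sum>x\<in>P0. ?F x * ?k x) = sq_kernel N 0 * (\<Sum>x\<in>P0. ?F x)"
        unfolding sum_distrib_left by (rule sum.cong) (auto simp: P0_def)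
      also have "(\<Sum>x\<in>P0. ?F x) \<le> (\<Sum>x\<in>P0. (F (fst x))\<^sup>2 / 2 + (F (snd x))\<^sup>2 / 2)"
      proof (rule sum_mono)
        fix x
        show "?F x \<le> (F (fst x))\<^sup>2 / 2 + (F (snd x))\<^sup>2 / 2"
          using zero_le_power2[of "F (fst x) - F (snd x)"] by (simp add: case_prod_unfold power2_diff)
      qed
      also have "\<dots> = (\<Sum>x\<in>P0. (F (fst x))\<^sup>2) / 2 + (\<Sum>x\<in>P0. (F (snd x))\<^sup>2) / 2"
        by (simp add: sum.distrib sum_divide_distrib)
      also have "(\<Sum>x\<in>P0. (F (snd x))\<^sup>2) = (\<Sum>x\<in>P0. (F (fst x))\<^sup>2)"
        by (rule sum.reindex_bij_witness[of _ prod.swap prod.swap]) (auto simp: P0_def)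
      also have "(\<Sum>x\<in>P0. (F (fst x))\<^sup>2) / 2 + (\<Sum>x\<in>P0. (F (fst x))\<^sup>2) / 2 = (\<Sum>x\<in>P0. (F (fst x))\<^sup>2)" by simp
      also have "(\<Sum>x\<in>P0. (F (fst x))\<^sup>2) \<le> (\<Sum>(m, m')\<in>Sigma ?I (\<lambda>m. {m, -m}). (F m)\<^sup>2)"
        unfolding case_prod_unfold by (rule sum_mono2) (auto simp: P0_def power2_eq_iff)
      also have "\<dots> = (\<Sum>m\<in>?I. \<Sum>m'\<in>{m, -m}. (F m)\<^sup>2)" by (subst sum.Sigma) auto
      also have "\<dots> \<le> (\<Sum>m\<in>?I. 2 * (F m)\<^sup>2)" by (intro sum_mono) (auto simp: card_insert_if)
      also have "\<dots> \<le> 2 * s powr (4/3)"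
        unfolding sum_distrib_left[symmetric] s_def by (intro mult_left_mono sum_squares_le_powr F) auto
      finally have "(\<Sum>x\<in>P0. ?F x * ?k x) \<le> sq_kernel N 0 * (2 * s powr (4/3))"
        by (simp add: mult_left_mono sq_kernel_nonneg)
      also have "\<dots> \<le> (8 * real N powr (2/3)) * (2 * s powr (4/3))"
      proof (rule mult_right_mono)
        have "sqrt N \<le> real N powr (2/3)" using N by (simp add: powr_half_sqrt[symmetric] powr_mono)
        then show "sq_kernel N 0 \<le> 8 * real N powr (2/3)" using sq_kernel_0_le[of N] by linarith
      qed simp
      finally show ?thesis by simp
    qed
    have P: "(\<Sum>x\<in>P. ?F x * ?k x) \<le> C powr (1/3) * real N powr (2/3) * s powr (4/3)"
    proof -
      have 0: "0 \<le> (\<Sum>x\<in>P. ?F x * ?k x)" using F sq_kernel_nonneg by (intro sum_nonneg) auto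
      have "(\<Sum>x\<in>P. ?F x powr (3/2)) \<le> (\<Sum>x\<in>?I \<times> ?I. ?F x powr (3/2))"
        unfolding PP by (rule sum_mono2) (use fin in auto)
      also have "\<dots> = s * s" unfolding s_def sum_product sum.cartesian_product
        using F by (intro sum.cong) (auto simp: powr_mult)
      finally have h1: "(\<Sum>x\<in>P. ?F x powr (3/2)) \<le> s * s" .
      have h2: "(\<Sum>x\<in>P. ?k x ^ 3) \<le> C * (real N)\<^sup>2" using C(2)[of N] by (simp add: P_def case_prod_unfold)
      have "(\<Sum>x\<in>P. ?F x * ?k x) ^ 3 \<le> (\<Sum>x\<in>P. ?F x powr (3/2))\<^sup>2 * (\<Sum>x\<in>P. ?k x ^ 3)"
        using F sq_kernel_nonneg by (intro Holder_3_2 fin) auto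
      also have "\<dots> \<le> (s * s)\<^sup>2 * (C * (real N)\<^sup>2)"
        using h1 h2 sq_kernel_nonneg by (intro mult_mono power_mono sum_nonneg) auto
      finally have "(\<Sum>x\<in>P. ?F x * ?k x) ^ 3 \<le> (s * s)\<^sup>2 * (C * (real N)\<^sup>2)" .
      then have "((\<Sum>x\<in>P. ?F x * ?k x) ^ 3) powr (1/3) \<le> ((s * s)\<^sup>2 * (C * (real N)\<^sup>2)) powr (1/3)"
        using 0 by (intro powr_mono2) auto
      moreover have "((\<Sum>x\<in>P. ?F x * ?k x) ^ 3) powr (1/3) = (\<Sum>x\<in>P. ?F x * ?k x)"
        using 0 by (cases "(\<Sum>x\<in>P. ?F x * ?k x) = 0") (simp_all add: powr_numeral[symmetric] powr_powr del: powr_numeral)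
      moreover have "((s * s)\<^sup>2 * (C * (real N)\<^sup>2)) powr (1/3) = C powr (1/3) * real N powr (2/3) * s powr (4/3)"
      proof -
        have "(s * s)\<^sup>2 = s powr 4" using s0 by (cases "s = 0") (simp_all add: powr_numeral power2_eq_square power_numeral_reduce)
        moreover have "(real N)\<^sup>2 = real N powr 2" using N by (simp add: powr_numeral)
        ultimately show ?thesis using C(1) by (simp add: powr_mult powr_powr del: powr_numeral)
      qed
      ultimately show ?thesis by simp
    qed
    have "(\<Sum>m\<in>?I. \<Sum>m'\<in>?I. F m * F m' * sq_kernel N (m\<^sup>2 - m'\<^sup>2)) = (\<Sum>x\<in>?I \<times> ?I. ?F x * ?k x)"
      unfolding sum.cartesian_product by (rule sum.cong) auto
    also have "\<dots> = (\<Sum>x\<in>P0. ?F x * ?k x) + (\<Sum>x\<in>P. ?F x * ?k x)"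
      unfolding PP by (rule sum.union_disjoint) (use fin PP in auto)
    also have "\<dots> \<le> (16 + C powr (1/3)) * real N powr (2/3) * s powr (4/3)" using P P0 by (simp add: algebra_simps)
    finally show ?thesis by (simp add: s_def)
  qed
  then show ?thesis by (intro exI[of _ "16 + C powr (1/3)"]) (auto intro: add_pos_nonneg)
qed

section \<open>A discrete circle method\<close>

definition root_exp :: "nat \<Rightarrow> int \<Rightarrow> complex" where
  "root_exp M k = cis (2 * pi * of_int k / real M)"

lemma root_exp_add: "root_exp M (k + l) = root_exp M k * root_exp M l"
  by (simp add: root_exp_def cis_mult add_divide_distrib ring_distribs)

lemma root_exp_eq_1_iff:
  assumes "M > 0"
  shows "root_exp M k = 1 \<longleftrightarrow> int M dvd k"
proof
  assume "root_exp M k = 1"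
  then have "cos (2 * pi * of_int k / real M) = 1" by (metis root_exp_def cis.sel(1) one_complex.sel(1))
  then obtain x where "2 * pi * of_int k / real M = of_int x * 2 * pi" by (auto simp: cos_one_2pi_int)
  then have "real_of_int k = of_int x * real M" using assms by (simp add: field_simps)
  then have "k = x * int M" by (metis of_int_eq_iff of_int_mult of_int_of_nat_eq)
  then show "int M dvd k" by simp
next
  assume "int M dvd k"
  then obtain x where "k = int M * x" by (elim dvdE)
  then have "2 * pi * of_int k / real M = 2 * pi * of_int x" using assms by simp
  then show "root_exp M k = 1" by (simp add: root_exp_def)
qed

lemma root_exp_power: "root_exp M k ^ j = root_exp M (int j * k)"
  unfolding root_exp_def Complex.DeMoivre by (rule arg_cong[where f = cis]) simp

lemma sum_root_exp_nat:
  assumes "M > 0"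
  shows "(\<Sum>j<M. root_exp M (int j * k)) = (if int M dvd k then of_nat M else 0)"
proof (cases "int M dvd k")
  case True
  then have "root_exp M k = 1" using assms by (simp add: root_exp_eq_1_iff)
  then show ?thesis using True by (simp add: root_exp_power[symmetric])
next
  case False
  then have "root_exp M k \<noteq> 1" using assms by (simp add: root_exp_eq_1_iff)
  then have "(\<Sum>j<M. root_exp M k ^ j) = (root_exp M k ^ M - 1) / (root_exp M k - 1)" by (rule geometric_sum)
  moreover have "root_exp M k ^ M = 1" unfolding root_exp_power using assms by (simp add: root_exp_eq_1_iff)
  ultimately show ?thesis using False by (simp add: root_exp_power)
qed

lemma sum_int_interval: "(\<Sum>j\<in>{0..<int M}. f j) = (\<Sum>j<M. f (int j))"
  by (rule sum.reindex_bij_witness[of _ int nat]) auto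

lemma sum_root_exp:
  assumes "M > 0"
  shows "(\<Sum>j\<in>{0..<int M}. root_exp M (j * k)) = (if int M dvd k then of_nat M else 0)"
  using sum_root_exp_nat[OF assms] by (simp add: sum_int_interval)

lemma root_exp_mod: 
  assumes "M > 0"
  shows "root_exp M (k mod int M) = root_exp M k"
proof -
  have "root_exp M k = root_exp M (k mod int M) * root_exp M (int M * (k div int M))"
    unfolding root_exp_add[symmetric] by simp
  moreover have "root_exp M (int M * (k div int M)) = 1" using assms by (simp add: root_exp_eq_1_iff)
  ultimately show ?thesis by simp
qed

lemma sum_periodic_shift:
  fixes f :: "int \<Rightarrow> 'a::comm_monoid_add"
  assumes "M > 0" "\<And>k. f (k mod int M) = f k"
  shows "(\<Sum>j\<in>{0..<int M}. f (j + c)) = (\<Sum>j\<in>{0..<int M}. f j)"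
proof (rule sum.reindex_bij_witness[of _ "\<lambda>j. (j - c) mod int M" "\<lambda>j. (j + c) mod int M"])
  fix j assume j: "j \<in> {0..<int M}"
  show "((j + c) mod int M - c) mod int M = j" using j by (simp add: mod_diff_left_eq)
  show "(j + c) mod int M \<in> {0..<int M}" using assms(1) by simp
  show "f ((j + c) mod int M) = f (j + c)" by (rule assms(2))
next
  fix j assume j: "j \<in> {0..<int M}"
  show "((j - c) mod int M + c) mod int M = j" using j by (simp add: mod_add_left_eq)
  show "(j - c) mod int M \<in> {0..<int M}" using assms(1) by simp
qed

section \<open>Bumps around fractions on the grid of multiples of 1/M\<close>

definition circ_dist :: "nat \<Rightarrow> int \<Rightarrow> real" where
  "circ_dist M i = real_of_int (min (i mod int M) (int M - i mod int M))"

lemma circ_dist_nonneg: "M > 0 \<Longrightarrow> 0 \<le> circ_dist M i"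
  using pos_mod_bound[of "int M" i] by (simp add: circ_dist_def min_def less_imp_le)

lemma circ_dist_mod: "circ_dist M (i mod int M) = circ_dist M i"
  by (simp add: circ_dist_def)

lemma circ_dist_le:
  assumes "M > 0"
  shows "circ_dist M i \<le> \<bar>real_of_int i\<bar>"
proof -
  have "min (i mod int M) (int M - i mod int M) \<le> \<bar>i\<bar>"
  proof (cases "i \<ge> 0")
    case True
    then have "i mod int M \<le> i" by (simp add: zmod_le_nonneg_dividend)
    then show ?thesis using True by simp
  next
    case False
    then have "i div int M < 0" using assms by (simp add: pos_imp_zdiv_neg_iff)
    then have "i div int M \<le> -1" by simp
    then have "int M * (i div int M) \<le> int M * (-1)" using assms by (intro mult_left_mono) auto
    moreover have "i mod int M = i - int M * (i div int M)" by (simp add: minus_mult_div_eq_mod)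
    ultimately show ?thesis using False by linarith
  qed
  then show ?thesis unfolding circ_dist_def by linarith
qed

text \<open>The Weyl bound for |S|^2 decays like 1/(1 + N^2 t) at distance t from a/Q. Its power
  3/2, taken at the grid point i/M, is this bump; the exponent exceeds 1, which makes the total mass
  of order M / N^2.\<close>

definition arc_weight :: "nat \<Rightarrow> nat \<Rightarrow> int \<Rightarrow> real" where
  "arc_weight N M i = (1 + (real N)\<^sup>2 * circ_dist M i / real M) powr (-(3/2))"

lemma arc_weight_mod: "arc_weight N M (i mod int M) = arc_weight N M i"
  by (simp add: arc_weight_def circ_dist_mod)

lemma arc_weight_nonneg: "0 \<le> arc_weight N M i"
  by (simp add: arc_weight_def)

text \<open>Comparison with the telescoping differences of 2 / (\<delta> sqrt(1 + \<delta>
  i)).\<close>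

lemma sum_powr_neg_three_half_le:
  fixes \<delta> :: real
  assumes \<delta>: "0 < \<delta>"
  shows "(\<Sum>i\<in>{1..K::nat}. (1 + \<delta> * real i) powr (-(3/2))) \<le> 2 / \<delta>"
proof -
  have "(\<Sum>i\<in>{1..K}. (1 + \<delta> * real i) powr (-(3/2))) \<le> 2 / \<delta> * (1 - 1 / sqrt (1 + \<delta> * real K))"
  proof (induction K)
    case (Suc K)
    define A where "A = sqrt (1 + \<delta> * real K)"
    define B where "B = sqrt (1 + \<delta> * real (Suc K))"
    have AB: "0 < A" "A \<le> B" "0 < B" using \<delta> by (auto simp: A_def B_def intro: add_pos_nonneg)
    have sq: "B\<^sup>2 - A\<^sup>2 = \<delta>" using \<delta> by (simp add: A_def B_def algebra_simps)
    have pos: "0 < 1 + \<delta> * real (Suc K)" using \<delta> by (intro add_pos_nonneg) auto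
    have "(1 + \<delta> * real (Suc K)) powr (-(3/2)) = (1 + \<delta> * real (Suc K)) powr (-1 + -(1/2))" by simp
    also have "\<dots> = (1 + \<delta> * real (Suc K)) powr (-1) * (1 + \<delta> * real (Suc K)) powr (-(1/2))" by (rule powr_add)
    also have "\<dots> = 1 / (B\<^sup>2 * B)" using pos by (simp add: B_def powr_minus_divide powr_half_sqrt)
    finally have 1: "(1 + \<delta> * real (Suc K)) powr (-(3/2)) = 1 / (B\<^sup>2 * B)" .
    have "A * (A + B) \<le> B * (B + B)" using AB by (intro mult_mono) auto
    then have "B * (A * (A + B)) \<le> B * (2 * B\<^sup>2)" using AB by (intro mult_left_mono) (auto simp: power2_eq_square)
    then have "\<delta> / (2 * (B\<^sup>2 * B)) \<le> \<delta> / (B * (A * (A + B)))"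
      using AB \<delta> by (intro divide_left_mono) (auto simp: mult_ac)
    also have "\<dots> = 1 / A - 1 / B"
    proof -
      have "1 / A - 1 / B = (B - A) / (A * B)" using AB by (simp add: field_simps)
      also have "\<dots> = ((B - A) * (A + B)) / (A * B * (A + B))" using AB by simp
      also have "(B - A) * (A + B) = \<delta>" unfolding sq[symmetric] by (simp add: power2_eq_square algebra_simps)
      finally show ?thesis by (simp add: mult_ac)
    qed
    finally have "1 / (B\<^sup>2 * B) \<le> 2 / \<delta> * (1 / A - 1 / B)" using \<delta> AB by (simp add: field_simps)
    moreover have "(\<Sum>i\<in>{1..Suc K}. (1 + \<delta> * real i) powr (-(3/2))) = (\<Sum>i\<in>{1..K}. (1 + \<delta> * real i) powr (-(3/2))) + 1 / (B\<^sup>2 * B)"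
      unfolding 1[symmetric] by simp
    ultimately have "(\<Sum>i\<in>{1..Suc K}. (1 + \<delta> * real i) powr (-(3/2))) \<le> 2 / \<delta> * (1 - 1 / A) + 2 / \<delta> * (1 / A - 1 / B)"
      using Suc unfolding A_def[symmetric] by linarith
    also have "\<dots> = 2 / \<delta> * (1 - 1 / B)" by (simp only: right_diff_distrib)
    finally show ?case by (simp only: B_def)
  qed simp
  also have "\<dots> \<le> 2 / \<delta> * 1" using \<delta> by (intro mult_left_mono) auto
  finally show ?thesis by simp
qed

text \<open>Each point is counted by its distance to 0 or to M. As N^2 <= M, the grid is no coarser
  than the width of the bump, and the central term 1 is absorbed by M / N^2.\<close>

lemma sum_arc_weight_le:
  assumes N: "1 \<le> N" and M: "N\<^sup>2 \<le> M"
  shows "(\<Sum>i\<in>{0..<int M}. arc_weight N M i) \<le> 5 * real M / (real N)\<^sup>2"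
proof -
  define \<delta> where "\<delta> = (real N)\<^sup>2 / real M"
  have "0 < N\<^sup>2" using N by simp
  then have M0: "M > 0" using M by linarith
  have "real (N\<^sup>2) \<le> real M" using M by (rule of_nat_mono)
  then have \<delta>: "0 < \<delta>" "\<delta> \<le> 1" using N M0 by (auto simp: \<delta>_def)
  let ?w = "\<lambda>i::nat. (1 + \<delta> * real i) powr (-(3/2))"
  have "(\<Sum>i\<in>{0..<int M}. arc_weight N M i) = (\<Sum>i<M. arc_weight N M (int i))" by (rule sum_int_interval)
  also have "\<dots> \<le> (\<Sum>i<M. ?w i + ?w (M - i))"
  proof (rule sum_mono)
    fix i assume i: "i \<in> {..<M}"
    then have "int i mod int M = int i" by simp
    then have "circ_dist M (int i) = real i \<or> circ_dist M (int i) = real (M - i)"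
      using i by (auto simp: circ_dist_def min_def of_nat_diff)
    then have "arc_weight N M (int i) = ?w i \<or> arc_weight N M (int i) = ?w (M - i)"
      by (auto simp: arc_weight_def \<delta>_def)
    then show "arc_weight N M (int i) \<le> ?w i + ?w (M - i)" by auto
  qed
  also have "\<dots> = (\<Sum>i<M. ?w i) + (\<Sum>i<M. ?w (M - i))" by (rule sum.distrib)
  also have "(\<Sum>i<M. ?w i) \<le> (\<Sum>i\<in>{0} \<union> {1..M}. ?w i)" by (intro sum_mono2) auto
  also have "\<dots> = 1 + (\<Sum>i\<in>{1..M}. ?w i)" by (subst sum.union_disjoint) auto
  also have "(\<Sum>i<M. ?w (M - i)) = (\<Sum>i\<in>{1..M}. ?w i)"
    by (rule sum.reindex_bij_witness[of _ "\<lambda>i. M - i" "\<lambda>i. M - i"]) auto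
  also have "1 + (\<Sum>i\<in>{1..M}. ?w i) + (\<Sum>i\<in>{1..M}. ?w i) \<le> 1 / \<delta> + 2 / \<delta> + 2 / \<delta>"
    using \<delta> by (intro add_mono sum_powr_neg_three_half_le) auto
  also have "\<dots> = 5 / \<delta>" by simp
  finally show ?thesis by (simp add: \<delta>_def)
qed

text \<open>The fraction a/Q supplied by \<open>weyl_sum_bound\<close> depends on j. As all terms
  are nonnegative, it may be replaced by the sum over all Q <= 16 N and all a modulo Q, so that the
  summation over j can be carried out first. Since Q divides M, a/Q is the grid point with index a
  (M div Q).\<close>

lemma weyl_sum_cube_le:
  assumes N: "1 \<le> N" and M: "M > 0" and dv: "\<And>Q::nat. 1 \<le> Q \<Longrightarrow> Q \<le> 16 * N \<Longrightarrow> Q dvd M"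
  shows "norm (weyl_sum N (of_int j / real M)) ^ 3 \<le> 300000 powr (3/2) * real N ^ 6 *
     (\<Sum>Q\<in>{1..16 * N}. real Q powr (-(3/2)) * (\<Sum>a\<in>{0..<int Q}. arc_weight N M (j - a * int (M div Q))))"
proof -
  define S where "S = norm (weyl_sum N (of_int j / real M))"
  obtain Q' a where Q': "1 \<le> Q'" "Q' \<le> 16 * int N" 
    and b: "S\<^sup>2 * (of_int Q' * (1 + (real N)\<^sup>2 * \<bar>of_int j / real M - of_int a / of_int Q'\<bar>)) \<le> 300000 * real N ^ 4"
    using weyl_sum_bound[OF N, of "of_int j / real M"] unfolding S_def by auto
  define Q where "Q = nat Q'"
  have Q: "1 \<le> Q" "Q \<le> 16 * N" "Q' = int Q" using Q' by (auto simp: Q_def)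
  have QM: "Q dvd M" using dv Q by auto
  \<comment> \<open>Reducing a modulo Q moves the centre by a multiple of M, which
    \<open>circ_dist\<close> does not see.\<close>
  define i where "i = j - (a mod int Q) * int (M div Q)"
  define X where "X = 1 + (real N)\<^sup>2 * circ_dist M i / real M"
  have X: "X \<ge> 1" using circ_dist_nonneg[OF M, of i] by (simp add: X_def)
  have "int Q * int (M div Q) = int M" using QM by (metis dvd_mult_div_cancel of_nat_mult)
  moreover have "b * K = r * K + t * m" if "q * K = m" "b = r + q * t" for b q K m r t :: int
    using that by (auto simp: algebra_simps)
  note this[of "int Q" "int (M div Q)" "int M" a "a mod int Q" "a div int Q"]
  ultimately have "a * int (M div Q) = (a mod int Q) * int (M div Q) + (a div int Q) * int M"
    by simp
  then have "(j - a * int (M div Q)) mod int M = i mod int M" 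
    unfolding mod_eq_dvd_iff by (simp add: i_def)
  then have "circ_dist M i = circ_dist M (j - a * int (M div Q))" by (metis circ_dist_mod)
  also have "\<dots> \<le> \<bar>real_of_int (j - a * int (M div Q))\<bar>" by (rule circ_dist_le[OF M])
  also have "real_of_int (j - a * int (M div Q)) = real M * (of_int j / real M - of_int a / of_int Q')"
    using M Q QM by (simp add: real_of_nat_div field_simps)
  also have "\<bar>\<dots>\<bar> = real M * \<bar>of_int j / real M - of_int a / of_int Q'\<bar>" by (simp add: abs_mult)
  finally have "circ_dist M i / real M \<le> \<bar>of_int j / real M - of_int a / of_int Q'\<bar>" using M by (simp add: field_simps)
  then have "(real N)\<^sup>2 * (circ_dist M i / real M) \<le> (real N)\<^sup>2 * \<bar>of_int j / real M - of_int a / of_int Q'\<bar>" by (intro mult_left_mono) auto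
  then have "S\<^sup>2 * (real Q * X) \<le> S\<^sup>2 * (of_int Q' * (1 + (real N)\<^sup>2 * \<bar>of_int j / real M - of_int a / of_int Q'\<bar>))"
    unfolding X_def Q(3) of_int_of_nat_eq by (intro mult_left_mono add_left_mono) auto
  also note b
  finally have "S\<^sup>2 \<le> 300000 * real N ^ 4 * (real Q powr (-1) * X powr (-1))"
    using X Q by (simp add: powr_minus_divide field_simps)
  then have "(S\<^sup>2) powr (3/2) \<le> (300000 * real N ^ 4 * (real Q powr (-1) * X powr (-1))) powr (3/2)"
    by (intro powr_mono2) auto
  also have "(S\<^sup>2) powr (3/2) = S ^ 3"
    by (cases "S = 0") (simp_all add: S_def powr_numeral[symmetric] powr_powr del: powr_numeral)
  also have "(300000 * real N ^ 4 * (real Q powr (-1) * X powr (-1))) powr (3/2) = 300000 powr (3/2) * real N ^ 6 * (real Q powr (-(3/2)) * arc_weight N M i)"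
  proof -
    have "(real N ^ 4) powr (3/2) = real N ^ 6" using N
      by (simp add: powr_numeral[symmetric] powr_powr del: powr_numeral)
    moreover have "(A * B * (x powr (-1) * y powr (-1))) powr (3/2) = A powr (3/2) * B powr (3/2) * (x powr (-(3/2)) * y powr (-(3/2)))"
      if "A \<ge> 0" "B \<ge> 0" for A B x y :: real
      using that unfolding powr_mult powr_powr by simp
    from this[of 300000 "real N ^ 4" "real Q" X] 
    have "(300000 * real N ^ 4 * (real Q powr (-1) * X powr (-1))) powr (3/2) = 300000 powr (3/2) * (real N ^ 4) powr (3/2) * (real Q powr (-(3/2)) * X powr (-(3/2)))"
      by simp
    ultimately show ?thesis by (simp only: arc_weight_def X_def[symmetric])
  qed
  also have "\<dots> \<le> 300000 powr (3/2) * real N ^ 6 *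
     (\<Sum>Q\<in>{1..16 * N}. real Q powr (-(3/2)) * (\<Sum>a\<in>{0..<int Q}. arc_weight N M (j - a * int (M div Q))))"
  proof (rule mult_left_mono)
    have "real Q powr (-(3/2)) * arc_weight N M i \<le> real Q powr (-(3/2)) * (\<Sum>a\<in>{0..<int Q}. arc_weight N M (j - a * int (M div Q)))"
    proof (rule mult_left_mono)
      show "arc_weight N M i \<le> (\<Sum>a\<in>{0..<int Q}. arc_weight N M (j - a * int (M div Q)))"
        unfolding i_def using Q(1) by (intro member_le_sum[where f = "\<lambda>a. arc_weight N M (j - a * int (M div Q))"]) (auto simp: arc_weight_nonneg)
    qed simp
    also have "\<dots> \<le> (\<Sum>Q\<in>{1..16 * N}. real Q powr (-(3/2)) * (\<Sum>a\<in>{0..<int Q}. arc_weight N M (j - a * int (M div Q))))"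
      using Q by (intro member_le_sum[where f = "\<lambda>Q. real Q powr (-(3/2)) * (\<Sum>a\<in>{0..<int Q}. arc_weight N M (j - a * int (M div Q)))"])
        (auto intro!: mult_nonneg_nonneg sum_nonneg simp: arc_weight_nonneg)
    finally show "real Q powr (-(3/2)) * arc_weight N M i \<le> (\<Sum>Q\<in>{1..16 * N}. real Q powr (-(3/2)) * (\<Sum>a\<in>{0..<int Q}. arc_weight N M (j - a * int (M div Q))))" .
  qed simp
  finally show ?thesis by (simp add: S_def)
qed

section \<open>The energy of a square exponential sum against the cube of the Weyl sum\<close>

definition square_sum :: "(int \<Rightarrow> real) \<Rightarrow> nat \<Rightarrow> nat \<Rightarrow> int \<Rightarrow> complex" where
  "square_sum F N M j = (\<Sum>m\<in>{-int N..int N}. of_real (F m) * root_exp M (j * m\<^sup>2))"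

lemma weyl_sum_eq_root_exp:
  "weyl_sum N (of_int j / real M) = (\<Sum>m\<in>{-2 * int N..2 * int N}. of_real (tent N m) * root_exp M (j * m\<^sup>2))"
  unfolding weyl_sum_def root_exp_def by (intro sum.cong arg_cong2[where f = times] refl arg_cong[where f = cis]) simp

lemma norm_square_sum_square:
  "complex_of_real ((norm (square_sum F N M j))\<^sup>2) =
     (\<Sum>m\<in>{-int N..int N}. \<Sum>m'\<in>{-int N..int N}. of_real (F m * F m') * root_exp M (j * (m\<^sup>2 - m'\<^sup>2)))"
proof -
  have cnj: "cnj (root_exp M k) = root_exp M (- k)" for k by (simp add: root_exp_def cis_cnj)
  have "complex_of_real ((norm (square_sum F N M j))\<^sup>2) = square_sum F N M j * cnj (square_sum F N M j)"
    by (simp add: complex_norm_square[symmetric])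
  also have "\<dots> = (\<Sum>m\<in>{-int N..int N}. \<Sum>m'\<in>{-int N..int N}. of_real (F m * F m') * root_exp M (j * (m\<^sup>2 - m'\<^sup>2)))"
    unfolding square_sum_def cnj_sum sum_product
  proof (intro sum.cong refl)
    fix m m'
    have "root_exp M (j * (m\<^sup>2 - m'\<^sup>2)) = root_exp M (j * m\<^sup>2) * root_exp M (- (j * m'\<^sup>2))"
      unfolding root_exp_add[symmetric] by (simp add: right_diff_distrib)
    then show "of_real (F m) * root_exp M (j * m\<^sup>2) * cnj (of_real (F m') * root_exp M (j * m'\<^sup>2)) = of_real (F m * F m') * root_exp M (j * (m\<^sup>2 - m'\<^sup>2))"
      by (simp add: cnj)
  qed
  finally show ?thesis .
qed

text \<open>After expanding the square, translating the bump by a M/Q multiplies its Fourier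
  coefficient at k = m^2 - m'^2 by e(a k/Q). The sum over a is Q or 0 according to whether Q divides
  k, and the coefficient itself is at most the total mass of the bump. Since F is nonnegative,
  absolute values can be taken term by term.\<close>

lemma arc_sum_le:
  assumes M: "M > 0" and Q: "1 \<le> Q" "Q dvd M" and F: "\<And>m. 0 \<le> F m"
  shows "(\<Sum>a\<in>{0..<int Q}. \<Sum>j\<in>{0..<int M}. (norm (square_sum F N M j))\<^sup>2 * arc_weight N M (j - a * int (M div Q)))
    \<le> (\<Sum>m\<in>{-int N..int N}. \<Sum>m'\<in>{-int N..int N}. F m * F m' * (if int Q dvd m\<^sup>2 - m'\<^sup>2 then real Q else 0)) * (\<Sum>i\<in>{0..<int M}. arc_weight N M i)"
proof -
  let ?I = "{-int N..int N}" and ?A = "{0..<int Q}" and ?J = "{0..<int M}"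
  let ?v = "arc_weight N M" and ?E = "root_exp M"
  define V where "V = (\<Sum>i\<in>?J. ?v i)"
  define vh where "vh = (\<lambda>k. \<Sum>j\<in>?J. ?E (j * k) * of_real (?v j))"
  have vh: "norm (vh k) \<le> V" for k
  proof -
    have "norm (vh k) \<le> (\<Sum>j\<in>?J. norm (?E (j * k) * of_real (?v j)))" unfolding vh_def by (rule norm_sum)
    also have "\<dots> = V" by (simp add: V_def norm_mult root_exp_def arc_weight_nonneg)
    finally show ?thesis .
  qed
  have shift: "(\<Sum>j\<in>?J. ?E (j * k) * of_real (?v (j - c))) = ?E (c * k) * vh k" for k c
  proof -
    define f where "f = (\<lambda>j. ?E (j * k) * complex_of_real (?v (j - c)))"
    have per: "f (j mod int M) = f j" for j
    proof -
      have "?E ((j mod int M) * k) = ?E (((j mod int M) * k) mod int M)" by (simp only: root_exp_mod[OF M])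
      also have "((j mod int M) * k) mod int M = (j * k) mod int M" by (rule mod_mult_left_eq)
      also have "?E ((j * k) mod int M) = ?E (j * k)" by (rule root_exp_mod[OF M])
      finally have "?E ((j mod int M) * k) = ?E (j * k)" .
      moreover have "?v (j mod int M - c) = ?v (j - c)" by (metis arc_weight_mod mod_diff_left_eq)
      ultimately show ?thesis by (simp add: f_def)
    qed
    have "(\<Sum>j\<in>?J. ?E (j * k) * of_real (?v (j - c))) = (\<Sum>j\<in>?J. f (j + c))"
      unfolding sum_periodic_shift[of M f, OF M per] by (simp add: f_def)
    also have "\<dots> = (\<Sum>j\<in>?J. ?E (c * k) * (?E (j * k) * of_real (?v j)))"
      by (intro sum.cong refl) (simp add: f_def distrib_right root_exp_add)
    finally show ?thesis by (simp add: vh_def sum_distrib_left)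
  qed
  have sumA: "(\<Sum>a\<in>?A. ?E (a * int (M div Q) * k)) = (if int Q dvd k then of_nat Q else 0)" for k
  proof -
    have "?E (a * int (M div Q) * k) = root_exp Q (a * k)" for a
    proof -
      have "real M = real Q * real (M div Q)" using Q by (metis dvd_mult_div_cancel of_nat_mult)
      moreover have "real (M div Q) \<noteq> 0"
      proof
        assume "real (M div Q) = 0"
        then show False using calculation M by simp
      qed
      ultimately show ?thesis unfolding root_exp_def by (intro arg_cong[where f = cis]) (simp add: field_simps)
    qed
    then show ?thesis using sum_root_exp[of Q k] Q by simp
  qed
  define T where "T = (\<Sum>a\<in>?A. \<Sum>j\<in>?J. (norm (square_sum F N M j))\<^sup>2 * ?v (j - a * int (M div Q)))"
  have "complex_of_real T = (\<Sum>a\<in>?A. \<Sum>j\<in>?J. \<Sum>m\<in>?I. \<Sum>m'\<in>?I. of_real (F m * F m') * (?E (j * (m\<^sup>2 - m'\<^sup>2)) * of_real (?v (j - a * int (M div Q)))))"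
    unfolding T_def of_real_sum of_real_mult[of "(norm _)\<^sup>2"] norm_square_sum_square sum_distrib_right
    by (simp only: mult.assoc)
  also have "\<dots> = (\<Sum>a\<in>?A. \<Sum>m\<in>?I. \<Sum>j\<in>?J. \<Sum>m'\<in>?I. of_real (F m * F m') * (?E (j * (m\<^sup>2 - m'\<^sup>2)) * of_real (?v (j - a * int (M div Q)))))"
    by (rule sum.cong[OF refl], rule sum.swap)
  also have "\<dots> = (\<Sum>m\<in>?I. \<Sum>a\<in>?A. \<Sum>j\<in>?J. \<Sum>m'\<in>?I. of_real (F m * F m') * (?E (j * (m\<^sup>2 - m'\<^sup>2)) * of_real (?v (j - a * int (M div Q)))))"
    by (rule sum.swap)
  also have "\<dots> = (\<Sum>m\<in>?I. \<Sum>a\<in>?A. \<Sum>m'\<in>?I. \<Sum>j\<in>?J. of_real (F m * F m') * (?E (j * (m\<^sup>2 - m'\<^sup>2)) * of_real (?v (j - a * int (M div Q)))))"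
    by (rule sum.cong[OF refl], rule sum.cong[OF refl], rule sum.swap)
  also have "\<dots> = (\<Sum>m\<in>?I. \<Sum>m'\<in>?I. \<Sum>a\<in>?A. \<Sum>j\<in>?J. of_real (F m * F m') * (?E (j * (m\<^sup>2 - m'\<^sup>2)) * of_real (?v (j - a * int (M div Q)))))"
    by (rule sum.cong[OF refl], rule sum.swap)
  also have "\<dots> = (\<Sum>m\<in>?I. \<Sum>m'\<in>?I. of_real (F m * F m') * ((if int Q dvd m\<^sup>2 - m'\<^sup>2 then of_nat Q else 0) * vh (m\<^sup>2 - m'\<^sup>2)))"
    unfolding sum_distrib_left[symmetric] shift sum_distrib_right[symmetric] sumA ..
  finally have eq: "complex_of_real T = (\<Sum>m\<in>?I. \<Sum>m'\<in>?I. of_real (F m * F m') * ((if int Q dvd m\<^sup>2 - m'\<^sup>2 then of_nat Q else 0) * vh (m\<^sup>2 - m'\<^sup>2)))" .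
  have "T \<le> norm (complex_of_real T)" by simp
  also have "\<dots> \<le> (\<Sum>m\<in>?I. \<Sum>m'\<in>?I. norm (of_real (F m * F m') * ((if int Q dvd m\<^sup>2 - m'\<^sup>2 then of_nat Q else 0) * vh (m\<^sup>2 - m'\<^sup>2))))"
    unfolding eq by (intro order_trans[OF norm_sum] sum_mono norm_sum)
  also have "\<dots> \<le> (\<Sum>m\<in>?I. \<Sum>m'\<in>?I. F m * F m' * (if int Q dvd m\<^sup>2 - m'\<^sup>2 then real Q else 0) * V)"
  proof (intro sum_mono)
    fix m m'
    have "norm (of_real (F m * F m') * ((if int Q dvd m\<^sup>2 - m'\<^sup>2 then of_nat Q else 0) * vh (m\<^sup>2 - m'\<^sup>2)))
      = F m * F m' * (if int Q dvd m\<^sup>2 - m'\<^sup>2 then real Q else 0) * norm (vh (m\<^sup>2 - m'\<^sup>2))"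
      using F by (simp add: norm_mult)
    also have "\<dots> \<le> F m * F m' * (if int Q dvd m\<^sup>2 - m'\<^sup>2 then real Q else 0) * V"
      using F by (intro mult_left_mono vh) auto
    finally show "norm (of_real (F m * F m') * ((if int Q dvd m\<^sup>2 - m'\<^sup>2 then of_nat Q else 0) * vh (m\<^sup>2 - m'\<^sup>2)))
      \<le> F m * F m' * (if int Q dvd m\<^sup>2 - m'\<^sup>2 then real Q else 0) * V" .
  qed
  also have "\<dots> = (\<Sum>m\<in>?I. \<Sum>m'\<in>?I. F m * F m' * (if int Q dvd m\<^sup>2 - m'\<^sup>2 then real Q else 0)) * V"
    by (simp only: sum_distrib_right)
  finally show ?thesis by (simp only: T_def V_def)
qed

text \<open>Divisibility puts every fraction a/Q on the grid j/M; N^2 <= M lets the grid resolve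
  arcs of width N^{-2}.\<close>

definition good_modulus :: "nat \<Rightarrow> nat \<Rightarrow> bool" where
  "good_modulus N M \<longleftrightarrow> N\<^sup>2 \<le> M \<and> (\<forall>Q. 1 \<le> Q \<longrightarrow> Q \<le> 16 * N \<longrightarrow> Q dvd M)"

text \<open>The powers combine as Q^{-3/2} Q = Q^{-1/2} and N^6 (M / N^2) = M N^4; the sum over Q is
  then the kernel.\<close>

lemma energy_le_sq_kernel:
  assumes N: "1 \<le> N" and gm: "good_modulus N M" and F: "\<And>m. 0 \<le> F m"
  shows "(\<Sum>j\<in>{0..<int M}. (norm (square_sum F N M j))\<^sup>2 * norm (weyl_sum N (of_int j / real M)) ^ 3)
    \<le> (5 * 300000 powr (3/2)) * real M * real N ^ 4 *
       (\<Sum>m\<in>{-int N..int N}. \<Sum>m'\<in>{-int N..int N}. F m * F m' * sq_kernel N (m\<^sup>2 - m'\<^sup>2))"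
proof -
  let ?I = "{-int N..int N}" and ?J = "{0..<int M}"
  let ?v = "arc_weight N M"
  have NM: "N\<^sup>2 \<le> M" and dv: "\<And>Q. 1 \<le> Q \<Longrightarrow> Q \<le> 16 * N \<Longrightarrow> Q dvd M" using gm by (auto simp: good_modulus_def)
  have "0 < N\<^sup>2" using N by simp
  then have M: "M > 0" using NM by linarith
  define c where "c = (300000::real) powr (3/2)"
  have c: "c \<ge> 0" by (simp add: c_def)
  define V where "V = (\<Sum>i\<in>?J. ?v i)"
  have V: "0 \<le> V" "V \<le> 5 * real M / (real N)\<^sup>2"
    using sum_arc_weight_le[OF N NM] by (simp_all add: V_def sum_nonneg arc_weight_nonneg)
  define G where "G = (\<lambda>m m'. F m * F m')"
  have G: "0 \<le> G m m'" for m m' using F by (simp add: G_def)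
  have "(\<Sum>j\<in>?J. (norm (square_sum F N M j))\<^sup>2 * norm (weyl_sum N (of_int j / real M)) ^ 3)
    \<le> (\<Sum>j\<in>?J. (norm (square_sum F N M j))\<^sup>2 * (c * real N ^ 6 *
     (\<Sum>Q\<in>{1..16 * N}. real Q powr (-(3/2)) * (\<Sum>a\<in>{0..<int Q}. ?v (j - a * int (M div Q))))))"
    unfolding c_def using weyl_sum_cube_le[OF N M dv] by (intro sum_mono mult_left_mono) auto
  also have "\<dots> = c * real N ^ 6 * (\<Sum>j\<in>?J. \<Sum>Q\<in>{1..16 * N}. real Q powr (-(3/2)) * (\<Sum>a\<in>{0..<int Q}. (norm (square_sum F N M j))\<^sup>2 * ?v (j - a * int (M div Q))))"
    by (simp add: sum_distrib_left mult_ac)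
  also have "(\<Sum>j\<in>?J. \<Sum>Q\<in>{1..16 * N}. real Q powr (-(3/2)) * (\<Sum>a\<in>{0..<int Q}. (norm (square_sum F N M j))\<^sup>2 * ?v (j - a * int (M div Q))))
    = (\<Sum>Q\<in>{1..16 * N}. real Q powr (-(3/2)) * (\<Sum>a\<in>{0..<int Q}. \<Sum>j\<in>?J. (norm (square_sum F N M j))\<^sup>2 * ?v (j - a * int (M div Q))))"
  proof (subst sum.swap, rule sum.cong[OF refl])
    fix Q
    show "(\<Sum>j\<in>?J. real Q powr (-(3/2)) * (\<Sum>a\<in>{0..<int Q}. (norm (square_sum F N M j))\<^sup>2 * ?v (j - a * int (M div Q))))
      = real Q powr (-(3/2)) * (\<Sum>a\<in>{0..<int Q}. \<Sum>j\<in>?J. (norm (square_sum F N M j))\<^sup>2 * ?v (j - a * int (M div Q)))"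
      by (subst sum.swap) (simp only: sum_distrib_left mult.left_commute)
  qed
  also have "c * real N ^ 6 * \<dots> \<le> c * real N ^ 6 * (\<Sum>Q\<in>{1..16 * N}. real Q powr (-(3/2)) * ((\<Sum>m\<in>?I. \<Sum>m'\<in>?I. G m m' * (if int Q dvd m\<^sup>2 - m'\<^sup>2 then real Q else 0)) * V))"
    unfolding G_def V_def using c dv by (intro mult_left_mono sum_mono arc_sum_le M F) auto
  also have "(\<Sum>Q\<in>{1..16 * N}. real Q powr (-(3/2)) * ((\<Sum>m\<in>?I. \<Sum>m'\<in>?I. G m m' * (if int Q dvd m\<^sup>2 - m'\<^sup>2 then real Q else 0)) * V))
    = (\<Sum>m\<in>?I. \<Sum>m'\<in>?I. G m m' * sq_kernel N (m\<^sup>2 - m'\<^sup>2)) * V"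
  proof -
    have "(\<Sum>Q\<in>{1..16 * N}. real Q powr (-(3/2)) * ((\<Sum>m\<in>?I. \<Sum>m'\<in>?I. G m m' * (if int Q dvd m\<^sup>2 - m'\<^sup>2 then real Q else 0)) * V))
      = (\<Sum>Q\<in>{1..16 * N}. \<Sum>m\<in>?I. \<Sum>m'\<in>?I. G m m' * (if int Q dvd m\<^sup>2 - m'\<^sup>2 then real Q powr (-(1/2)) else 0)) * V"
      unfolding sum_distrib_left sum_distrib_right
    proof (intro sum.cong refl)
      fix Q m m' assume "Q \<in> {1..16 * N}"
      then have "real Q powr (-(1/2)) = real Q powr (-(3/2)) * real Q"
        using powr_mult_base[of "real Q" "-(3/2)"] by (simp add: mult.commute)
      then show "real Q powr (-(3/2)) * (G m m' * (if int Q dvd m\<^sup>2 - m'\<^sup>2 then real Q else 0) * V)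
        = G m m' * (if int Q dvd m\<^sup>2 - m'\<^sup>2 then real Q powr (-(1/2)) else 0) * V" by simp
    qed
    also have "(\<Sum>Q\<in>{1..16 * N}. \<Sum>m\<in>?I. \<Sum>m'\<in>?I. G m m' * (if int Q dvd m\<^sup>2 - m'\<^sup>2 then real Q powr (-(1/2)) else 0))
      = (\<Sum>m\<in>?I. \<Sum>Q\<in>{1..16 * N}. \<Sum>m'\<in>?I. G m m' * (if int Q dvd m\<^sup>2 - m'\<^sup>2 then real Q powr (-(1/2)) else 0))"
      by (rule sum.swap)
    also have "\<dots> = (\<Sum>m\<in>?I. \<Sum>m'\<in>?I. \<Sum>Q\<in>{1..16 * N}. G m m' * (if int Q dvd m\<^sup>2 - m'\<^sup>2 then real Q powr (-(1/2)) else 0))"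
      by (rule sum.cong[OF refl], rule sum.swap)
    finally show ?thesis by (simp only: sum_distrib_left[symmetric] sq_kernel_def)
  qed
  also have "c * real N ^ 6 * ((\<Sum>m\<in>?I. \<Sum>m'\<in>?I. G m m' * sq_kernel N (m\<^sup>2 - m'\<^sup>2)) * V)
    \<le> c * real N ^ 6 * ((\<Sum>m\<in>?I. \<Sum>m'\<in>?I. G m m' * sq_kernel N (m\<^sup>2 - m'\<^sup>2)) * (5 * real M / (real N)\<^sup>2))"
    using c V G sq_kernel_nonneg by (intro mult_left_mono mult_nonneg_nonneg sum_nonneg) auto
  also have "\<dots> = (5 * c) * real M * real N ^ 4 * (\<Sum>m\<in>?I. \<Sum>m'\<in>?I. G m m' * sq_kernel N (m\<^sup>2 - m'\<^sup>2))"
    using N by (simp add: field_simps power_numeral_reduce power2_eq_square)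
  finally show ?thesis by (simp only: c_def G_def)
qed

lemma energy_bound:
  "\<exists>C>0. \<forall>N M F. 1 \<le> N \<longrightarrow> good_modulus N M \<longrightarrow> (\<forall>m. 0 \<le> F m) \<longrightarrow>
    (\<Sum>j\<in>{0..<int M}. (norm (square_sum F N M j))\<^sup>2 * norm (weyl_sum N (of_int j / real M)) ^ 3)
    \<le> C * real M * real N powr (14/3) * (\<Sum>m\<in>{-int N..int N}. F m powr (3/2)) powr (4/3)"
proof -
  obtain C where C: "C > 0" "\<And>N F. 1 \<le> N \<Longrightarrow> (\<And>m. 0 \<le> F m) \<Longrightarrow>
    (\<Sum>m\<in>{-int N..int N}. \<Sum>m'\<in>{-int N..int N}. F m * F m' * sq_kernel N (m\<^sup>2 - m'\<^sup>2))
      \<le> C * real N powr (2/3) * (\<Sum>m\<in>{-int N..int N}. F m powr (3/2)) powr (4/3)"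
    using sq_kernel_bilinear_bound by blast
  define c where "c = 5 * (300000::real) powr (3/2)"
  have c: "c > 0" by (simp add: c_def)
  have "(\<Sum>j\<in>{0..<int M}. (norm (square_sum F N M j))\<^sup>2 * norm (weyl_sum N (of_int j / real M)) ^ 3)
    \<le> c * C * real M * real N powr (14/3) * (\<Sum>m\<in>{-int N..int N}. F m powr (3/2)) powr (4/3)"
    if N: "1 \<le> N" and gm: "good_modulus N M" and F: "\<And>m. 0 \<le> F m" for N M F
  proof -
    have "(\<Sum>j\<in>{0..<int M}. (norm (square_sum F N M j))\<^sup>2 * norm (weyl_sum N (of_int j / real M)) ^ 3)
      \<le> c * real M * real N ^ 4 * (\<Sum>m\<in>{-int N..int N}. \<Sum>m'\<in>{-int N..int N}. F m * F m' * sq_kernel N (m\<^sup>2 - m'\<^sup>2))"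
      unfolding c_def by (rule energy_le_sq_kernel[OF N gm F])
    also have "\<dots> \<le> c * real M * real N ^ 4 * (C * real N powr (2/3) * (\<Sum>m\<in>{-int N..int N}. F m powr (3/2)) powr (4/3))"
      using c by (intro mult_left_mono C(2) N F) auto
    also have "\<dots> = c * C * real M * (real N ^ 4 * real N powr (2/3)) * (\<Sum>m\<in>{-int N..int N}. F m powr (3/2)) powr (4/3)" by simp
    also have "real N ^ 4 * real N powr (2/3) = real N powr (14/3)"
      using N by (simp add: powr_numeral[symmetric] powr_add[symmetric] del: powr_numeral)
    finally show ?thesis .
  qed
  then show ?thesis using c C(1) by (intro exI[of _ "c * C"]) auto
qed

section \<open>From exponential sums back to the sphere\<close>

lemma root_exp_sum: "finite A \<Longrightarrow> root_exp M (\<Sum>l\<in>A. f l) = (\<Prod>l\<in>A. root_exp M (f l))"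
  by (induction A rule: finite_induct) (simp_all add: root_exp_add, simp add: root_exp_def)

lemma norm_root_exp [simp]: "norm (root_exp M k) = 1"
  by (simp add: root_exp_def)

lemma norm_weyl_sum_le: 
  assumes "1 \<le> N"
  shows "norm (weyl_sum N \<theta>) \<le> 10 * (real N)\<^sup>2"
proof -
  have "norm (weyl_sum N \<theta>) \<le> (\<Sum>m\<in>{-2 * int N..2 * int N}. 2 * real N)"
    unfolding weyl_sum_def
    by (rule order_trans[OF norm_sum], rule sum_mono) (simp add: norm_mult tent_nonneg tent_le)
  also have "\<dots> = (4 * real N + 1) * (2 * real N)" by (simp add: nat_add_distrib nat_mult_distrib)
  also have "\<dots> \<le> (5 * real N) * (2 * real N)" using assms by (intro mult_right_mono) auto
  finally show ?thesis by (simp add: power2_eq_square)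
qed

text \<open>The quantity 4 (n + 1) N^2 bounds every difference between lam and a sum of n squares of
  integers of size at most 2N; as it is below M, congruence modulo M becomes equality.\<close>

lemma good_modulus_exists:
  assumes "1 \<le> N"
  shows "good_modulus N (8 * (n + 1) * N\<^sup>2 * fact (16 * N))" "4 * (n + 1) * N\<^sup>2 < 8 * (n + 1) * N\<^sup>2 * fact (16 * N)"
proof -
  have f: "1 \<le> (fact (16 * N) :: nat)" by (simp add: Suc_leI)
  define X where "X = (n + 1) * N\<^sup>2"
  have e: "8 * (n + 1) * N\<^sup>2 * fact (16 * N) = 8 * X * fact (16 * N)" "4 * (n + 1) * N\<^sup>2 = 4 * X"
    by (simp_all only: X_def mult.assoc)
  have X: "N\<^sup>2 \<le> X" "0 < X" using assms by (simp_all add: X_def)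
  have f8: "8 * X * 1 \<le> 8 * X * fact (16 * N)" using f by (intro mult_left_mono) auto
  show "4 * (n + 1) * N\<^sup>2 < 8 * (n + 1) * N\<^sup>2 * fact (16 * N)" unfolding e using f8 X by linarith
  have "Q dvd 8 * X * fact (16 * N)" if "1 \<le> Q" "Q \<le> 16 * N" for Q
    using dvd_fact[OF that] by (rule dvd_mult)
  moreover have "N\<^sup>2 \<le> 8 * X * fact (16 * N)" using f8 X by linarith
  ultimately show "good_modulus N (8 * (n + 1) * N\<^sup>2 * fact (16 * N))" unfolding e good_modulus_def by blast
qed

text \<open>Additive characters modulo M detect the sphere, and over a box the resulting sum
  factorises into one exponential sum for each coordinate.\<close>

lemma sum_on_sphere_eq_fourier:
  fixes g :: "nat \<Rightarrow> int \<Rightarrow> real"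
  assumes M: "0 < M" and A: "finite A" and small: "\<And>y. y \<in> PiE {..<n} (\<lambda>_. A) \<Longrightarrow> \<bar>(\<Sum>l<n. (y l)\<^sup>2) - lam\<bar> < int M"
  shows "complex_of_real (\<Sum>y\<in>PiE {..<n} (\<lambda>_. A). if (\<Sum>l<n. (y l)\<^sup>2) = lam then \<Prod>l<n. g l (y l) else 0)
    = (\<Sum>j\<in>{0..<int M}. root_exp M (j * (- lam)) * (\<Prod>l<n. \<Sum>m\<in>A. of_real (g l m) * root_exp M (j * m\<^sup>2))) / of_nat M"
proof -
  let ?S = "PiE {..<n} (\<lambda>_. A)" and ?J = "{0..<int M}"
  have finS: "finite ?S" using A by (intro finite_PiE) auto
  have "complex_of_real (\<Sum>y\<in>?S. if (\<Sum>l<n. (y l)\<^sup>2) = lam then \<Prod>l<n. g l (y l) else 0)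
     = (\<Sum>y\<in>?S. of_real (\<Prod>l<n. g l (y l)) * ((\<Sum>j\<in>?J. root_exp M (j * ((\<Sum>l<n. (y l)\<^sup>2) - lam))) / of_nat M))"
    unfolding of_real_sum
  proof (rule sum.cong[OF refl])
    fix y assume y: "y \<in> ?S"
    have "int M dvd (\<Sum>l<n. (y l)\<^sup>2) - lam \<longleftrightarrow> (\<Sum>l<n. (y l)\<^sup>2) = lam"
    proof
      assume d: "int M dvd (\<Sum>l<n. (y l)\<^sup>2) - lam"
      show "(\<Sum>l<n. (y l)\<^sup>2) = lam"
      proof (rule ccontr)
        assume "(\<Sum>l<n. (y l)\<^sup>2) \<noteq> lam"
        then have "int M \<le> \<bar>(\<Sum>l<n. (y l)\<^sup>2) - lam\<bar>" using d dvd_imp_le_int[of "(\<Sum>l<n. (y l)\<^sup>2) - lam" "int M"] by simp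
        then show False using small[OF y] by simp
      qed
    qed simp
    then show "complex_of_real (if (\<Sum>l<n. (y l)\<^sup>2) = lam then \<Prod>l<n. g l (y l) else 0)
      = of_real (\<Prod>l<n. g l (y l)) * ((\<Sum>j\<in>?J. root_exp M (j * ((\<Sum>l<n. (y l)\<^sup>2) - lam))) / of_nat M)"
      using M by (simp add: sum_root_exp)
  qed
  also have "\<dots> = (\<Sum>y\<in>?S. \<Sum>j\<in>?J. of_real (\<Prod>l<n. g l (y l)) * root_exp M (j * ((\<Sum>l<n. (y l)\<^sup>2) - lam))) / of_nat M"
    by (simp only: sum_distrib_left sum_divide_distrib times_divide_eq_right)
  also have "(\<Sum>y\<in>?S. \<Sum>j\<in>?J. of_real (\<Prod>l<n. g l (y l)) * root_exp M (j * ((\<Sum>l<n. (y l)\<^sup>2) - lam)))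
    = (\<Sum>j\<in>?J. \<Sum>y\<in>?S. of_real (\<Prod>l<n. g l (y l)) * root_exp M (j * ((\<Sum>l<n. (y l)\<^sup>2) - lam)))" by (rule sum.swap)
  also have "\<dots> = (\<Sum>j\<in>?J. root_exp M (j * (- lam)) * (\<Prod>l<n. \<Sum>m\<in>A. of_real (g l m) * root_exp M (j * m\<^sup>2)))"
  proof (rule sum.cong[OF refl])
    fix j
    have "(\<Sum>y\<in>?S. of_real (\<Prod>l<n. g l (y l)) * root_exp M (j * ((\<Sum>l<n. (y l)\<^sup>2) - lam)))
      = (\<Sum>y\<in>?S. root_exp M (j * (- lam)) * (\<Prod>l<n. of_real (g l (y l)) * root_exp M (j * (y l)\<^sup>2)))"
    proof (rule sum.cong[OF refl])
      fix y
      have "root_exp M (j * ((\<Sum>l<n. (y l)\<^sup>2) - lam)) = root_exp M (j * (- lam) + (\<Sum>l<n. j * (y l)\<^sup>2))"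
        by (simp add: sum_distrib_left[symmetric] algebra_simps)
      also have "\<dots> = root_exp M (j * (- lam)) * (\<Prod>l<n. root_exp M (j * (y l)\<^sup>2))"
        by (simp only: root_exp_add root_exp_sum[OF finite_lessThan])
      finally show "of_real (\<Prod>l<n. g l (y l)) * root_exp M (j * ((\<Sum>l<n. (y l)\<^sup>2) - lam)) = root_exp M (j * (- lam)) * (\<Prod>l<n. of_real (g l (y l)) * root_exp M (j * (y l)\<^sup>2))"
        by (simp add: prod.distrib mult_ac)
    qed
    also have "\<dots> = root_exp M (j * (- lam)) * (\<Prod>l<n. \<Sum>m\<in>A. of_real (g l m) * root_exp M (j * m\<^sup>2))"
      using A by (subst prod_sum_PiE) (auto simp: sum_distrib_left)
    finally show "(\<Sum>y\<in>?S. of_real (\<Prod>l<n. g l (y l)) * root_exp M (j * ((\<Sum>l<n. (y l)\<^sup>2) - lam)))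
      = root_exp M (j * (- lam)) * (\<Prod>l<n. \<Sum>m\<in>A. of_real (g l m) * root_exp M (j * m\<^sup>2))" .
  qed
  finally show ?thesis .
qed

lemma prod_lessThan_split_two:
  fixes f :: "nat \<Rightarrow> 'a::comm_monoid_mult"
  assumes "i0 < n" "i1 < n" "i0 \<noteq> i1"
  shows "(\<Prod>l<n. f l) = f i0 * (f i1 * (\<Prod>l\<in>{..<n} - {i0, i1}. f l))"
proof -
  have "(\<Prod>l<n. f l) = f i0 * (\<Prod>l\<in>{..<n} - {i0}. f l)" using assms by (intro prod.remove) auto
  also have "(\<Prod>l\<in>{..<n} - {i0}. f l) = f i1 * (\<Prod>l\<in>{..<n} - {i0} - {i1}. f l)" using assms by (intro prod.remove) auto
  also have "{..<n} - {i0} - {i1} = {..<n} - {i0, i1}" by auto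
  finally show ?thesis .
qed

text \<open>Cauchy-Schwarz in j separates the sums of F and G, each against the cube of the Weyl
  sum; the other n - 5 Weyl sums are bounded trivially by 10 N^2. Dividing by N^{n-2} for the
  weights gives the exponent 2 (n - 5) + 14/3 - (n - 2) = n - 10/3.\<close>

lemma sphere_pair_bound:
  fixes n :: nat
  assumes n: "n \<ge> 5"
  shows "\<exists>C>0. \<forall>N lam i0 i1 F G. 1 \<le> N \<longrightarrow> 0 \<le> lam \<longrightarrow> lam < (int N + 1)\<^sup>2 \<longrightarrow> i0 < n \<longrightarrow> i1 < n \<longrightarrow> i0 \<noteq> i1 \<longrightarrow>
     (\<forall>m. 0 \<le> F m) \<longrightarrow> (\<forall>m. 0 \<le> G m) \<longrightarrow>
     (\<Sum>x\<in>sphere_pts n lam. F (x i0) * G (x i1)) \<le> C * real N powr (real n - 10/3) *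
        ((\<Sum>m\<in>{-int N..int N}. F m powr (3/2)) powr (2/3) * (\<Sum>m\<in>{-int N..int N}. G m powr (3/2)) powr (2/3))"
proof -
  obtain C where C: "C > 0" "\<And>N M F. 1 \<le> N \<Longrightarrow> good_modulus N M \<Longrightarrow> (\<And>m. 0 \<le> F m) \<Longrightarrow>
    (\<Sum>j\<in>{0..<int M}. (norm (square_sum F N M j))\<^sup>2 * norm (weyl_sum N (of_int j / real M)) ^ 3)
    \<le> C * real M * real N powr (14/3) * (\<Sum>m\<in>{-int N..int N}. F m powr (3/2)) powr (4/3)"
    using energy_bound by blast
  have "(\<Sum>x\<in>sphere_pts n lam. F (x i0) * G (x i1)) \<le> C * 10 ^ (n - 5) * real N powr (real n - 10/3) *
        ((\<Sum>m\<in>{-int N..int N}. F m powr (3/2)) powr (2/3) * (\<Sum>m\<in>{-int N..int N}. G m powr (3/2)) powr (2/3))"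
    if N: "1 \<le> N" and lam: "0 \<le> lam" "lam < (int N + 1)\<^sup>2" and i: "i0 < n" "i1 < n" "i0 \<noteq> i1" 
      and F: "\<And>m. 0 \<le> F m" and G: "\<And>m. 0 \<le> G m" for N lam i0 i1 F G
  proof -
    define M where "M = 8 * (n + 1) * N\<^sup>2 * fact (16 * N)"
    have gm: "good_modulus N M" and MN: "4 * (n + 1) * N\<^sup>2 < M" using good_modulus_exists[OF N] by (auto simp: M_def)
    have M: "0 < M" using MN by linarith
    define A where "A = {-2 * int N..2 * int N}"
    \<comment> \<open>All coordinates on the sphere have size at most N, so cutting F and G there
      changes nothing, while each of the other n - 2 coordinates receives a weight of at least
      N.\<close>
    define cut where "cut = (\<lambda>(f :: int \<Rightarrow> real) m. if \<bar>m\<bar> \<le> int N then f m else 0)"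
    define g where "g = (\<lambda>l. if l = i0 then cut F else if l = i1 then cut G else tent N)"
    let ?S = "PiE {..<n} (\<lambda>_. A)" and ?J = "{0..<int M}"
    have g0: "0 \<le> g l m" for l m using F G by (simp add: g_def cut_def tent_nonneg)
    have finS: "finite ?S" by (intro finite_PiE) (auto simp: A_def)
    have card: "card ({..<n} - {i0, i1}) = n - 2" using i by (simp add: card_Diff_subset numeral_2_eq_2)
    define R where "R = (\<Sum>y\<in>?S. if (\<Sum>l<n. (y l)\<^sup>2) = lam then \<Prod>l<n. g l (y l) else 0)"
    have LR: "(\<Sum>x\<in>sphere_pts n lam. F (x i0) * G (x i1)) * real N ^ (n - 2) \<le> R"
      unfolding sum_distrib_right R_def
    proof (rule sum_le_included[where i = "\<lambda>y l. if l < n then y l else 0"])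
      show "\<forall>y\<in>?S. 0 \<le> (if (\<Sum>l<n. (y l)\<^sup>2) = lam then \<Prod>l<n. g l (y l) else 0)" using g0 by (auto intro: prod_nonneg)
      show "\<forall>x\<in>sphere_pts n lam. \<exists>y\<in>?S. (\<lambda>l. if l < n then y l else 0) = x \<and> F (x i0) * G (x i1) * real N ^ (n - 2) \<le> (if (\<Sum>l<n. (y l)\<^sup>2) = lam then \<Prod>l<n. g l (y l) else 0)"
      proof
        fix x assume x: "x \<in> sphere_pts n lam"
        have xN: "\<bar>x l\<bar> \<le> int N" for l
        proof -
          have "(x l)\<^sup>2 < (int N + 1)\<^sup>2" using sphere_pts_coord_le[OF x, of l] lam by simp
          then have "\<bar>x l\<bar>\<^sup>2 < (int N + 1)\<^sup>2" by simp
          then have "\<bar>x l\<bar> < int N + 1" by (rule power2_less_imp_less) simp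
          then show ?thesis by simp
        qed
        define y where "y = restrict x {..<n}"
        have "x l \<in> A" for l using xN[of l] unfolding A_def abs_le_iff atLeastAtMost_iff by linarith
        then have "y \<in> ?S" by (auto simp: y_def)
        moreover have "(\<lambda>l. if l < n then y l else 0) = x" using x by (auto simp: y_def sphere_pts_def fun_eq_iff)
        moreover have "(\<Sum>l<n. (y l)\<^sup>2) = lam" using x by (simp add: y_def sphere_pts_def)
        moreover have "F (x i0) * G (x i1) * real N ^ (n - 2) \<le> (\<Prod>l<n. g l (y l))"
        proof -
          have "(\<Prod>l<n. g l (y l)) = (\<Prod>l<n. g l (x l))" by (intro prod.cong) (auto simp: y_def)
          also have "\<dots> = g i0 (x i0) * (g i1 (x i1) * (\<Prod>l\<in>{..<n} - {i0, i1}. g l (x l)))"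
            by (rule prod_lessThan_split_two[OF i])
          also have "g i0 (x i0) = F (x i0)" using xN by (simp add: g_def cut_def)
          also have "g i1 (x i1) = G (x i1)" using xN i by (simp add: g_def cut_def)
          finally have e: "(\<Prod>l<n. g l (y l)) = F (x i0) * (G (x i1) * (\<Prod>l\<in>{..<n} - {i0, i1}. g l (x l)))" .
          have "real N ^ (n - 2) = (\<Prod>l\<in>{..<n} - {i0, i1}. real N)" by (simp add: card)
          also have "\<dots> \<le> (\<Prod>l\<in>{..<n} - {i0, i1}. g l (x l))"
          proof (rule prod_mono)
            fix l assume "l \<in> {..<n} - {i0, i1}"
            moreover have "real_of_int \<bar>x l\<bar> \<le> real N" using xN[of l] by linarith
            ultimately show "0 \<le> real N \<and> real N \<le> g l (x l)" by (auto simp: g_def tent_def)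
          qed
          finally show ?thesis unfolding e mult.assoc using F G by (intro mult_left_mono) auto
        qed
        ultimately show "\<exists>y\<in>?S. (\<lambda>l. if l < n then y l else 0) = x \<and> F (x i0) * G (x i1) * real N ^ (n - 2) \<le> (if (\<Sum>l<n. (y l)\<^sup>2) = lam then \<Prod>l<n. g l (y l) else 0)"
          by (intro bexI[of _ y]) auto
      qed
    qed (use finS finite_sphere_pts in auto)
    have small: "\<bar>(\<Sum>l<n. (y l)\<^sup>2) - lam\<bar> < int M" if y: "y \<in> ?S" for y
    proof -
      have "(y l)\<^sup>2 \<le> 4 * int (N\<^sup>2)" if "l < n" for l
      proof -
        have "\<bar>y l\<bar> \<le> 2 * int N" using y that by (auto simp: A_def PiE_def Pi_def abs_le_iff)
        then have "\<bar>y l\<bar>\<^sup>2 \<le> (2 * int N)\<^sup>2" by (intro power_mono) auto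
        then show ?thesis by (simp add: power_mult_distrib)
      qed
      then have "(\<Sum>l<n. (y l)\<^sup>2) \<le> (\<Sum>l<n. 4 * int (N\<^sup>2))" by (intro sum_mono) auto
      then have 1: "(\<Sum>l<n. (y l)\<^sup>2) \<le> int (4 * n * N\<^sup>2)" by simp
      have 2: "0 \<le> (\<Sum>l<n. (y l)\<^sup>2)" by (simp add: sum_nonneg)
      have "(int N + 1)\<^sup>2 \<le> (2 * int N)\<^sup>2" using N by (intro power_mono) auto
      then have 3: "lam < int (4 * N\<^sup>2)" using lam by (simp add: power_mult_distrib)
      have "int (4 * n * N\<^sup>2) + int (4 * N\<^sup>2) < int M" using MN by (simp add: algebra_simps flip: of_nat_add of_nat_mult)
      then show ?thesis using 1 2 3 lam by linarith
    qed
    define f1 where "f1 = (\<lambda>j. norm (square_sum F N M j))"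
    define f2 where "f2 = (\<lambda>j. norm (square_sum G N M j))"
    define w where "w = (\<lambda>j. norm (weyl_sum N (of_int j / real M)))"
    have cut: "(\<Sum>m\<in>A. of_real (cut f m) * root_exp M (j * m\<^sup>2)) = square_sum f N M j" for f j
      unfolding square_sum_def A_def by (rule sum.mono_neutral_cong_right) (auto simp: cut_def abs_le_iff)
    have "R = norm (complex_of_real R)"
    proof -
      have "0 \<le> R" unfolding R_def using g0 by (intro sum_nonneg) (auto intro: prod_nonneg)
      then show ?thesis by simp
    qed
    also have "complex_of_real R = (\<Sum>j\<in>?J. root_exp M (j * (- lam)) * (\<Prod>l<n. \<Sum>m\<in>A. of_real (g l m) * root_exp M (j * m\<^sup>2))) / of_nat M"
      unfolding R_def by (rule sum_on_sphere_eq_fourier[OF M _ small]) (auto simp: A_def)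
    also have "norm \<dots> \<le> (\<Sum>j\<in>?J. norm (root_exp M (j * (- lam)) * (\<Prod>l<n. \<Sum>m\<in>A. of_real (g l m) * root_exp M (j * m\<^sup>2)))) / real M"
      unfolding norm_divide by (simp only: norm_of_nat) (intro divide_right_mono norm_sum, simp)
    also have "\<dots> \<le> (\<Sum>j\<in>?J. (10 * (real N)\<^sup>2) ^ (n - 5) * (f1 j * f2 j * w j ^ 3)) / real M"
    proof (intro divide_right_mono sum_mono)
      fix j
      have "norm (root_exp M (j * (- lam)) * (\<Prod>l<n. \<Sum>m\<in>A. of_real (g l m) * root_exp M (j * m\<^sup>2)))
        = (\<Prod>l<n. norm (\<Sum>m\<in>A. of_real (g l m) * root_exp M (j * m\<^sup>2)))" by (simp add: norm_mult prod_norm)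
      also have "\<dots> = norm (\<Sum>m\<in>A. of_real (g i0 m) * root_exp M (j * m\<^sup>2)) * (norm (\<Sum>m\<in>A. of_real (g i1 m) * root_exp M (j * m\<^sup>2)) *
        (\<Prod>l\<in>{..<n} - {i0, i1}. norm (\<Sum>m\<in>A. of_real (g l m) * root_exp M (j * m\<^sup>2))))"
        by (rule prod_lessThan_split_two[OF i])
      also have "g i0 = cut F" by (simp add: g_def)
      also have "g i1 = cut G" using i by (simp add: g_def)
      also have "(\<Prod>l\<in>{..<n} - {i0, i1}. norm (\<Sum>m\<in>A. of_real (g l m) * root_exp M (j * m\<^sup>2))) = (\<Prod>l\<in>{..<n} - {i0, i1}. w j)"
        by (intro prod.cong) (auto simp: g_def w_def weyl_sum_eq_root_exp A_def)
      also have "\<dots> = w j ^ (n - 2)" by (simp add: card)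
      also have "n - 2 = 3 + (n - 5)" using n by simp
      also have "norm (\<Sum>m\<in>A. of_real (cut F m) * root_exp M (j * m\<^sup>2)) * (norm (\<Sum>m\<in>A. of_real (cut G m) * root_exp M (j * m\<^sup>2)) * w j ^ (3 + (n - 5)))
        = (f1 j * f2 j * w j ^ 3) * w j ^ (n - 5)" unfolding cut by (simp add: f1_def f2_def power_add)
      also have "\<dots> \<le> (f1 j * f2 j * w j ^ 3) * (10 * (real N)\<^sup>2) ^ (n - 5)"
        by (intro mult_left_mono power_mono) (auto simp: w_def f1_def f2_def norm_weyl_sum_le[OF N])
      finally show "norm (root_exp M (j * (- lam)) * (\<Prod>l<n. \<Sum>m\<in>A. of_real (g l m) * root_exp M (j * m\<^sup>2)))
        \<le> (10 * (real N)\<^sup>2) ^ (n - 5) * (f1 j * f2 j * w j ^ 3)" by (simp add: mult_ac)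
    qed simp
    also have "\<dots> = (10 * (real N)\<^sup>2) ^ (n - 5) * ((\<Sum>j\<in>?J. f1 j * f2 j * w j ^ 3) / real M)"
      by (simp add: sum_distrib_left)
    finally have R: "R \<le> (10 * (real N)\<^sup>2) ^ (n - 5) * ((\<Sum>j\<in>?J. f1 j * f2 j * w j ^ 3) / real M)" .
    define sF where "sF = (\<Sum>m\<in>{-int N..int N}. F m powr (3/2))"
    define sG where "sG = (\<Sum>m\<in>{-int N..int N}. G m powr (3/2))"
    have CS: "(\<Sum>j\<in>?J. f1 j * f2 j * w j ^ 3) \<le> C * real M * real N powr (14/3) * (sF powr (2/3) * sG powr (2/3))"
    proof -
      have "(\<Sum>j\<in>?J. (f1 j * sqrt (w j ^ 3)) * (f2 j * sqrt (w j ^ 3)))\<^sup>2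
        \<le> (\<Sum>j\<in>?J. (f1 j * sqrt (w j ^ 3))\<^sup>2) * (\<Sum>j\<in>?J. (f2 j * sqrt (w j ^ 3))\<^sup>2)" by (rule Cauchy_Schwarz_ineq_sum)
      moreover have w0: "0 \<le> w j ^ 3" for j by (simp add: w_def)
      moreover have "(f1 j * sqrt (w j ^ 3)) * (f2 j * sqrt (w j ^ 3)) = f1 j * f2 j * w j ^ 3" for j
        using w0[of j] by (simp add: mult_ac flip: power2_eq_square)
      moreover have "(f j * sqrt (w j ^ 3))\<^sup>2 = (f j)\<^sup>2 * w j ^ 3" for f j using w0[of j] by (simp add: power_mult_distrib)
      ultimately have "(\<Sum>j\<in>?J. f1 j * f2 j * w j ^ 3)\<^sup>2 \<le> (\<Sum>j\<in>?J. (f1 j)\<^sup>2 * w j ^ 3) * (\<Sum>j\<in>?J. (f2 j)\<^sup>2 * w j ^ 3)" by simp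
      also have "\<dots> \<le> (C * real M * real N powr (14/3) * sF powr (4/3)) * (C * real M * real N powr (14/3) * sG powr (4/3))"
        unfolding f1_def f2_def w_def sF_def sG_def using C(1)
        by (intro mult_mono C(2) N gm F G) (auto intro!: sum_nonneg mult_nonneg_nonneg)
      also have "\<dots> = (C * real M * real N powr (14/3) * (sF powr (2/3) * sG powr (2/3)))\<^sup>2"
      proof -
        have "s powr (4/3) = s powr (2/3) * s powr (2/3)" for s :: real by (simp add: powr_add[symmetric])
        then show ?thesis by (simp add: power2_eq_square)
      qed
      finally show ?thesis by (rule power2_le_imp_le) (use C(1) in simp)
    qed
    have "(\<Sum>x\<in>sphere_pts n lam. F (x i0) * G (x i1)) * real N ^ (n - 2)
      \<le> (10 * (real N)\<^sup>2) ^ (n - 5) * ((C * real M * real N powr (14/3) * (sF powr (2/3) * sG powr (2/3))) / real M)"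
      by (rule order_trans[OF LR], rule order_trans[OF R], intro mult_left_mono divide_right_mono CS) auto
    also have "\<dots> = (C * 10 ^ (n - 5) * real N powr (real n - 10/3) * (sF powr (2/3) * sG powr (2/3))) * real N ^ (n - 2)"
    proof -
      have e: "(10 * (real N)\<^sup>2) ^ (n - 5) = 10 ^ (n - 5) * real N powr (2 * (real n - 5))"
      proof -
        have "((real N)\<^sup>2) ^ (n - 5) = real N ^ (2 * (n - 5))" by (simp add: power_mult)
        also have "\<dots> = real N powr real (2 * (n - 5))" by (rule powr_realpow[symmetric]) (use N in simp)
        also have "real (2 * (n - 5)) = 2 * (real n - 5)" using n by (simp add: of_nat_diff)
        finally show ?thesis by (simp add: power_mult_distrib)
      qed
      have e2: "real N ^ (n - 2) = real N powr (real n - 2)"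
        using N n by (simp add: powr_realpow[symmetric] of_nat_diff)
      have "real N powr (2 * (real n - 5)) * real N powr (14/3) = real N powr (real n - 10/3) * real N powr (real n - 2)"
        unfolding powr_add[symmetric] by (rule arg_cong[where f = "\<lambda>x. real N powr x"]) simp
      then show ?thesis unfolding e e2 using M by (simp add: mult_ac) 
    qed
    finally have "(\<Sum>x\<in>sphere_pts n lam. F (x i0) * G (x i1)) \<le> C * 10 ^ (n - 5) * real N powr (real n - 10/3) * (sF powr (2/3) * sG powr (2/3))"
      using N by (simp add: mult_le_cancel_right)
    then show ?thesis by (simp only: sF_def sG_def)
  qed
  then show ?thesis using C(1) by (intro exI[of _ "C * 10 ^ (n - 5)"]) auto
qed

section \<open>The maximal function on the integers\<close>

text \<open>\<open>L\<close> picks one average per point, so no supremum over scales is needed.\<close>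

lemma maximal_weak_type:
  fixes g :: "int \<Rightarrow> real" and L :: "int \<Rightarrow> nat"
  assumes "finite Y" "finite Z" "t \<ge> 0" and g: "\<And>m. 0 \<le> g m"
    and big: "\<And>y. y \<in> Y \<Longrightarrow> 1 \<le> L y \<and> t * real (L y) \<le> (\<Sum>m\<in>{y..<y + int (L y)}. g m) \<and> {y..<y + int (L y)} \<subseteq> Z"
  shows "t * real (card Y) \<le> sum g Z"
  using assms(1,2) big
proof (induction "card Y" arbitrary: Y Z rule: less_induct)
  case less
  show ?case
  proof (cases "Y = {}")
    case True
    then show ?thesis using g by (simp add: sum_nonneg)
  next
    case False
    \<comment> \<open>Greedy from the left: the interval [y, b) of the leftmost point accounts for
      all points of \<open>Y\<close> below b, at most \<open>L y\<close> many, and the intervals of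
      the remaining points do not meet it.\<close>
    define y where "y = Min Y"
    define b where "b = y + int (L y)"
    have y: "y \<in> Y" "\<And>z. z \<in> Y \<Longrightarrow> y \<le> z" using False less.prems(1) by (auto simp: y_def)
    have Ly: "1 \<le> L y" "t * real (L y) \<le> (\<Sum>m\<in>{y..<b}. g m)" "{y..<b} \<subseteq> Z"
      using less.prems(3)[OF y(1)] by (auto simp: b_def)
    define Y' where "Y' = {z\<in>Y. b \<le> z}"
    define Z' where "Z' = {z\<in>Z. b \<le> z}"
    have "y \<notin> Y'" using Ly(1) by (simp add: Y'_def b_def)
    then have "card Y' < card Y" using y(1) less.prems(1) by (intro psubset_card_mono) (auto simp: Y'_def)
    then have IH: "t * real (card Y') \<le> sum g Z'"
    proof (rule less.hyps)
      show "finite Y'" "finite Z'" using less.prems(1,2) by (auto simp: Y'_def Z'_def)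
      fix z assume "z \<in> Y'"
      then have z: "z \<in> Y" "b \<le> z" by (auto simp: Y'_def)
      show "1 \<le> L z \<and> t * real (L z) \<le> (\<Sum>m\<in>{z..<z + int (L z)}. g m) \<and> {z..<z + int (L z)} \<subseteq> Z'"
        using less.prems(3)[OF z(1)] z(2) by (auto simp: Z'_def)
    qed
    have "Y \<subseteq> {y..<b} \<union> Y'" using y by (auto simp: Y'_def)
    then have "card Y \<le> card ({y..<b} \<union> Y')" using less.prems(1) by (intro card_mono) (auto simp: Y'_def)
    also have "\<dots> \<le> card {y..<b} + card Y'" by (rule card_Un_le)
    also have "card {y..<b} = L y" by (simp add: b_def)
    finally have "real (card Y) \<le> real (L y) + real (card Y')" by linarith
    then have "t * real (card Y) \<le> t * (real (L y) + real (card Y'))" using assms(3) by (rule mult_left_mono)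
    also have "\<dots> \<le> (\<Sum>m\<in>{y..<b}. g m) + sum g Z'" using Ly(2) IH by (simp add: distrib_left)
    also have "\<dots> = sum g ({y..<b} \<union> Z')"
      using less.prems(2) by (intro sum.union_disjoint[symmetric]) (auto simp: Z'_def)
    also have "\<dots> \<le> sum g Z" using Ly(3) less.prems(2) g by (intro sum_mono2) (auto simp: Z'_def)
    finally show ?thesis .
  qed
qed

lemma geometric_sum_int_le:
  fixes r :: real and J :: "int set"
  assumes "finite J" "r > 1" "\<And>j. j \<in> J \<Longrightarrow> j \<le> K"
  shows "(\<Sum>j\<in>J. r powr real_of_int j) \<le> r powr real_of_int K * (1 / (1 - 1 / r))"
proof -
  have "(\<Sum>j\<in>J. r powr real_of_int j) = (\<Sum>j\<in>J. r powr real_of_int K * (1 / r) ^ nat (K - j))"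
  proof (rule sum.cong[OF refl])
    fix j assume "j \<in> J"
    then have jK: "j \<le> K" using assms by simp
    have "(1 / r) ^ nat (K - j) = r powr (- real (nat (K - j)))"
      using assms(2) by (simp add: powr_minus powr_realpow power_one_over inverse_eq_divide)
    also have "real (nat (K - j)) = real_of_int K - real_of_int j" using jK by simp
    finally show "r powr real_of_int j = r powr real_of_int K * (1 / r) ^ nat (K - j)"
      by (simp add: powr_add[symmetric])
  qed
  also have "\<dots> = r powr real_of_int K * (\<Sum>j\<in>J. (1 / r) ^ nat (K - j))" by (simp add: sum_distrib_left)
  also have "(\<Sum>j\<in>J. (1 / r) ^ nat (K - j)) = (\<Sum>i\<in>(\<lambda>j. nat (K - j)) ` J. (1 / r) ^ i)"
  proof (subst sum.reindex)
    show "inj_on (\<lambda>j. nat (K - j)) J" using assms(3) by (auto simp: inj_on_def eq_nat_nat_iff)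
  qed simp
  also have "\<dots> \<le> suminf (\<lambda>i. (1 / r) ^ i)" using assms by (intro sum_le_suminf summable_geometric) auto
  also have "suminf (\<lambda>i. (1 / r) ^ i) = 1 / (1 - 1 / r)" using assms(2) by (intro suminf_geometric) auto
  finally show ?thesis by (simp add: mult_left_mono)
qed

text \<open>Dyadic levels: at level 2^j the values of g up to 2^{j-1} contribute at most half of the
  average, so the weak type bound is applied to the larger values only. For fixed m the sum over j
  is geometric with ratio 2^{P-1} > 1 and stops at the size of g(m).\<close>

lemma maximal_strong_type_right:
  fixes P :: real
  assumes P: "P > 1"
  shows "\<exists>C>0. \<forall>(g :: int \<Rightarrow> real) (L :: int \<Rightarrow> nat) Y Z. finite Y \<longrightarrow> finite Z \<longrightarrow> (\<forall>m. 0 \<le> g m) \<longrightarrow>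
     (\<forall>y\<in>Y. 1 \<le> L y \<and> {y..<y + int (L y)} \<subseteq> Z) \<longrightarrow>
     (\<Sum>y\<in>Y. ((\<Sum>m\<in>{y..<y + int (L y)}. g m) / real (L y)) powr P) \<le> C * (\<Sum>m\<in>Z. g m powr P)"
proof -
  define r where "r = (2::real) powr (P - 1)"
  have r: "r > 1" using P by (simp add: r_def)
  define C where "C = 2 powr (P + 1) * (2 powr (P - 1) * (1 / (1 - 1 / r)))"
  have C: "C > 0" using r by (simp add: C_def)
  have "(\<Sum>y\<in>Y. ((\<Sum>m\<in>{y..<y + int (L y)}. g m) / real (L y)) powr P) \<le> C * (\<Sum>m\<in>Z. g m powr P)"
    if fin: "finite Y" "finite Z" and g: "\<And>m. 0 \<le> g m" and L: "\<And>y. y \<in> Y \<Longrightarrow> 1 \<le> L y \<and> {y..<y + int (L y)} \<subseteq> Z"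
    for g :: "int \<Rightarrow> real" and L :: "int \<Rightarrow> nat" and Y Z
  proof -
    define a where "a = (\<lambda>y. (\<Sum>m\<in>{y..<y + int (L y)}. g m) / real (L y))"
    have a0: "0 \<le> a y" for y using g by (simp add: a_def sum_nonneg)
    define Y1 where "Y1 = {y\<in>Y. 0 < a y}"
    \<comment> \<open>Ceiling minus one gives 2^lev < a <= 2^(lev + 1), with the strict inequality
      on the side where the level set in \<open>weak\<close> has it.\<close>
    define lev where "lev = (\<lambda>y. \<lceil>log 2 (a y)\<rceil> - 1)"
    have lev: "2 powr real_of_int (lev y) < a y" "a y \<le> 2 powr (real_of_int (lev y) + 1)" if "y \<in> Y1" for y
    proof -
      have "0 < a y" using that by (simp add: Y1_def)
      moreover have "real_of_int (lev y) < log 2 (a y)" "log 2 (a y) \<le> real_of_int (lev y) + 1" unfolding lev_def by linarith+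
      ultimately show "2 powr real_of_int (lev y) < a y" "a y \<le> 2 powr (real_of_int (lev y) + 1)"
        by (simp_all add: less_log_iff log_le_iff)
    qed
    define J where "J = lev ` Y1"
    have finJ: "finite J" "finite Y1" using fin by (auto simp: J_def Y1_def)
    have weak: "real (card {y\<in>Y. 2 powr real_of_int j < a y}) \<le> 2 powr (1 - real_of_int j) * (\<Sum>m\<in>Z. if 2 powr (real_of_int j - 1) < g m then g m else 0)" for j
    proof -
      define t where "t = (2::real) powr (real_of_int j - 1)"
      have t: "t > 0" "2 powr real_of_int j = 2 * t" by (simp_all add: t_def powr_diff)
      define h where "h = (\<lambda>m. if t < g m then g m else 0)"
      have "t * real (card {y\<in>Y. 2 powr real_of_int j < a y}) \<le> sum h Z"
      proof (rule maximal_weak_type[where L = L])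
        fix y assume "y \<in> {y\<in>Y. 2 powr real_of_int j < a y}"
        then have y: "y \<in> Y" "2 * t < a y" using t by auto
        have Ly: "1 \<le> L y" "{y..<y + int (L y)} \<subseteq> Z" using L[OF y(1)] by auto
        have "2 * t * real (L y) \<le> (\<Sum>m\<in>{y..<y + int (L y)}. g m)" using y(2) Ly(1) by (simp add: a_def pos_less_divide_eq)
        also have "\<dots> \<le> (\<Sum>m\<in>{y..<y + int (L y)}. h m + t)" using t g by (intro sum_mono) (auto simp: h_def)
        also have "\<dots> = (\<Sum>m\<in>{y..<y + int (L y)}. h m) + real (L y) * t" by (simp add: sum.distrib)
        finally have "t * real (L y) \<le> (\<Sum>m\<in>{y..<y + int (L y)}. h m)" by (simp add: algebra_simps)
        then show "1 \<le> L y \<and> t * real (L y) \<le> (\<Sum>m\<in>{y..<y + int (L y)}. h m) \<and> {y..<y + int (L y)} \<subseteq> Z" using Ly by simp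
      qed (use fin t g in \<open>auto simp: h_def\<close>)
      then have "real (card {y\<in>Y. 2 powr real_of_int j < a y}) \<le> sum h Z / t" using t(1) by (simp add: pos_le_divide_eq mult.commute)
      also have "1 / t = 2 powr (1 - real_of_int j)" by (simp add: t_def powr_minus_divide[symmetric])
      then have "sum h Z / t = 2 powr (1 - real_of_int j) * sum h Z" by (metis mult.commute mult_1 times_divide_eq_right)
      finally show ?thesis by (simp add: h_def t_def)
    qed
    have "(\<Sum>y\<in>Y. a y powr P) = (\<Sum>y\<in>Y1. a y powr P)"
      using fin a0 P by (intro sum.mono_neutral_right) (auto simp: Y1_def less_le)
    also have "\<dots> \<le> (\<Sum>y\<in>Y1. 2 powr (P * (real_of_int (lev y) + 1)))"
    proof (rule sum_mono)
      fix y assume "y \<in> Y1"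
      then have "a y powr P \<le> (2 powr (real_of_int (lev y) + 1)) powr P" using a0 P lev by (intro powr_mono2) auto
      then show "a y powr P \<le> 2 powr (P * (real_of_int (lev y) + 1))" by (simp add: powr_powr mult.commute)
    qed
    also have "\<dots> = (\<Sum>j\<in>J. \<Sum>y | y \<in> Y1 \<and> lev y = j. 2 powr (P * (real_of_int (lev y) + 1)))"
      unfolding J_def using finJ(2) by (rule sum.image_gen)
    also have "\<dots> \<le> (\<Sum>j\<in>J. 2 powr (P * (real_of_int j + 1)) * real (card {y\<in>Y. 2 powr real_of_int j < a y}))"
    proof (rule sum_mono)
      fix j
      have "(\<Sum>y | y \<in> Y1 \<and> lev y = j. 2 powr (P * (real_of_int (lev y) + 1))) = 2 powr (P * (real_of_int j + 1)) * real (card {y. y \<in> Y1 \<and> lev y = j})"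
        by simp
      also have "\<dots> \<le> 2 powr (P * (real_of_int j + 1)) * real (card {y\<in>Y. 2 powr real_of_int j < a y})"
        using fin lev by (intro mult_left_mono of_nat_mono card_mono) (auto simp: Y1_def)
      finally show "(\<Sum>y | y \<in> Y1 \<and> lev y = j. 2 powr (P * (real_of_int (lev y) + 1))) \<le> 2 powr (P * (real_of_int j + 1)) * real (card {y\<in>Y. 2 powr real_of_int j < a y})" .
    qed
    also have "\<dots> \<le> (\<Sum>j\<in>J. 2 powr (P * (real_of_int j + 1)) * (2 powr (1 - real_of_int j) * (\<Sum>m\<in>Z. if 2 powr (real_of_int j - 1) < g m then g m else 0)))"
      by (intro sum_mono mult_left_mono weak) simp
    also have "\<dots> = (\<Sum>j\<in>J. \<Sum>m\<in>Z. 2 powr (P + 1) * (if 2 powr (real_of_int j - 1) < g m then r powr real_of_int j * g m else 0))"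
    proof (rule sum.cong[OF refl])
      fix j
      have "2 powr (P * (real_of_int j + 1)) * 2 powr (1 - real_of_int j) = 2 powr (P + 1) * r powr real_of_int j"
        unfolding r_def powr_powr powr_add[symmetric] by (rule arg_cong[where f = "\<lambda>x. 2 powr x"]) (simp add: algebra_simps)
      then show "2 powr (P * (real_of_int j + 1)) * (2 powr (1 - real_of_int j) * (\<Sum>m\<in>Z. if 2 powr (real_of_int j - 1) < g m then g m else 0))
         = (\<Sum>m\<in>Z. 2 powr (P + 1) * (if 2 powr (real_of_int j - 1) < g m then r powr real_of_int j * g m else 0))"
        unfolding mult.assoc[symmetric] by (simp only: sum_distrib_left) (intro sum.cong, auto)
    qed
    also have "\<dots> = (\<Sum>m\<in>Z. \<Sum>j\<in>J. 2 powr (P + 1) * (if 2 powr (real_of_int j - 1) < g m then r powr real_of_int j * g m else 0))" by (rule sum.swap)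
    also have "\<dots> \<le> (\<Sum>m\<in>Z. C * g m powr P)"
    proof (rule sum_mono)
      fix m
      define J' where "J' = {j\<in>J. 2 powr (real_of_int j - 1) < g m}"
      have finJ': "finite J'" using finJ by (simp add: J'_def)
      have "(\<Sum>j\<in>J. 2 powr (P + 1) * (if 2 powr (real_of_int j - 1) < g m then r powr real_of_int j * g m else 0))
         = 2 powr (P + 1) * ((\<Sum>j\<in>J'. r powr real_of_int j) * g m)"
        unfolding sum_distrib_left[symmetric] sum_distrib_right J'_def by (subst sum.inter_filter[OF finJ(1)]) (rule refl)
      also have "\<dots> \<le> C * g m powr P"
      proof (cases "J' = {}")
        case True
        then show ?thesis using C by simp
      next
        case False
        define K where "K = Max J'"
        have K: "K \<in> J'" "\<And>j. j \<in> J' \<Longrightarrow> j \<le> K" using False finJ' by (auto simp: K_def)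
        have gK: "2 powr (real_of_int K - 1) < g m" using K(1) by (simp add: J'_def)
        moreover have "0 < (2::real) powr (real_of_int K - 1)" by simp
        ultimately have gpos: "0 < g m" by (rule order.strict_trans[rotated])
        have "(\<Sum>j\<in>J'. r powr real_of_int j) \<le> r powr real_of_int K * (1 / (1 - 1 / r))"
          by (rule geometric_sum_int_le) (use finJ' r K in auto)
        also have "r powr real_of_int K = 2 powr (P - 1) * (2 powr (real_of_int K - 1)) powr (P - 1)"
          unfolding r_def powr_powr powr_add[symmetric] by (rule arg_cong[where f = "\<lambda>x. 2 powr x"]) (simp add: algebra_simps)
        also have "\<dots> * (1 / (1 - 1 / r)) \<le> 2 powr (P - 1) * g m powr (P - 1) * (1 / (1 - 1 / r))"
          using gK P r by (intro mult_right_mono mult_left_mono powr_mono2) auto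
        finally have "2 powr (P + 1) * ((\<Sum>j\<in>J'. r powr real_of_int j) * g m) \<le> 2 powr (P + 1) * ((2 powr (P - 1) * g m powr (P - 1) * (1 / (1 - 1 / r))) * g m)"
          using gpos by (intro mult_left_mono mult_right_mono) auto
        also have "\<dots> = C * (g m * g m powr (P - 1))" by (simp add: C_def mult_ac)
        also have "g m * g m powr (P - 1) = g m powr P" using powr_mult_base[of "g m" "P - 1"] gpos by simp
        finally show ?thesis .
      qed
      finally show "(\<Sum>j\<in>J. 2 powr (P + 1) * (if 2 powr (real_of_int j - 1) < g m then r powr real_of_int j * g m else 0)) \<le> C * g m powr P" .
    qed
    also have "\<dots> = C * (\<Sum>m\<in>Z. g m powr P)" by (simp add: sum_distrib_left)
    finally show ?thesis by (simp only: a_def)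
  qed
  then show ?thesis using C by (intro exI[of _ C]) auto
qed

text \<open>The centred sum is covered by a right and a left interval of length N + 1 that share the
  point y; the left one is a right one for the reflected function. Passing from N + 1 to N and from
  the sum of both averages to their maximum costs 4^P.\<close>

lemma maximal_strong_type:
  fixes P :: real
  assumes P: "P > 1"
  shows "\<exists>C>0. \<forall>(g :: int \<Rightarrow> real) (N :: int \<Rightarrow> nat) Y B. finite Y \<longrightarrow> (\<forall>m. 0 \<le> g m) \<longrightarrow> (\<forall>y\<in>Y. 1 \<le> N y) \<longrightarrow>
     (\<forall>Z. finite Z \<longrightarrow> (\<Sum>m\<in>Z. g m powr P) \<le> B) \<longrightarrow>
     (\<Sum>y\<in>Y. ((\<Sum>m\<in>{-int (N y)..int (N y)}. g (y - m)) / real (N y)) powr P) \<le> C * B"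
proof -
  obtain C where C: "C > 0" and C': "\<forall>(g :: int \<Rightarrow> real) (L :: int \<Rightarrow> nat) Y Z. finite Y \<longrightarrow> finite Z \<longrightarrow> (\<forall>m. 0 \<le> g m) \<longrightarrow>
     (\<forall>y\<in>Y. 1 \<le> L y \<and> {y..<y + int (L y)} \<subseteq> Z) \<longrightarrow>
     (\<Sum>y\<in>Y. ((\<Sum>m\<in>{y..<y + int (L y)}. g m) / real (L y)) powr P) \<le> C * (\<Sum>m\<in>Z. g m powr P)"
    using maximal_strong_type_right[OF P] by (elim exE conjE) (rule that; assumption)
  have "(\<Sum>y\<in>Y. ((\<Sum>m\<in>{-int (N y)..int (N y)}. g (y - m)) / real (N y)) powr P) \<le> (2 * 4 powr P * C) * B"
    if fin: "finite Y" and g: "\<And>m. 0 \<le> g m" and N: "\<And>y. y \<in> Y \<Longrightarrow> 1 \<le> N y" and B: "\<And>Z. finite Z \<Longrightarrow> (\<Sum>m\<in>Z. g m powr P) \<le> B"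
    for g :: "int \<Rightarrow> real" and N :: "int \<Rightarrow> nat" and Y B
  proof -
    define L where "L = (\<lambda>y. N y + 1)"
    define a where "a = (\<lambda>y. (\<Sum>m\<in>{y..<y + int (L y)}. g m) / real (L y))"
    define b where "b = (\<lambda>y. (\<Sum>m\<in>{-y..<-y + int (L y)}. g (- m)) / real (L y))"
    have ab0: "0 \<le> a y" "0 \<le> b y" for y using g by (simp_all add: a_def b_def sum_nonneg)
    have "(\<Sum>y\<in>Y. a y powr P) \<le> C * (\<Sum>m\<in>(\<Union>y\<in>Y. {y..<y + int (L y)}). g m powr P)"
      unfolding a_def by (rule C'[rule_format]) (use fin g in \<open>auto simp: L_def\<close>)
    also have "\<dots> \<le> C * B" using C fin by (intro mult_left_mono B) auto
    finally have sa: "(\<Sum>y\<in>Y. a y powr P) \<le> C * B" .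
    have "(\<Sum>y\<in>Y. b y powr P) = (\<Sum>y\<in>uminus ` Y. ((\<Sum>m\<in>{y..<y + int (L (- y))}. g (- m)) / real (L (- y))) powr P)"
      by (subst sum.reindex) (auto simp: b_def)
    also have "\<dots> \<le> C * (\<Sum>m\<in>(\<Union>y\<in>uminus ` Y. {y..<y + int (L (- y))}). g (- m) powr P)"
      by (rule C'[rule_format]) (use fin g in \<open>auto simp: L_def\<close>)
    also have "(\<Sum>m\<in>(\<Union>y\<in>uminus ` Y. {y..<y + int (L (- y))}). g (- m) powr P) = (\<Sum>m\<in>uminus ` (\<Union>y\<in>uminus ` Y. {y..<y + int (L (- y))}). g m powr P)"
      by (subst sum.reindex) auto
    also have "C * \<dots> \<le> C * B" using C fin by (intro mult_left_mono B) auto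
    finally have sb: "(\<Sum>y\<in>Y. b y powr P) \<le> C * B" .
    have "((\<Sum>m\<in>{-int (N y)..int (N y)}. g (y - m)) / real (N y)) powr P \<le> 4 powr P * (a y powr P + b y powr P)" if y: "y \<in> Y" for y
    proof -
      let ?s = "\<Sum>m\<in>{-int (N y)..int (N y)}. g (y - m)"
      have Ny: "1 \<le> real (N y)" using N[OF y] by simp
      have "?s \<le> (\<Sum>m\<in>{-int (N y)..0} \<union> {0..int (N y)}. g (y - m))" using g by (intro sum_mono2) auto
      also have "\<dots> \<le> (\<Sum>m\<in>{-int (N y)..0}. g (y - m)) + (\<Sum>m\<in>{0..int (N y)}. g (y - m))"
        using g by (subst sum_Un) (auto intro: sum_nonneg)
      also have "(\<Sum>m\<in>{-int (N y)..0}. g (y - m)) = (\<Sum>m\<in>{y..<y + int (L y)}. g m)"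
        by (rule sum.reindex_bij_witness[of _ "\<lambda>m. y - m" "\<lambda>m. y - m"]) (auto simp: L_def)
      also have "(\<Sum>m\<in>{0..int (N y)}. g (y - m)) = (\<Sum>m\<in>{-y..<-y + int (L y)}. g (- m))"
        by (rule sum.reindex_bij_witness[of _ "\<lambda>m. y + m" "\<lambda>m. m - y"]) (auto simp: L_def)
      also have "(\<Sum>m\<in>{y..<y + int (L y)}. g m) = real (L y) * a y" by (simp add: a_def L_def)
      also have "(\<Sum>m\<in>{-y..<-y + int (L y)}. g (- m)) = real (L y) * b y" by (simp add: b_def L_def)
      finally have "?s \<le> real (L y) * (a y + b y)" by (simp add: distrib_left)
      also have "\<dots> \<le> (2 * real (N y)) * (2 * max (a y) (b y))"
        using Ny ab0[of y] by (intro mult_mono) (auto simp: L_def)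
      finally have "?s / real (N y) \<le> 4 * max (a y) (b y)" using Ny by (simp add: field_simps)
      moreover have "0 \<le> ?s / real (N y)" using g by (simp add: sum_nonneg)
      ultimately have "(?s / real (N y)) powr P \<le> (4 * max (a y) (b y)) powr P" using P by (intro powr_mono2) auto
      also have "\<dots> = 4 powr P * max (a y) (b y) powr P" by (simp add: powr_mult)
      also have "\<dots> \<le> 4 powr P * (a y powr P + b y powr P)" by (intro mult_left_mono) (auto simp: max_def)
      finally show ?thesis .
    qed
    then have "(\<Sum>y\<in>Y. ((\<Sum>m\<in>{-int (N y)..int (N y)}. g (y - m)) / real (N y)) powr P) \<le> (\<Sum>y\<in>Y. 4 powr P * (a y powr P + b y powr P))"
      by (rule sum_mono)
    also have "\<dots> = 4 powr P * ((\<Sum>y\<in>Y. a y powr P) + (\<Sum>y\<in>Y. b y powr P))" by (simp add: sum_distrib_left sum.distrib distrib_left)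
    also have "\<dots> \<le> 4 powr P * (C * B + C * B)" using sa sb by (intro mult_left_mono add_mono) auto
    also have "\<dots> = (2 * 4 powr P * C) * B" by simp
    finally show ?thesis .
  qed
  then show ?thesis using C by (intro exI[of _ "2 * 4 powr P * C"]) auto
qed

section \<open>Pointwise bounds for spherical averages\<close>

text \<open>Hoelder's inequality is applied to the \<open>n\<close> factors \<open>(h_i h_{i+1})^{1/2}\<close> with cyclic indices.\<close>

lemma sphere_product_bound:
  fixes n :: nat
  assumes n: "n \<ge> 5"
  shows "\<exists>C>0. \<forall>N lam h. 1 \<le> N \<longrightarrow> 0 \<le> lam \<longrightarrow> lam < (int N + 1)\<^sup>2 \<longrightarrow> (\<forall>i m. 0 \<le> h i m) \<longrightarrow>
     (\<Sum>x\<in>sphere_pts n lam. \<Prod>i<n. h i (x i)) \<le> C * real N powr (real n - 10/3) *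
        (\<Prod>i<n. (\<Sum>m\<in>{-int N..int N}. h i m powr (3 * real n / 4)) powr (4 / (3 * real n)))"
proof -
  obtain C where C: "C > 0" and C': "\<forall>N lam i0 i1 F G. 1 \<le> N \<longrightarrow> 0 \<le> lam \<longrightarrow> lam < (int N + 1)\<^sup>2 \<longrightarrow> i0 < n \<longrightarrow> i1 < n \<longrightarrow> i0 \<noteq> i1 \<longrightarrow>
     (\<forall>m. 0 \<le> F m) \<longrightarrow> (\<forall>m. 0 \<le> G m) \<longrightarrow>
     (\<Sum>x\<in>sphere_pts n lam. F (x i0) * G (x i1)) \<le> C * real N powr (real n - 10/3) *
        ((\<Sum>m\<in>{-int N..int N}. F m powr (3/2)) powr (2/3) * (\<Sum>m\<in>{-int N..int N}. G m powr (3/2)) powr (2/3))"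
    using sphere_pair_bound[OF n] by (elim exE conjE) (rule that; assumption)
  have "(\<Sum>x\<in>sphere_pts n lam. \<Prod>i<n. h i (x i)) \<le> C * real N powr (real n - 10/3) *
        (\<Prod>i<n. (\<Sum>m\<in>{-int N..int N}. h i m powr (3 * real n / 4)) powr (4 / (3 * real n)))"
    if N: "1 \<le> N" and lam: "0 \<le> lam" "lam < (int N + 1)\<^sup>2" and h: "\<And>i m. 0 \<le> h i m" for N lam h
  proof -
    define D where "D = C * real N powr (real n - 10/3)"
    have D: "0 \<le> D" using C by (simp add: D_def)
    define s where "s = (\<lambda>i. \<Sum>m\<in>{-int N..int N}. h i m powr (3 * real n / 4))"
    \<comment> \<open>Cyclic successor: each coordinate occurs in exactly two factors, always next
      to a different coordinate, as the bound for pairs requires.\<close>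
    define \<sigma> where "\<sigma> = (\<lambda>i. Suc i mod n)"
    have \<sigma>n: "\<sigma> i < n" for i using n by (simp add: \<sigma>_def)
    have \<sigma>i: "\<sigma> i \<noteq> i" if "i < n" for i using n that by (cases "Suc i = n") (auto simp: \<sigma>_def)
    have bij: "bij_betw \<sigma> {..<n} {..<n}"
    proof -
      have "inj_on \<sigma> {..<n}"
      proof (rule inj_onI)
        fix i j assume ij: "i \<in> {..<n}" "j \<in> {..<n}" "\<sigma> i = \<sigma> j"
        show "i = j"
        proof (cases "Suc i = n"; cases "Suc j = n")
        qed (use ij in \<open>auto simp: \<sigma>_def\<close>)
      qed
      then show ?thesis unfolding bij_betw_def using \<sigma>n by (intro conjI endo_inj_surj) auto
    qed
    define H where "H = (\<lambda>i (x :: nat \<Rightarrow> int). h i (x i) powr (1/2) * h (\<sigma> i) (x (\<sigma> i)) powr (1/2))"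
    have prodH: "(\<Prod>i<n. H i x) = (\<Prod>i<n. h i (x i))" for x
    proof -
      have "(\<Prod>i<n. H i x) = (\<Prod>i<n. h i (x i) powr (1/2)) * (\<Prod>i<n. h (\<sigma> i) (x (\<sigma> i)) powr (1/2))"
        by (simp add: H_def prod.distrib)
      also have "(\<Prod>i<n. h (\<sigma> i) (x (\<sigma> i)) powr (1/2)) = (\<Prod>i<n. h i (x i) powr (1/2))"
        by (rule prod.reindex_bij_betw[OF bij])
      also have "(\<Prod>i<n. h i (x i) powr (1/2)) * (\<Prod>i<n. h i (x i) powr (1/2)) = (\<Prod>i<n. h i (x i) powr (1/2) * h i (x i) powr (1/2))"
        by (simp add: prod.distrib)
      also have "\<dots> = (\<Prod>i<n. h i (x i))" using h by (intro prod.cong) (auto simp: powr_half_sqrt)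
      finally show ?thesis .
    qed
    \<comment> \<open>The n-th power turns h^{1/2} into h^{n/2}, whose l^{3/2} sum in the bound for
      pairs involves h^{3n/4}.\<close>
    have Hn: "H i x ^ n = h i (x i) powr (real n / 2) * h (\<sigma> i) (x (\<sigma> i)) powr (real n / 2)" for i x
    proof -
      have "(z powr (1/2)) ^ n = z powr (real n / 2)" for z :: real
        using n by (cases "z = 0") (simp_all add: powr_power)
      then show ?thesis by (simp add: H_def power_mult_distrib)
    qed
    have "(\<Sum>x\<in>sphere_pts n lam. \<Prod>i<n. H i x) ^ card {..<n} \<le> (\<Prod>i<n. \<Sum>x\<in>sphere_pts n lam. H i x ^ card {..<n})"
      by (intro generalized_Holder finite_sphere_pts) (use n in \<open>auto simp: H_def lessThan_empty_iff\<close>)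
    then have "(\<Sum>x\<in>sphere_pts n lam. \<Prod>i<n. h i (x i)) ^ n \<le> (\<Prod>i<n. \<Sum>x\<in>sphere_pts n lam. H i x ^ n)"
      by (simp add: prodH)
    also have "\<dots> \<le> (\<Prod>i<n. D * (s i powr (2/3) * s (\<sigma> i) powr (2/3)))"
    proof (rule prod_mono)
      fix i assume "i \<in> {..<n}"
      then have i: "i < n" by simp
      have e: "(z powr (real n / 2)) powr (3/2) = z powr (3 * real n / 4)" for z :: real by (simp add: powr_powr mult.commute)
      have "(\<Sum>x\<in>sphere_pts n lam. H i x ^ n) \<le> D * (s i powr (2/3) * s (\<sigma> i) powr (2/3))"
        using C'[rule_format, OF N lam i \<sigma>n[of i] \<sigma>i[OF i, symmetric], of "\<lambda>m. h i m powr (real n / 2)" "\<lambda>m. h (\<sigma> i) m powr (real n / 2)"]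
        by (simp add: Hn D_def s_def e)
      moreover have "0 \<le> (\<Sum>x\<in>sphere_pts n lam. H i x ^ n)" by (simp add: Hn sum_nonneg)
      ultimately show "0 \<le> (\<Sum>x\<in>sphere_pts n lam. H i x ^ n) \<and> (\<Sum>x\<in>sphere_pts n lam. H i x ^ n) \<le> D * (s i powr (2/3) * s (\<sigma> i) powr (2/3))" by simp
    qed
    also have "\<dots> = D ^ n * ((\<Prod>i<n. s i powr (2/3)) * (\<Prod>i<n. s (\<sigma> i) powr (2/3)))" by (simp add: prod.distrib)
    also have "(\<Prod>i<n. s (\<sigma> i) powr (2/3)) = (\<Prod>i<n. s i powr (2/3))" by (rule prod.reindex_bij_betw[OF bij])
    also have "(\<Prod>i<n. s i powr (2/3)) * (\<Prod>i<n. s i powr (2/3)) = (\<Prod>i<n. s i powr (4 / (3 * real n))) ^ n"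
    proof -
      have "(z powr (4 / (3 * real n))) ^ n = z powr (4/3)" for z :: real
        using n by (cases "z = 0") (simp_all add: powr_power)
      moreover have "z powr (2/3) * z powr (2/3) = z powr (4/3)" for z :: real by (simp add: powr_add[symmetric])
      ultimately show ?thesis by (simp add: prod.distrib[symmetric] prod_power_distrib)
    qed
    also have "D ^ n * (\<Prod>i<n. s i powr (4 / (3 * real n))) ^ n = (D * (\<Prod>i<n. s i powr (4 / (3 * real n)))) ^ n" by (simp add: power_mult_distrib)
    finally have "(\<Sum>x\<in>sphere_pts n lam. \<Prod>i<n. h i (x i)) ^ n \<le> (D * (\<Prod>i<n. s i powr (4 / (3 * real n)))) ^ n" .
    moreover have "0 \<le> (\<Sum>x\<in>sphere_pts n lam. \<Prod>i<n. h i (x i))" using h by (intro sum_nonneg prod_nonneg) auto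
    moreover have "0 \<le> D * (\<Prod>i<n. s i powr (4 / (3 * real n)))" using D by (intro mult_nonneg_nonneg prod_nonneg) auto
    ultimately have "(\<Sum>x\<in>sphere_pts n lam. \<Prod>i<n. h i (x i)) \<le> D * (\<Prod>i<n. s i powr (4 / (3 * real n)))"
      using n by (subst (asm) power_mono_iff) auto
    then show ?thesis by (simp only: D_def s_def)
  qed
  then show ?thesis using C by (intro exI[of _ C]) auto
qed

lemma norm_sph_avg_le:
  "norm (sph_avg n lam f y) \<le> (\<Sum>x\<in>sphere_pts n lam. \<Prod>i<n. norm (f i (y - x i))) / real (r_count n lam)"
proof -
  have "norm (sph_avg n lam f y) = norm (\<Sum>x\<in>sphere_pts n lam. \<Prod>i<n. f i (y - x i)) / real (r_count n lam)"
    by (simp add: sph_avg_def norm_mult norm_divide)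
  also have "\<dots> \<le> (\<Sum>x\<in>sphere_pts n lam. norm (\<Prod>i<n. f i (y - x i))) / real (r_count n lam)"
    by (intro divide_right_mono norm_sum) simp
  finally show ?thesis by (simp add: prod_norm)
qed

lemma int_sqrt_exists:
  fixes lam :: int
  assumes "1 \<le> lam"
  shows "\<exists>N::nat. 1 \<le> N \<and> (int N)\<^sup>2 \<le> lam \<and> lam < (int N + 1)\<^sup>2"
proof -
  define N where "N = nat \<lfloor>sqrt (real_of_int lam)\<rfloor>"
  have s: "1 \<le> sqrt (real_of_int lam)" using assms by simp
  then have N: "real N \<le> sqrt (real_of_int lam)" "sqrt (real_of_int lam) < real N + 1" "1 \<le> N"
    unfolding N_def by (linarith, linarith, simp add: le_nat_iff le_floor_iff)
  have "(real N)\<^sup>2 \<le> (sqrt (real_of_int lam))\<^sup>2" using N by (intro power_mono) auto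
  then have "(real N)\<^sup>2 \<le> real_of_int lam" using assms by simp
  moreover have "(sqrt (real_of_int lam))\<^sup>2 < (real N + 1)\<^sup>2" using N s by (intro power_strict_mono) auto
  then have "real_of_int lam < (real N + 1)\<^sup>2" using assms by simp
  moreover have "(real N)\<^sup>2 = real_of_int ((int N)\<^sup>2)" "(real N + 1)\<^sup>2 = real_of_int ((int N + 1)\<^sup>2)" by simp_all
  ultimately have "(int N)\<^sup>2 \<le> lam" "lam < (int N + 1)\<^sup>2" by (metis of_int_le_iff, metis of_int_less_iff)
  then show ?thesis using N(3) by blast
qed

text \<open>The powers of N match exactly: N^{n - 10/3} divided by the lower bound N^{n-2} for the
  sphere is N^{-4/3}, which supplies each of the n sums with the factor N^{-4/(3n)} that makes it a
  mean.\<close>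

lemma sph_avg_pointwise_bound:
  fixes n :: nat
  assumes n: "n \<ge> 5"
  shows "\<exists>K>0. \<forall>lam f y. 1 \<le> lam \<longrightarrow> (\<exists>N::nat. 1 \<le> N \<and> norm (sph_avg n lam f y) \<le>
     K * (\<Prod>i<n. ((\<Sum>m\<in>{-int N..int N}. norm (f i (y - m)) powr (3 * real n / 4)) / real N) powr (4 / (3 * real n))))"
proof -
  define e where "e = 4 / (3 * real n)"
  obtain C where C: "C > 0" and C': "\<forall>N lam h. 1 \<le> N \<longrightarrow> 0 \<le> lam \<longrightarrow> lam < (int N + 1)\<^sup>2 \<longrightarrow> (\<forall>i m. 0 \<le> h i m) \<longrightarrow>
     (\<Sum>x\<in>sphere_pts n lam. \<Prod>i<n. h i (x i)) \<le> C * real N powr (real n - 10/3) *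
        (\<Prod>i<n. (\<Sum>m\<in>{-int N..int N}. h i m powr (3 * real n / 4)) powr e)"
    using sphere_product_bound[OF n, folded e_def] by (elim exE conjE) (rule that; assumption)
  obtain c where c: "c > 0" and c': "\<forall>N::nat. \<forall>lam. 1 \<le> N \<longrightarrow> (int N)\<^sup>2 \<le> lam \<longrightarrow> c * real N ^ (n - 2) \<le> real (r_count n lam)"
    using r_count_ge[OF n] by (elim exE conjE) (rule that; assumption)
  have "\<exists>N::nat. 1 \<le> N \<and> norm (sph_avg n lam f y) \<le>
     (C / c) * (\<Prod>i<n. ((\<Sum>m\<in>{-int N..int N}. norm (f i (y - m)) powr (3 * real n / 4)) / real N) powr e)" if lam: "1 \<le> lam" for lam f y
  proof -
    obtain N where N: "1 \<le> N" "(int N)\<^sup>2 \<le> lam" "lam < (int N + 1)\<^sup>2" using int_sqrt_exists[OF lam] by blast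
    define s where "s = (\<lambda>i. \<Sum>m\<in>{-int N..int N}. norm (f i (y - m)) powr (3 * real n / 4))"
    have s0: "0 \<le> s i" for i by (simp add: s_def sum_nonneg)
    have r: "c * real N ^ (n - 2) \<le> real (r_count n lam)" using c' N by blast
    have r0: "0 < c * real N ^ (n - 2)" using c N by simp
    have "norm (sph_avg n lam f y) \<le> (\<Sum>x\<in>sphere_pts n lam. \<Prod>i<n. norm (f i (y - x i))) / real (r_count n lam)"
      by (rule norm_sph_avg_le)
    also have "\<dots> \<le> (C * real N powr (real n - 10/3) * (\<Prod>i<n. s i powr e)) / (c * real N ^ (n - 2))"
    proof (rule frac_le)
      show "(\<Sum>x\<in>sphere_pts n lam. \<Prod>i<n. norm (f i (y - x i))) \<le> C * real N powr (real n - 10/3) * (\<Prod>i<n. s i powr e)"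
        using C'[rule_format, of N lam "\<lambda>i m. norm (f i (y - m))"] N lam by (simp add: s_def)
      show "0 \<le> C * real N powr (real n - 10/3) * (\<Prod>i<n. s i powr e)" using C by (intro mult_nonneg_nonneg prod_nonneg) auto
    qed (use r r0 in auto)
    also have "\<dots> = (C / c) * (\<Prod>i<n. (s i / real N) powr e)"
    proof -
      have "(\<Prod>i<n. (s i / real N) powr e) = (\<Prod>i<n. s i powr e * real N powr (-e))"
        using s0 by (intro prod.cong) (auto simp: powr_divide powr_minus_divide)
      also have "\<dots> = (\<Prod>i<n. s i powr e) * real N powr (-(4/3))"
      proof -
        have "(real N powr (-e)) ^ n = real N powr (-(4/3))" using N n by (simp add: powr_power e_def)
        then show ?thesis by (simp add: prod.distrib)
      qed
      finally have 1: "(\<Prod>i<n. (s i / real N) powr e) = (\<Prod>i<n. s i powr e) * real N powr (-(4/3))" .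
      have "real N powr (real n - 10/3) = real N powr (-(4/3) + (real n - 2))" by simp
      also have "\<dots> = real N powr (-(4/3)) * real N powr (real n - 2)" by (rule powr_add)
      also have "real N powr (real n - 2) = real N ^ (n - 2)" using N n by (simp add: powr_realpow[symmetric] of_nat_diff)
      finally show ?thesis unfolding 1 using N c by simp
    qed
    finally show ?thesis using N by (auto simp: s_def)
  qed
  then show ?thesis using C c unfolding e_def by (intro exI[of _ "C / c"]) auto
qed

text \<open>Letting \<open>lam\<close> depend on y takes care of the supremum. Hoelder in y
  separates the n functions, and the maximal theorem with exponent 4q/3 is applied to |f_i|^{3n/4},
  which produces |f_i|^{nq}. Only finite sums occur; the numbers \<open>B i\<close> stand for the
  norms.\<close>

lemma maximal_average_sum_bound:
  fixes n :: nat and q :: real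
  assumes n: "n \<ge> 5" and q: "1 \<le> q"
  shows "\<exists>K>0. \<forall>f Y lam B. finite Y \<longrightarrow> (\<forall>y\<in>Y. 1 \<le> lam y) \<longrightarrow>
     (\<forall>i<n. \<forall>Z. finite Z \<longrightarrow> (\<Sum>m\<in>Z. norm (f i m) powr (real n * q)) \<le> B i) \<longrightarrow>
     (\<Sum>y\<in>Y. norm (sph_avg n (lam y) f y) powr q) \<le> K * (\<Prod>i<n. B i powr (1 / real n))"
proof -
  obtain K where K: "K > 0" and K': "\<forall>lam f y. 1 \<le> lam \<longrightarrow> (\<exists>N::nat. 1 \<le> N \<and> norm (sph_avg n lam f y) \<le>
     K * (\<Prod>i<n. ((\<Sum>m\<in>{-int N..int N}. norm (f i (y - m)) powr (3 * real n / 4)) / real N) powr (4 / (3 * real n))))"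
    using sph_avg_pointwise_bound[OF n] by (elim exE conjE) (rule that; assumption)
  have P: "4 * q / 3 > 1" using q by simp
  obtain C where C: "C > 0" and C': "\<forall>(g :: int \<Rightarrow> real) (N :: int \<Rightarrow> nat) Y B. finite Y \<longrightarrow> (\<forall>m. 0 \<le> g m) \<longrightarrow> (\<forall>y\<in>Y. 1 \<le> N y) \<longrightarrow>
     (\<forall>Z. finite Z \<longrightarrow> (\<Sum>m\<in>Z. g m powr (4 * q / 3)) \<le> B) \<longrightarrow>
     (\<Sum>y\<in>Y. ((\<Sum>m\<in>{-int (N y)..int (N y)}. g (y - m)) / real (N y)) powr (4 * q / 3)) \<le> C * B"
    using maximal_strong_type[OF P] by (elim exE conjE) (rule that; assumption)
  have "(\<Sum>y\<in>Y. norm (sph_avg n (lam y) f y) powr q) \<le> (K powr q * C) * (\<Prod>i<n. B i powr (1 / real n))"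
    if Y: "finite Y" and lam: "\<forall>y\<in>Y. 1 \<le> lam y" 
      and B: "\<forall>i<n. \<forall>Z. finite Z \<longrightarrow> (\<Sum>m\<in>Z. norm (f i m) powr (real n * q)) \<le> B i" for f Y lam B
  proof -
    have B0: "0 \<le> B i" if "i < n" for i using B[rule_format, OF that, of "{}"] by simp
    have "\<forall>y\<in>Y. \<exists>N::nat. 1 \<le> N \<and> norm (sph_avg n (lam y) f y) \<le>
       K * (\<Prod>i<n. ((\<Sum>m\<in>{-int N..int N}. norm (f i (y - m)) powr (3 * real n / 4)) / real N) powr (4 / (3 * real n)))"
      using K' lam by blast
    then obtain N :: "int \<Rightarrow> nat" where N: "\<forall>y\<in>Y. 1 \<le> N y \<and> norm (sph_avg n (lam y) f y) \<le>
       K * (\<Prod>i<n. ((\<Sum>m\<in>{-int (N y)..int (N y)}. norm (f i (y - m)) powr (3 * real n / 4)) / real (N y)) powr (4 / (3 * real n)))"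
      by (rule bchoice[THEN exE])
    define a where "a = (\<lambda>i y. (\<Sum>m\<in>{-int (N y)..int (N y)}. norm (f i (y - m)) powr (3 * real n / 4)) / real (N y))"
    have a0: "0 \<le> a i y" for i y by (simp add: a_def sum_nonneg)
    define u where "u = (\<lambda>i y. a i y powr (4 * q / (3 * real n)))"
    have un: "u i y ^ n = a i y powr (4 * q / 3)" for i y
      using n q by (cases "a i y = 0") (simp_all add: u_def powr_power)
    have "norm (sph_avg n (lam y) f y) powr q \<le> K powr q * (\<Prod>i<n. u i y)" if y: "y \<in> Y" for y
    proof -
      have "norm (sph_avg n (lam y) f y) powr q \<le> (K * (\<Prod>i<n. a i y powr (4 / (3 * real n)))) powr q"
        using N y q by (intro powr_mono2) (auto simp: a_def)
      also have "\<dots> = K powr q * (\<Prod>i<n. a i y powr (4 / (3 * real n))) powr q" by (simp add: powr_mult)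
      also have "(\<Prod>i<n. a i y powr (4 / (3 * real n))) powr q = (\<Prod>i<n. u i y)"
        by (simp add: prod_powr_distrib u_def powr_powr)
      finally show ?thesis .
    qed
    then have "(\<Sum>y\<in>Y. norm (sph_avg n (lam y) f y) powr q) \<le> (\<Sum>y\<in>Y. K powr q * (\<Prod>i<n. u i y))" by (rule sum_mono)
    also have "\<dots> = K powr q * (\<Sum>y\<in>Y. \<Prod>i<n. u i y)" by (simp add: sum_distrib_left)
    also have "\<dots> \<le> K powr q * (C * (\<Prod>i<n. B i powr (1 / real n)))"
    proof (rule mult_left_mono)
      have "(\<Sum>y\<in>Y. \<Prod>i<n. u i y) ^ card {..<n} \<le> (\<Prod>i<n. \<Sum>y\<in>Y. u i y ^ card {..<n})"
        by (intro generalized_Holder) (use n Y in \<open>auto simp: u_def lessThan_empty_iff\<close>)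
      then have "(\<Sum>y\<in>Y. \<Prod>i<n. u i y) ^ n \<le> (\<Prod>i<n. \<Sum>y\<in>Y. a i y powr (4 * q / 3))" by (simp add: un)
      also have "\<dots> \<le> (\<Prod>i<n. C * B i)"
      proof (rule prod_mono)
        fix i assume "i \<in> {..<n}"
        then have i: "i < n" by simp
        have e: "(norm (f i m) powr (3 * real n / 4)) powr (4 * q / 3) = norm (f i m) powr (real n * q)" for m
          by (simp add: powr_powr mult.commute)
        have "(\<Sum>y\<in>Y. a i y powr (4 * q / 3)) \<le> C * B i"
          unfolding a_def
          by (rule C'[rule_format, where g = "\<lambda>m. norm (f i m) powr (3 * real n / 4)"]) (use Y N B i e in auto)
        then show "0 \<le> (\<Sum>y\<in>Y. a i y powr (4 * q / 3)) \<and> (\<Sum>y\<in>Y. a i y powr (4 * q / 3)) \<le> C * B i"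
          by (simp add: sum_nonneg)
      qed
      also have "\<dots> = C ^ n * (\<Prod>i<n. B i)" by (simp add: prod.distrib)
      also have "(\<Prod>i<n. B i) = (\<Prod>i<n. B i powr (1 / real n)) ^ n"
        unfolding prod_power_distrib
      proof (rule prod.cong[OF refl])
        fix i assume "i \<in> {..<n}"
        then have "0 \<le> B i" using B0 by simp
        then show "B i = (B i powr (1 / real n)) ^ n" using n by (cases "B i = 0") (simp_all add: powr_power)
      qed
      also have "C ^ n * (\<Prod>i<n. B i powr (1 / real n)) ^ n = (C * (\<Prod>i<n. B i powr (1 / real n))) ^ n" by (simp add: power_mult_distrib)
      finally have "(\<Sum>y\<in>Y. \<Prod>i<n. u i y) ^ n \<le> (C * (\<Prod>i<n. B i powr (1 / real n))) ^ n" .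
      moreover have "0 \<le> (\<Sum>y\<in>Y. \<Prod>i<n. u i y)" by (intro sum_nonneg prod_nonneg) (auto simp: u_def)
      moreover have "0 \<le> C * (\<Prod>i<n. B i powr (1 / real n))" using C by (intro mult_nonneg_nonneg prod_nonneg) auto
      ultimately show "(\<Sum>y\<in>Y. \<Prod>i<n. u i y) \<le> C * (\<Prod>i<n. B i powr (1 / real n))"
        using n by (subst (asm) power_mono_iff) auto
    qed simp
    finally show ?thesis by (simp add: mult.assoc)
  qed
  then show ?thesis using K C by (intro exI[of _ "K powr q * C"]) auto
qed

section \<open>The maximal operator\<close>

lemma norm_sph_avg_le_prod:
  assumes b: "\<And>i m. i < n \<Longrightarrow> norm (f i m) \<le> b i"
  shows "norm (sph_avg n lam f y) \<le> (\<Prod>i<n. b i)"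
proof -
  have b0: "0 \<le> b i" if "i < n" for i using b[OF that, of 0] norm_ge_zero order_trans by blast
  have "norm (sph_avg n lam f y) \<le> (\<Sum>x\<in>sphere_pts n lam. \<Prod>i<n. norm (f i (y - x i))) / real (r_count n lam)"
    by (rule norm_sph_avg_le)
  also have "\<dots> \<le> (\<Sum>x\<in>sphere_pts n lam. \<Prod>i<n. b i) / real (r_count n lam)"
    using b by (intro divide_right_mono sum_mono prod_mono) auto
  also have "\<dots> = real (r_count n lam) * (\<Prod>i<n. b i) / real (r_count n lam)" by (simp add: r_count_def)
  also have "\<dots> \<le> (\<Prod>i<n. b i)" using b0 by (cases "r_count n lam = 0") (auto intro: prod_nonneg)
  finally show ?thesis .
qed

text \<open>A real supremum is meaningful only for sets bounded above, so bounds on the f_i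
  accompany the facts about \<open>sph_max\<close>; membership in l^p provides them.\<close>

lemma sph_max_bdd_above:
  assumes "\<And>i m. i < n \<Longrightarrow> norm (f i m) \<le> b i"
  shows "bdd_above ((\<lambda>lam. norm (sph_avg n lam f y)) ` {1..})"
  using norm_sph_avg_le_prod[OF assms] by (intro bdd_aboveI2[where M = "\<Prod>i<n. b i"])

lemma norm_sph_avg_le_sph_max:
  assumes "\<And>i m. i < n \<Longrightarrow> norm (f i m) \<le> b i" "1 \<le> lam"
  shows "norm (sph_avg n lam f y) \<le> sph_max n f y"
  unfolding sph_max_def using assms(2) by (intro cSUP_upper sph_max_bdd_above[OF assms(1)]) auto

lemma sph_max_nonneg:
  assumes "\<And>i m. i < n \<Longrightarrow> norm (f i m) \<le> b i"
  shows "0 \<le> sph_max n f y"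
proof -
  have "norm (sph_avg n 1 f y) \<le> sph_max n f y" by (rule norm_sph_avg_le_sph_max[OF assms]) auto
  then show ?thesis using norm_ge_zero order_trans by blast
qed

text \<open>The factor 2 leaves room below a positive supremum, so no radius has to attain it. This
  is how a radius is selected for each y.\<close>

lemma sph_max_nearly_attained:
  assumes b: "\<And>i m. i < n \<Longrightarrow> norm (f i m) \<le> b i"
  shows "\<exists>lam\<ge>1. sph_max n f y \<le> 2 * norm (sph_avg n lam f y)"
proof (cases "sph_max n f y = 0")
  case True
  then show ?thesis by (intro exI[of _ 1]) auto
next
  case False
  then have "sph_max n f y / 2 < sph_max n f y" using sph_max_nonneg[of n f b y] b by (simp add: order_less_le)
  then have "sph_max n f y / 2 < (SUP lam\<in>{1..}. norm (sph_avg n lam f y))" by (simp add: sph_max_def)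
  moreover have "bdd_above ((\<lambda>lam. norm (sph_avg n lam f y)) ` {1..})" by (rule sph_max_bdd_above) (rule b)
  ultimately have "\<exists>lam\<in>{1..}. sph_max n f y / 2 < norm (sph_avg n lam f y)"
    by (subst (asm) less_cSUP_iff) auto
  then obtain lam where "1 \<le> lam" "sph_max n f y / 2 < norm (sph_avg n lam f y)" by auto
  then show ?thesis by (intro exI[of _ lam]) auto
qed

text \<open>Everything is reduced to l^{nq} by |f|^{nq} <= |f|^p T^{nq - p}, where T is the l^p norm
  of f and bounds |f| pointwise.\<close>

lemma sph_max_bounded:
  fixes n :: nat and q p :: real
  assumes n: "n \<ge> 5" and q: "1 \<le> q" and p: "1 \<le> p" "p \<le> real n * q"
  shows "\<exists>C::real. \<forall>f :: nat \<Rightarrow> int \<Rightarrow> complex. (\<forall>i<n. in_lp (ereal p) (f i)) \<longrightarrow>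
     in_lp (ereal q) (sph_max n f) \<and> lp_norm (ereal q) (sph_max n f) \<le> C * (\<Prod>i<n. lp_norm (ereal p) (f i))"
proof -
  obtain K where K: "K > 0" and K': "\<forall>f Y lam B. finite Y \<longrightarrow> (\<forall>y\<in>Y. 1 \<le> lam y) \<longrightarrow>
     (\<forall>i<n. \<forall>Z. finite Z \<longrightarrow> (\<Sum>m\<in>Z. norm (f i m) powr (real n * q)) \<le> B i) \<longrightarrow>
     (\<Sum>y\<in>Y. norm (sph_avg n (lam y) f y) powr q) \<le> K * (\<Prod>i<n. B i powr (1 / real n))"
    using maximal_average_sum_bound[OF n q] by (elim exE conjE) (rule that; assumption)
  have main: "in_lp (ereal q) (sph_max n f) \<and> lp_norm (ereal q) (sph_max n f) \<le> (2 powr q * K) powr (1 / q) * (\<Prod>i<n. lp_norm (ereal p) (f i))"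
    if f: "\<forall>i<n. in_lp (ereal p) (f i)" for f :: "nat \<Rightarrow> int \<Rightarrow> complex"
  proof -
    define S where "S = (\<lambda>i. \<Sum>\<^sub>\<infinity>m. norm (f i m) powr p)"
    have S0: "0 \<le> S i" for i unfolding S_def by (intro infsum_nonneg) simp
    have sm: "(\<lambda>m. norm (f i m) powr p) summable_on UNIV" if "i < n" for i using f that by (simp add: in_lp_def)
    have fin: "(\<Sum>m\<in>Z. norm (f i m) powr p) \<le> S i" if "i < n" "finite Z" for i Z
      unfolding S_def using that by (intro finite_sum_le_infsum sm) auto
    have b: "norm (f i m) \<le> S i powr (1 / p)" if "i < n" for i m
    proof -
      have "norm (f i m) powr p \<le> S i" using fin[OF that, of "{m}"] by simp
      then have "(norm (f i m) powr p) powr (1 / p) \<le> S i powr (1 / p)" using p by (intro powr_mono2) auto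
      then show ?thesis using p by (simp add: powr_powr)
    qed
    \<comment> \<open>\<open>S i\<close> is the p-th power of the l^p norm, so \<open>B i\<close> is
      the norm to the power nq, and its n-th root is the norm to the power q.\<close>
    define B where "B = (\<lambda>i. S i powr (real n * q / p))"
    have B: "\<forall>i<n. \<forall>Z. finite Z \<longrightarrow> (\<Sum>m\<in>Z. norm (f i m) powr (real n * q)) \<le> B i"
    proof (intro allI impI)
      fix i and Z :: "int set" assume i: "i < n" and Z: "finite Z"
      have "(\<Sum>m\<in>Z. norm (f i m) powr (real n * q)) \<le> (\<Sum>m\<in>Z. norm (f i m) powr p * S i powr ((real n * q - p) / p))"
      proof (rule sum_mono)
        fix m
        have "norm (f i m) powr (real n * q) = norm (f i m) powr p * norm (f i m) powr (real n * q - p)"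
          by (simp add: powr_add[symmetric])
        also have "norm (f i m) powr (real n * q - p) \<le> (S i powr (1 / p)) powr (real n * q - p)"
          using b[OF i] p by (intro powr_mono2) auto
        also have "(S i powr (1 / p)) powr (real n * q - p) = S i powr ((real n * q - p) / p)" by (simp add: powr_powr)
        finally show "norm (f i m) powr (real n * q) \<le> norm (f i m) powr p * S i powr ((real n * q - p) / p)"
          by (simp add: mult_left_mono)
      qed
      also have "\<dots> = (\<Sum>m\<in>Z. norm (f i m) powr p) * S i powr ((real n * q - p) / p)" by (simp add: sum_distrib_right)
      also have "\<dots> \<le> S i * S i powr ((real n * q - p) / p)" by (intro mult_right_mono fin i Z) simp
      also have "\<dots> = B i" using powr_mult_base[OF S0, of i "(real n * q - p) / p"] p by (simp add: B_def diff_divide_distrib)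
      finally show "(\<Sum>m\<in>Z. norm (f i m) powr (real n * q)) \<le> B i" .
    qed
    have "\<forall>y. \<exists>lam\<ge>1. sph_max n f y \<le> 2 * norm (sph_avg n lam f y)"
      using sph_max_nearly_attained[of n f "\<lambda>i. S i powr (1 / p)"] b by blast
    then obtain lam where lam: "\<forall>y. 1 \<le> lam y \<and> sph_max n f y \<le> 2 * norm (sph_avg n (lam y) f y)" by metis
    have pos: "0 \<le> sph_max n f y" for y by (rule sph_max_nonneg[of n f "\<lambda>i. S i powr (1 / p)"]) (rule b)
    define R where "R = 2 powr q * K * (\<Prod>i<n. S i powr (q / p))"
    have R: "(\<Sum>y\<in>Y. norm (sph_max n f y) powr q) \<le> R" if Y: "finite Y" for Y
    proof -
      have "(\<Sum>y\<in>Y. norm (sph_max n f y) powr q) \<le> (\<Sum>y\<in>Y. 2 powr q * norm (sph_avg n (lam y) f y) powr q)"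
      proof (rule sum_mono)
        fix y
        have "norm (sph_max n f y) powr q \<le> (2 * norm (sph_avg n (lam y) f y)) powr q"
          using lam pos q by (intro powr_mono2) auto
        then show "norm (sph_max n f y) powr q \<le> 2 powr q * norm (sph_avg n (lam y) f y) powr q" by (simp add: powr_mult)
      qed
      also have "\<dots> = 2 powr q * (\<Sum>y\<in>Y. norm (sph_avg n (lam y) f y) powr q)" by (simp add: sum_distrib_left)
      also have "\<dots> \<le> 2 powr q * (K * (\<Prod>i<n. B i powr (1 / real n)))"
        using K'[rule_format, OF Y, of lam f B] lam B by (intro mult_left_mono) auto
      also have "(\<Prod>i<n. B i powr (1 / real n)) = (\<Prod>i<n. S i powr (q / p))"
        using n by (intro prod.cong) (auto simp: B_def powr_powr)
      finally show ?thesis by (simp add: R_def)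
    qed
    have summ: "(\<lambda>y. norm (sph_max n f y) powr q) summable_on UNIV"
      using R by (intro nonneg_bdd_above_summable_on bdd_aboveI2[where M = R]) auto
    have "(\<Sum>\<^sub>\<infinity>y. norm (sph_max n f y) powr q) \<le> R" using R by (intro infsum_le_finite_sums summ) auto
    then have "(\<Sum>\<^sub>\<infinity>y. norm (sph_max n f y) powr q) powr (1 / q) \<le> R powr (1 / q)"
      using q by (intro powr_mono2 infsum_nonneg) auto
    also have "R powr (1 / q) = (2 powr q * K) powr (1 / q) * (\<Prod>i<n. S i powr (1 / p))"
      using q unfolding R_def powr_mult prod_powr_distrib by (simp add: powr_powr prod_powr_distrib)
    finally show ?thesis using summ by (simp add: in_lp_def lp_norm_def S_def)
  qed
  show ?thesis by (rule exI[of _ "(2 powr q * K) powr (1 / q)"]) (use main in blast)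
qed

section \<open>Necessity of n >= 5 and p <= nq\<close>

lemma eight_dvd_sum_squares_even:
  fixes a b c d :: int
  assumes "8 dvd a\<^sup>2 + b\<^sup>2 + c\<^sup>2 + d\<^sup>2"
  shows "even a"
proof (rule ccontr)
  assume "odd a"
  then have "a\<^sup>2 mod 8 = 1" by (rule odd_square_mod_8)
  have sq: "x\<^sup>2 mod 8 \<in> {0, 1, 4}" for x :: int
  proof (cases "even x")
    case True
    then obtain k where k: "x = 2 * k" by (elim evenE)
    have "x\<^sup>2 = 4 * k\<^sup>2" by (simp add: k power_mult_distrib)
    moreover have "(4 * w) mod 8 \<in> {0, 4}" for w :: int by simp presburger
    ultimately show ?thesis by auto
  qed (simp add: odd_square_mod_8)
  have "a\<^sup>2 + b\<^sup>2 + c\<^sup>2 + d\<^sup>2 = 8 * (a\<^sup>2 div 8 + b\<^sup>2 div 8 + c\<^sup>2 div 8 + d\<^sup>2 div 8) + (a\<^sup>2 mod 8 + b\<^sup>2 mod 8 + c\<^sup>2 mod 8 + d\<^sup>2 mod 8)"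
    using mult_div_mod_eq[of 8 "a\<^sup>2"] mult_div_mod_eq[of 8 "b\<^sup>2"] mult_div_mod_eq[of 8 "c\<^sup>2"] mult_div_mod_eq[of 8 "d\<^sup>2"]
    unfolding distrib_left by linarith
  then have "8 dvd a\<^sup>2 mod 8 + b\<^sup>2 mod 8 + c\<^sup>2 mod 8 + d\<^sup>2 mod 8"
    using assms by (metis dvd_add_right_iff dvd_triv_left)
  \<comment> \<open>The other three residues, taken from {0, 1, 4}, would have to add up to 7, which
    is impossible.\<close>
  then show False using \<open>a\<^sup>2 mod 8 = 1\<close> sq[of b] sq[of c] sq[of d] by auto
qed

text \<open>If m is even, then 8 divides 4m and all coordinates on the sphere of 4m are even, so
  halving maps it injectively into the sphere of m.\<close>

lemma r_count_4_mult_4_le: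
  assumes "even m"
  shows "r_count 4 (4 * m) \<le> r_count 4 m"
  unfolding r_count_def
proof (rule card_inj_on_le[where f = "\<lambda>x i. x i div 2"])
  have four: "{..<4::nat} = {0, 1, 2, 3}" by auto
  have ev: "even (x i)" if x: "x \<in> sphere_pts 4 (4 * m)" for x i
  proof (cases "i < 4")
    case True
    have s: "(x 0)\<^sup>2 + (x 1)\<^sup>2 + (x 2)\<^sup>2 + (x 3)\<^sup>2 = 4 * m" using x by (simp add: sphere_pts_def four)
    have d: "8 dvd 4 * m" using assms by auto
    have "even (x 0)" by (rule eight_dvd_sum_squares_even[of _ "x 1" "x 2" "x 3"]) (use s d in simp)
    moreover have "even (x 1)" by (rule eight_dvd_sum_squares_even[of _ "x 0" "x 2" "x 3"]) (use s d in \<open>simp add: ac_simps\<close>)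
    moreover have "even (x 2)" by (rule eight_dvd_sum_squares_even[of _ "x 0" "x 1" "x 3"]) (use s d in \<open>simp add: ac_simps\<close>)
    moreover have "even (x 3)" by (rule eight_dvd_sum_squares_even[of _ "x 0" "x 1" "x 2"]) (use s d in \<open>simp add: ac_simps\<close>)
    moreover have "i = 0 \<or> i = 1 \<or> i = 2 \<or> i = 3" using True by linarith
    ultimately show ?thesis by blast
  qed (use x in \<open>simp add: sphere_pts_def\<close>)
  show "inj_on (\<lambda>x i. x i div 2) (sphere_pts 4 (4 * m))"
  proof (rule inj_onI)
    fix x y assume xy: "x \<in> sphere_pts 4 (4 * m)" "y \<in> sphere_pts 4 (4 * m)" "(\<lambda>i. x i div 2) = (\<lambda>i. y i div 2)"
    show "x = y"
    proof
      fix i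
      show "x i = y i" using ev[OF xy(1), of i] ev[OF xy(2), of i] fun_cong[OF xy(3), of i] by (metis dvd_mult_div_cancel)
    qed
  qed
  show "(\<lambda>x i. x i div 2) ` sphere_pts 4 (4 * m) \<subseteq> sphere_pts 4 m"
  proof (rule image_subsetI)
    fix x assume x: "x \<in> sphere_pts 4 (4 * m)"
    have "4 * (\<Sum>i<4. (x i div 2)\<^sup>2) = (\<Sum>i<4. (2 * (x i div 2))\<^sup>2)" by (simp add: sum_distrib_left power_mult_distrib)
    also have "\<dots> = (\<Sum>i<4. (x i)\<^sup>2)" using ev[OF x] by simp
    finally show "(\<lambda>i. x i div 2) \<in> sphere_pts 4 m" using x by (simp add: sphere_pts_def)
  qed
qed (rule finite_sphere_pts)

text \<open>The descent stops at 4 because halving needs an even argument; indeed r(4) = 24 exceeds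
  r(1) = 8.\<close>

lemma r_count_4_power_4_le: "r_count 4 (4 ^ Suc k) \<le> r_count 4 4"
proof (induction k)
  case (Suc k)
  have "even (4 ^ Suc k :: int)" by simp
  then have "r_count 4 (4 * 4 ^ Suc k) \<le> r_count 4 (4 ^ Suc k)" by (rule r_count_4_mult_4_le)
  then show ?case using Suc by simp
qed simp

lemma in_lp_finite_support:
  fixes f :: "int \<Rightarrow> complex"
  assumes "finite A" "\<And>x. x \<notin> A \<Longrightarrow> f x = 0"
  shows "in_lp p f"
proof (cases "p = \<infinity>")
  case True
  have "range (\<lambda>x. norm (f x)) \<subseteq> insert 0 ((\<lambda>x. norm (f x)) ` A)" using assms(2) by fastforce
  then have "bdd_above (range (\<lambda>x. norm (f x)))" using assms(1) by (meson bdd_above_finite bdd_above_mono finite_imageI finite_insert)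
  then show ?thesis using True by (simp add: in_lp_def)
next
  case False
  have "(\<lambda>x. norm (f x) powr real_of_ereal p) summable_on UNIV"
    by (rule finite_nonzero_values_imp_summable_on, rule finite_subset[OF _ assms(1)]) (use assms(2) in force)
  then show ?thesis using False by (simp add: in_lp_def)
qed

text \<open>Delta functions lie in every l^p, so one counterexample serves all p. For y = 2^k only
  the point with all four coordinates 2^k contributes, and it lies on the sphere of 4^{k+1}. The
  maximal function thus stays above a fixed positive constant at infinitely many points.\<close>

lemma sph_max_unbounded_dim_4:
  fixes q :: real and p :: ereal
  assumes q: "1 \<le> q"
  shows "\<exists>f :: nat \<Rightarrow> int \<Rightarrow> complex. (\<forall>i<4. in_lp p (f i)) \<and> \<not> in_lp (ereal q) (sph_max 4 f)"
proof -
  define f where "f = (\<lambda>(i::nat) x::int. if x = 0 then 1 else 0 :: complex)"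
  have b: "norm (f i m) \<le> 1" for i m by (simp add: f_def)
  define r where "r = real (r_count 4 4)"
  have key: "1 / r \<le> sph_max 4 f (2 ^ k)" "0 < r" for k
  proof -
    define lam where "lam = (4::int) ^ Suc k"
    define x where "x = (\<lambda>i::nat. if i < 4 then (2::int) ^ k else 0)"
    have lam1: "1 \<le> lam" unfolding lam_def by (rule one_le_power) simp
    have "((2::int) ^ k)\<^sup>2 = 4 ^ k" by (simp add: power_even_eq[symmetric] power2_eq_square flip: power_mult_distrib)
    then have x: "x \<in> sphere_pts 4 lam" by (simp add: sphere_pts_def x_def lam_def)
    have "(\<Sum>z\<in>sphere_pts 4 lam. \<Prod>i<4. f i (2 ^ k - z i)) = (\<Sum>z\<in>{x}. \<Prod>i<4. f i (2 ^ k - z i))"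
    proof (rule sum.mono_neutral_right)
      show "\<forall>z\<in>sphere_pts 4 lam - {x}. (\<Prod>i<4. f i (2 ^ k - z i)) = 0"
      proof
        fix z assume z: "z \<in> sphere_pts 4 lam - {x}"
        then obtain i where "z i \<noteq> x i" by auto
        moreover have "i < 4" using calculation z by (cases "i < 4") (auto simp: sphere_pts_def x_def)
        ultimately have "f i (2 ^ k - z i) = 0" by (auto simp: f_def x_def)
        then show "(\<Prod>i<4. f i (2 ^ k - z i)) = 0" using \<open>i < 4\<close> by (intro prod_zero) auto
      qed
    qed (use x finite_sphere_pts in auto)
    also have "\<dots> = 1" by (simp add: f_def x_def)
    finally have "norm (sph_avg 4 lam f (2 ^ k)) = 1 / real (r_count 4 lam)"
      by (simp add: sph_avg_def norm_divide)
    moreover have "norm (sph_avg 4 lam f (2 ^ k)) \<le> sph_max 4 f (2 ^ k)"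
      by (rule norm_sph_avg_le_sph_max[where b = "\<lambda>_. 1"]) (use b lam1 in auto)
    moreover have le: "real (r_count 4 lam) \<le> r" unfolding lam_def r_def using r_count_4_power_4_le[of k] by simp
    moreover have pos: "0 < real (r_count 4 lam)" using x finite_sphere_pts[of 4 lam] by (auto simp: r_count_def card_gt_0_iff)
    ultimately show "1 / r \<le> sph_max 4 f (2 ^ k)" by (metis frac_le less_eq_real_def order_trans zero_le_one order_refl)
    show "0 < r" using le pos by linarith
  qed
  have "\<not> in_lp (ereal q) (sph_max 4 f)"
  proof
    assume "in_lp (ereal q) (sph_max 4 f)"
    then have s: "(\<lambda>y. norm (sph_max 4 f y) powr q) summable_on UNIV" by (simp add: in_lp_def)
    define I where "I = (\<Sum>\<^sub>\<infinity>y. norm (sph_max 4 f y) powr q)"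
    define \<epsilon> where "\<epsilon> = (1 / r) powr q"
    have \<epsilon>: "\<epsilon> > 0" using key by (simp add: \<epsilon>_def)
    have "real m * \<epsilon> \<le> I" for m
    proof -
      have "inj_on (\<lambda>k. (2::int) ^ k) {..<m}" by (auto simp: inj_on_def)
      then have "real m * \<epsilon> = (\<Sum>y\<in>(\<lambda>k. (2::int) ^ k) ` {..<m}. \<epsilon>)" by (simp add: card_image)
      also have "\<dots> \<le> (\<Sum>y\<in>(\<lambda>k. (2::int) ^ k) ` {..<m}. norm (sph_max 4 f y) powr q)"
      proof (rule sum_mono)
        fix y assume "y \<in> (\<lambda>k. (2::int) ^ k) ` {..<m}"
        then obtain k where y: "y = 2 ^ k" by auto
        show "\<epsilon> \<le> norm (sph_max 4 f y) powr q" unfolding \<epsilon>_def y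
          using key(1)[of k] key(2) q by (intro powr_mono2) auto
      qed
      also have "\<dots> \<le> I" unfolding I_def by (intro finite_sum_le_infsum s) auto
      finally show ?thesis .
    qed
    moreover obtain m :: nat where "I / \<epsilon> < real m" using reals_Archimedean2 by blast
    ultimately show False using \<epsilon> by (metis less_le_not_le pos_divide_less_eq)
  qed
  moreover have "in_lp p (f i)" for i by (rule in_lp_finite_support[of "{0}"]) (auto simp: f_def)
  ultimately show ?thesis by blast
qed

text \<open>For the indicator of [-K, K] the left side grows at least like K^{1/q}, the right side
  like K^{n/p}.\<close>

lemma exponent_necessary:
  fixes n :: nat and p :: ereal and q C :: real
  assumes n: "n \<ge> 4" and q: "1 \<le> q" and p: "1 \<le> p"
    and bound: "\<And>f :: nat \<Rightarrow> int \<Rightarrow> complex. (\<forall>i<n. in_lp p (f i)) \<Longrightarrow>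
               in_lp (ereal q) (sph_max n f) \<and> lp_norm (ereal q) (sph_max n f) \<le> C * (\<Prod>i<n. lp_norm p (f i))"
  shows "p \<le> ereal (real n * q)"
proof (rule ccontr)
  assume "\<not> p \<le> ereal (real n * q)"
  then have np: "ereal (real n * q) < p" by simp
  \<comment> \<open>The exponent n/p of the right side, read as 0 for infinite p; p > nq means that
    it is below 1/q.\<close>
  define \<theta> where "\<theta> = (if p = \<infinity> then 0 else real n / real_of_ereal p)"
  have \<theta>: "\<theta> < 1 / q"
  proof (cases p)
    case (real p')
    have "0 < real n * q" using n q by simp
    moreover have "real n * q < p'" using np real by simp
    ultimately have "real n / p' < real n / (real n * q)" using n by (intro divide_strict_left_mono) auto
    then show ?thesis using n real by (simp add: \<theta>_def)
  qed (use q p in \<open>auto simp: \<theta>_def\<close>)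
  have ineq: "(2 * real K - 1) powr (1 / q) \<le> C * (2 * real K + 1) powr \<theta>" if K: "1 \<le> K" for K :: nat
  proof -
    define A where "A = {-int K..int K}"
    define f where "f = (\<lambda>(i::nat) x. if x \<in> A then 1 else 0 :: complex)"
    have b: "norm (f i m) \<le> 1" for i m by (simp add: f_def)
    have inp: "\<forall>i<n. in_lp p (f i)"
      by (intro allI impI, rule in_lp_finite_support[of A]) (auto simp: f_def A_def)
    have nf: "lp_norm p (f i) = (if p = \<infinity> then 1 else (2 * real K + 1) powr (1 / real_of_ereal p))" for i
    proof (cases "p = \<infinity>")
      case True
      have "range (\<lambda>x. norm (f i x)) = {0, 1}"
      proof -
        have "norm (f i (int K + 1)) = 0" "norm (f i 0) = 1" by (simp_all add: f_def A_def)
        then have "{0, 1} \<subseteq> range (\<lambda>x. norm (f i x))" by (metis empty_subsetI insert_subset rangeI)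
        moreover have "range (\<lambda>x. norm (f i x)) \<subseteq> {0, 1}"
          by (rule image_subsetI) (simp add: f_def)
        ultimately show ?thesis by blast
      qed
      then show ?thesis using True by (simp add: lp_norm_def cSup_eq_Max)
    next
      case False
      have "f i x = 0" if "x \<notin> A" for x using that by (simp add: f_def)
      then have "(\<Sum>\<^sub>\<infinity>x. norm (f i x) powr real_of_ereal p) = (\<Sum>\<^sub>\<infinity>x\<in>A. norm (f i x) powr real_of_ereal p)"
        by (intro infsum_cong_neutral) auto
      also have "\<dots> = (\<Sum>x\<in>A. 1)" by (subst infsum_finite) (auto simp: f_def A_def)
      also have "\<dots> = 2 * real K + 1" by (simp add: A_def)
      finally show ?thesis using False by (simp add: lp_norm_def)
    qed
    have prod_nf: "(\<Prod>i<n. lp_norm p (f i)) = (2 * real K + 1) powr \<theta>"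
    proof (cases "p = \<infinity>")
      case False
      then have "(\<Prod>i<n. lp_norm p (f i)) = ((2 * real K + 1) powr (1 / real_of_ereal p)) ^ n" by (simp add: nf)
      then show ?thesis using False n by (simp add: \<theta>_def powr_power)
    next
      case True
      then have "\<theta> = 0" by (simp add: \<theta>_def)
      moreover have "lp_norm p (f i) = 1" for i unfolding nf by (rule if_P[OF True])
      ultimately show ?thesis using K by simp
    qed
    \<comment> \<open>Points of the unit sphere have coordinates of size at most 1, so for y in the
      interval shortened by one at each end all \<open>y - x i\<close> stay in \<open>A\<close> and
      the average equals 1.\<close>
    have ge1: "1 \<le> sph_max n f y" if y: "y \<in> {-(int K - 1)..int K - 1}" for y
    proof -
      have "(\<Prod>i<n. f i (y - x i)) = 1" if x: "x \<in> sphere_pts n 1" for x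
      proof (rule prod.neutral, rule ballI)
        fix i
        have "\<bar>x i\<bar> \<le> 1" using int_le_square[of "x i"] sphere_pts_coord_le[OF x, of i] by linarith
        then have "y - x i \<in> A" using y by (auto simp: A_def)
        then show "f i (y - x i) = 1" by (simp add: f_def)
      qed
      then have "(\<Sum>x\<in>sphere_pts n 1. \<Prod>i<n. f i (y - x i)) = of_nat (r_count n 1)" by (simp add: r_count_def)
      moreover have "r_count n 1 \<noteq> 0"
      proof -
        have "(\<Sum>i<n. (if i = 0 then 1 else 0 :: int)\<^sup>2) = (\<Sum>i<n. if i = 0 then 1 else 0)" by (intro sum.cong) auto
        also have "\<dots> = 1" using n by (simp add: sum.delta)
        finally have "(\<lambda>i. if i = 0 then 1 else 0) \<in> sphere_pts n 1" using n by (simp add: sphere_pts_def)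
        then show ?thesis using finite_sphere_pts[of n 1] by (auto simp: r_count_def)
      qed
      ultimately have "norm (sph_avg n 1 f y) = 1" by (simp add: sph_avg_def)
      moreover have "norm (sph_avg n 1 f y) \<le> sph_max n f y"
        by (rule norm_sph_avg_le_sph_max[where b = "\<lambda>_. 1"]) (use b in auto)
      ultimately show ?thesis by simp
    qed
    \<comment> \<open>Summability has to come from the assumed bound: without it
      \<open>infsum\<close> is 0 by convention and would not dominate the finite sums below.\<close>
    have s: "(\<lambda>y. norm (sph_max n f y) powr q) summable_on UNIV" using bound[OF inp] by (simp add: in_lp_def)
    have "2 * real K - 1 = (\<Sum>y\<in>{-(int K - 1)..int K - 1}. 1)" using K by (simp add: of_nat_diff nat_diff_distrib)
    also have "\<dots> \<le> (\<Sum>y\<in>{-(int K - 1)..int K - 1}. norm (sph_max n f y) powr q)"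
    proof (rule sum_mono)
      fix y assume "y \<in> {-(int K - 1)..int K - 1}"
      then have "1 \<le> norm (sph_max n f y)" using ge1[of y] by simp
      then show "1 \<le> norm (sph_max n f y) powr q" using q by (intro ge_one_powr_ge_zero) auto
    qed
    also have "\<dots> \<le> (\<Sum>\<^sub>\<infinity>y. norm (sph_max n f y) powr q)" by (intro finite_sum_le_infsum s) auto
    finally have "(2 * real K - 1) powr (1 / q) \<le> lp_norm (ereal q) (sph_max n f)"
      using K q by (simp add: lp_norm_def) (intro powr_mono2, auto)
    also have "\<dots> \<le> C * (2 * real K + 1) powr \<theta>" using bound[OF inp] by (simp add: prod_nf)
    finally show ?thesis .
  qed
  define \<delta> where "\<delta> = 1 / q - \<theta>"
  have \<delta>: "\<delta> > 0" using \<theta> by (simp add: \<delta>_def)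
  define X where "X = C * 3 powr (1 / q)"
  have key: "(2 * real K + 1) powr \<delta> \<le> X" if K: "1 \<le> K" for K :: nat
  proof -
    let ?t = "2 * real K + 1"
    have t: "0 < ?t" by simp
    have "?t \<le> 3 * (2 * real K - 1)" using K by simp
    then have "?t powr (1 / q) \<le> (3 * (2 * real K - 1)) powr (1 / q)" using q by (intro powr_mono2) auto
    also have "\<dots> = 3 powr (1 / q) * (2 * real K - 1) powr (1 / q)" by (rule powr_mult)
    also have "\<dots> \<le> 3 powr (1 / q) * (C * ?t powr \<theta>)" by (intro mult_left_mono ineq K) simp
    finally have "?t powr (1 / q) \<le> X * ?t powr \<theta>" by (simp add: X_def mult_ac)
    moreover have "?t powr (1 / q) = ?t powr \<delta> * ?t powr \<theta>" by (simp add: powr_add[symmetric] \<delta>_def)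
    ultimately have "?t powr \<delta> * ?t powr \<theta> \<le> X * ?t powr \<theta>" by simp
    then show ?thesis using t by (simp add: mult_le_cancel_right)
  qed
  have X: "0 < X"
  proof -
    have "0 < (2 * real 1 + 1) powr \<delta>" by simp
    also have "\<dots> \<le> X" by (rule key) simp
    finally show ?thesis .
  qed
  obtain K :: nat where K: "X powr (1 / \<delta>) < real K" using reals_Archimedean2 by blast
  have "0 < X powr (1 / \<delta>)" using X by simp
  then have K1: "1 \<le> K" using K by (metis less_trans of_nat_0_less_iff Suc_le_eq One_nat_def)
  have "X = (X powr (1 / \<delta>)) powr \<delta>" using X \<delta> by (simp add: powr_powr)
  also have "\<dots> < (2 * real K + 1) powr \<delta>" using K \<delta> by (intro powr_less_mono2) auto
  finally show False using key[OF K1] by simp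
qed

theorem theorem1:
  fixes n :: nat and p :: ereal and q :: real
  assumes "n \<ge> 4" and "1 \<le> q" and "1 \<le> p"
  shows "(\<exists>C::real. \<forall>f :: nat \<Rightarrow> int \<Rightarrow> complex.
             (\<forall>i<n. in_lp p (f i)) \<longrightarrow>
               in_lp (ereal q) (sph_max n f) \<and>
               lp_norm (ereal q) (sph_max n f) \<le> C * (\<Prod>i<n. lp_norm p (f i)))
         \<longleftrightarrow> (n \<ge> 5 \<and> p \<le> ereal (real n * q))"
proof
  assume "\<exists>C::real. \<forall>f :: nat \<Rightarrow> int \<Rightarrow> complex.
             (\<forall>i<n. in_lp p (f i)) \<longrightarrow>
               in_lp (ereal q) (sph_max n f) \<and>
               lp_norm (ereal q) (sph_max n f) \<le> C * (\<Prod>i<n. lp_norm p (f i))"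
  then obtain C where C: "\<And>f :: nat \<Rightarrow> int \<Rightarrow> complex. (\<forall>i<n. in_lp p (f i)) \<Longrightarrow>
               in_lp (ereal q) (sph_max n f) \<and> lp_norm (ereal q) (sph_max n f) \<le> C * (\<Prod>i<n. lp_norm p (f i))"
    by blast
  \<comment> \<open>In dimension four membership in l^q already fails, whatever C is.\<close>
  have "n \<noteq> 4" using C sph_max_unbounded_dim_4[OF assms(2), of p] by blast
  moreover have "p \<le> ereal (real n * q)" by (rule exponent_necessary[OF assms C])
  ultimately show "n \<ge> 5 \<and> p \<le> ereal (real n * q)" using assms(1) by simp
next
  assume *: "n \<ge> 5 \<and> p \<le> ereal (real n * q)"
  \<comment> \<open>The bound by the finite number nq excludes an infinite p.\<close>
  then obtain p' where p': "p = ereal p'" using assms(3) by (cases p) auto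
  show "\<exists>C::real. \<forall>f :: nat \<Rightarrow> int \<Rightarrow> complex.
             (\<forall>i<n. in_lp p (f i)) \<longrightarrow>
               in_lp (ereal q) (sph_max n f) \<and>
               lp_norm (ereal q) (sph_max n f) \<le> C * (\<Prod>i<n. lp_norm p (f i))"
    unfolding p' by (rule sph_max_bounded) (use * assms p' in auto)
qed

end
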